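(* Let $\alpha\in(-1,1)$. Let $\varphi$ be a univalent holomorphic self-map of $\mathbb{D}$ with a fixed point $a \in \mathbb{D}$, and satisfying $\varphi'' \in H^{\infty}(\mathbb{D})$. Let $\psi \in \mathrm{Hol}(\mathbb{D})$, $\psi\not\equiv 0$, be such that (i) $\lim_{|z|\to 1^-}|\psi''(z)|(1-|z|^2)=0$, (ii) $\lim_{|z|\to 1^-}|\psi(z)|\left(\frac{1-|z|^2}{1-|\varphi(z)|^2}\right)^{\frac{\alpha}{2}+1}=0$. Then $0<|\varphi'(a)|<1$ and $$\sigma(C_{\psi,\varphi};\mathcal{D}_{\alpha})=\left\{\psi(a)(\varphi'(a))^n: n \in \mathbb{N} \cup \{0\} \right\}\cup \{0\}.$$ Furthermore, if $\psi(a)=0$ then $\sigma(C_{\psi,\varphi};\mathcal{D}_{\alpha})=\{0\}$.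
   Context: $\mathbb{D}=\{z\in\mathbb{C}:|z|<1\}$; $\mathrm{Hol}(\mathbb{D})$ is the space of complex-valued holomorphic functions on $\mathbb{D}$ and $H^\infty(\mathbb{D})$ the space of bounded ones. A holomorphic self-map of $\mathbb{D}$ is $\varphi\in\mathrm{Hol}(\mathbb{D})$ with $\varphi(\mathbb{D})\subseteq\mathbb{D}$; univalent means injective. For $\psi\in\mathrm{Hol}(\mathbb{D})$ and a holomorphic self-map $\varphi$, the weighted composition operator is $C_{\psi,\varphi}f=\psi\,(f\circ\varphi)$ for $f\in\mathrm{Hol}(\mathbb{D})$. For $\alpha\in\mathbb{R}$, the weighted Dirichlet space $\mathcal{D}_\alpha$ is the Hilbert space of all $f(z)=\sum_{n\ge 0}a_nz^n\in\mathrm{Hol}(\mathbb{D})$ with $\|f\|_{\mathcal{D}_\alpha}^2=\sum_{n\ge 0}(n+1)^{1-\alpha}|a_n|^2<\infty$, with inner product $\langle f,g\rangle_{\mathcal{D}_\alpha}=\sum_{n\ge 0}(n+1)^{1-\alpha}a_n\overline{b_n}$ for $g(z)=\sum_{n\ge0} b_nz^n$. $\sigma(T;\mathcal{D}_\alpha)$ denotes the spectrum of $T$ as a bounded linear operator on $\mathcal{D}_\alpha$. *)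

theory Defs
  imports "HOL-Complex_Analysis.Complex_Analysis" "HOL-Library.Going_To_Filter"
begin

abbreviation unit_disc :: "complex set" where
  "unit_disc \<equiv> ball 0 1"

definition bounded_holomorphic :: "(complex \<Rightarrow> complex) set" where
  "bounded_holomorphic = {f. f holomorphic_on unit_disc \<and> bounded (f ` unit_disc)}"

definition holomorphic_self_map :: "(complex \<Rightarrow> complex) \<Rightarrow> bool" where
  "holomorphic_self_map \<phi> \<longleftrightarrow> \<phi> holomorphic_on unit_disc \<and> \<phi> ` unit_disc \<subseteq> unit_disc"

definition taylor_coeff :: "(complex \<Rightarrow> complex) \<Rightarrow> nat \<Rightarrow> complex" where
  "taylor_coeff f n = fps_nth (fps_expansion f 0) n"

text \<open>
  HOL functions are total, so a holomorphic function on the disc is represented by the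
  unique extension that vanishes outside the disc. With this convention two elements of
  the space are equal as HOL functions iff they agree on the disc.
\<close>

definition hol_disc :: "(complex \<Rightarrow> complex) set" where
  "hol_disc = {f. f holomorphic_on unit_disc \<and> (\<forall>z. z \<notin> unit_disc \<longrightarrow> f z = 0)}"

definition dirichlet_space :: "real \<Rightarrow> (complex \<Rightarrow> complex) set" where
  "dirichlet_space \<alpha> = {f \<in> hol_disc.
     summable (\<lambda>n. (real n + 1) powr (1 - \<alpha>) * (norm (taylor_coeff f n))\<^sup>2)}"

definition dirichlet_norm :: "real \<Rightarrow> (complex \<Rightarrow> complex) \<Rightarrow> real" where
  "dirichlet_norm \<alpha> f =
     sqrt (\<Sum>n. (real n + 1) powr (1 - \<alpha>) * (norm (taylor_coeff f n))\<^sup>2)"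

definition bounded_operator ::
    "real \<Rightarrow> ((complex \<Rightarrow> complex) \<Rightarrow> (complex \<Rightarrow> complex)) \<Rightarrow> bool" where
  "bounded_operator \<alpha> T \<longleftrightarrow>
     (\<forall>f \<in> dirichlet_space \<alpha>. T f \<in> dirichlet_space \<alpha>) \<and>
     (\<forall>f \<in> dirichlet_space \<alpha>. \<forall>g \<in> dirichlet_space \<alpha>.
        T (\<lambda>z. f z + g z) = (\<lambda>z. T f z + T g z)) \<and>
     (\<forall>c. \<forall>f \<in> dirichlet_space \<alpha>. T (\<lambda>z. c * f z) = (\<lambda>z. c * T f z)) \<and>
     (\<exists>K. \<forall>f \<in> dirichlet_space \<alpha>. dirichlet_norm \<alpha> (T f) \<le> K * dirichlet_norm \<alpha> f)"

text \<open>
  The complement consists of those \<open>\<lambda>\<close> for which \<open>\<lambda>I - T\<close> has a two-sided inverse \<open>S\<close>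
  among the bounded operators. The notion is meaningful for bounded \<open>T\<close>.
\<close>

definition operator_spectrum ::
    "real \<Rightarrow> ((complex \<Rightarrow> complex) \<Rightarrow> (complex \<Rightarrow> complex)) \<Rightarrow> complex set" where
  "operator_spectrum \<alpha> T = {l. \<not> (\<exists>S. bounded_operator \<alpha> S \<and>
     (\<forall>f \<in> dirichlet_space \<alpha>. S (\<lambda>z. l * f z - T f z) = f) \<and>
     (\<forall>f \<in> dirichlet_space \<alpha>. (\<lambda>z. l * S f z - T (S f) z) = f))}"

text \<open>The value outside the disc is the one prescribed by \<^const>\<open>hol_disc\<close>.\<close>

definition weighted_comp ::
    "(complex \<Rightarrow> complex) \<Rightarrow> (complex \<Rightarrow> complex) \<Rightarrow> (complex \<Rightarrow> complex) \<Rightarrow> (complex \<Rightarrow> complex)"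
  where "weighted_comp \<psi> \<phi> f = (\<lambda>z. if z \<in> unit_disc then \<psi> z * f (\<phi> z) else 0)"

end

theory Submission
  imports Defs
begin

text \<open>
  Write \<open>T\<close> for the weighted composition operator \<open>f \<mapsto> \<psi> \<cdot> (f \<circ> \<phi>)\<close>. With respect to the order of
  vanishing at the fixed point \<open>a\<close> it is triangular: if \<open>f = (z - a)\<^sup>n g\<close>, then \<open>T f = (z - a)\<^sup>n h\<close>
  with \<open>h a = \<psi> a \<cdot> (\<phi>' a)\<^sup>n \<cdot> g a\<close>. The numbers on this diagonal lie in the spectrum, as one sees by
  comparing the first coefficients in \<open>\<lambda> f - T f = (z - a)\<^sup>n\<close>. The remaining claims rest on one analytic
  fact: on the functions vanishing to order \<open>n\<close> at \<open>a\<close> the norm of \<open>T\<close> tends to 0 as \<open>n\<close> grows. Hence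
  \<open>T\<close> is not bounded below and 0 is in the spectrum; and if \<open>\<lambda> \<noteq> 0\<close> is not on the diagonal, then
  \<open>\<lambda> - T\<close> is inverted by a Neumann series on a subspace of high order of vanishing, and the inverse
  extends to the whole space by adding one dimension at a time, each step dividing by
  \<open>\<lambda> - \<psi> a \<cdot> (\<phi>' a)\<^sup>k\<close>. This is the locale \<open>small_triangular_operator\<close>; it takes the place of the
  spectral theory of compact operators.

  The analytic fact follows from \<open>coeff_energy_weighted_comp_small\<close>. For every \<open>\<epsilon> > 0\<close> it bounds the
  squared norm of \<open>T f\<close> by \<open>\<epsilon>\<close> times the squared norm of \<open>f\<close> plus a constant times the weaker sum
  \<open>\<Sum>n. (n + 1) powr (- \<alpha>) \<cdot> \<bar>a\<^sub>n\<bar>\<^sup>2\<close>, which gains the factor \<open>1 / (n + 1)\<close> when the first \<open>n\<close> coefficients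
  vanish. To prove it, the squared norm is replaced by
  \<open>\<bar>f 0\<bar>\<^sup>2 + \<bar>f' 0\<bar>\<^sup>2 + \<integral> \<bar>f''\<bar>\<^sup>2 (1 - \<bar>z\<bar>\<^sup>2) powr (\<alpha> + 2)\<close> over the disc. The second derivative of \<open>T f\<close> is
  \<open>\<psi>'' \<cdot> (f \<circ> \<phi>) + (2 \<psi>' \<phi>' + \<psi> \<phi>'') \<cdot> (f' \<circ> \<phi>) + \<psi> \<phi>'\<^sup>2 \<cdot> (f'' \<circ> \<phi>)\<close>. The first hypothesis on \<open>\<psi>\<close> controls
  \<open>\<psi>''\<close>, \<open>\<psi>'\<close> and \<open>\<psi>\<close> well enough that the first two terms are of lower order. In the last term the
  second hypothesis on \<open>\<psi>\<close> makes the weight small near the circle, and since \<open>\<phi>\<close> is injective,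
  the change of variables \<open>w = \<phi> z\<close> turns the factor \<open>\<bar>\<phi>'\<bar>\<^sup>2\<close> into area measure on the image.

  Functions vanishing at the origin are easier to handle than functions vanishing at \<open>a\<close>, so \<open>T\<close> is
  conjugated by a Moebius transformation; its composition operator is bounded by the same estimate
  with \<open>\<psi> = 1\<close>. Finally \<open>\<phi>' a \<noteq> 0\<close> by injectivity and \<open>\<bar>\<phi>' a\<bar> \<le> 1\<close> by the Schwarz lemma. Equality would
  make \<open>\<phi>\<close> conjugate to a rotation; then \<open>(1 - \<bar>z\<bar>\<^sup>2) / (1 - \<bar>\<phi> z\<bar>\<^sup>2)\<close> would be bounded below, and the second
  hypothesis would force \<open>\<psi>\<close> to tend to 0 at the circle, so \<open>\<psi>\<close> would vanish identically.
\<close>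

unbundle no fps_syntax

section \<open>Change of variables under injective holomorphic maps\<close>

lemma lborel_complex_eq_distr_vec2:
  "distr lborel borel (\<lambda>v::real^2. Complex (v$1) (v$2)) = (lborel :: complex measure)"
proof (rule lborel_eqI[symmetric])
  let ?C = "\<lambda>v::real^2. Complex (v$1) (v$2)"
  have meas [measurable]: "?C \<in> borel_measurable borel"
    by (intro borel_measurable_continuous_onI) (auto simp: Complex_eq intro!: continuous_intros)
  fix l u :: complex assume le: "\<And>b. b \<in> Basis \<Longrightarrow> l \<bullet> b \<le> u \<bullet> b"
  have le': "Re l \<le> Re u" "Im l \<le> Im u"
    using le[of 1] le[of \<i>] by (auto simp: Basis_complex_def)
  have eq: "?C -` box l u = box (vector [Re l, Im l]) (vector [Re u, Im u])"
    by (auto simp: mem_box_cart in_box_complex_iff forall_2)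
  have "emeasure (distr lborel borel ?C) (box l u) = emeasure lborel (?C -` box l u)"
    by (subst emeasure_distr) auto
  also have "\<dots> = ennreal ((Re u - Re l) * (Im u - Im l))"
    unfolding eq using le'
    by (subst emeasure_lborel_box) (auto simp: Basis_vec_def UNIV_2 inner_axis prod.union_disjoint axis_eq_axis)
  also have "\<dots> = ennreal (\<Prod>b\<in>Basis. (u - l) \<bullet> b)"
    by (simp add: Basis_complex_def complex_eq_iff)
  finally show "emeasure (distr lborel borel ?C) (box l u) = (\<Prod>b\<in>Basis. (u - l) \<bullet> b)" .
qed simp

text \<open>
  The change-of-variables theorem for Lebesgue measurable images covers finite measures; the
  case of infinite measure is added here, so that the formula holds in the extended nonnegative
  reals.
\<close>

lemma emeasure_differentiable_image:
  fixes f :: "real^'n::{finite,wellorder} \<Rightarrow> real^'n::_"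
  assumes S: "S \<in> sets lebesgue"
    and der: "\<And>x. x \<in> S \<Longrightarrow> (f has_derivative f' x) (at x within S)"
    and inj: "inj_on f S"
    and fS: "f ` S \<in> sets lebesgue"
    and meas: "(\<lambda>x. \<bar>det (matrix (f' x))\<bar>) \<in> borel_measurable (lebesgue_on S)"
  shows "emeasure lebesgue (f ` S) = (\<integral>\<^sup>+x\<in>S. ennreal \<bar>det (matrix (f' x))\<bar> \<partial>lebesgue)"
proof -
  let ?J = "\<lambda>x. \<bar>det (matrix (f' x))\<bar>"
  have eq: "(\<integral>\<^sup>+x\<in>S. ennreal (?J x) \<partial>lebesgue) = (\<integral>\<^sup>+x. ennreal (?J x) \<partial>lebesgue_on S)"
    using S by (subst nn_integral_restrict_space) auto
  show ?thesis
  proof (cases "(\<integral>\<^sup>+x. ennreal (?J x) \<partial>lebesgue_on S) < \<infinity>")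
    case True
    have int: "integrable (lebesgue_on S) ?J"
      using meas True by (subst integrable_iff_bounded) auto
    have "(?J has_integral (integral\<^sup>L (lebesgue_on S) ?J)) S"
      using has_integral_integral_lebesgue_on[OF int S] .
    then have *: "f ` S \<in> lmeasurable" "measure lebesgue (f ` S) = integral\<^sup>L (lebesgue_on S) ?J"
      using has_measure_differentiable_image[OF S der inj] by auto
    have "emeasure lebesgue (f ` S) = ennreal (integral\<^sup>L (lebesgue_on S) ?J)"
      using * by (simp add: emeasure_eq_measure2)
    also have "\<dots> = (\<integral>\<^sup>+x. ennreal (?J x) \<partial>lebesgue_on S)"
      by (rule nn_integral_eq_integral[OF int, symmetric]) auto
    finally show ?thesis using eq by simp
  next
    case False
    have "f ` S \<notin> lmeasurable"
    proof
      assume "f ` S \<in> lmeasurable"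
      then have "?J absolutely_integrable_on S"
        using measurable_differentiable_image_alt[OF S der inj] by auto
      then have "integrable (lebesgue_on S) ?J"
        using S by (simp add: absolutely_integrable_on_iff_nonneg integrable_restrict_space set_integrable_def)
      then show False using False by (simp add: integrable_iff_bounded)
    qed
    then have "emeasure lebesgue (f ` S) = \<infinity>"
      using fS by (metis fmeasurableI infinity_ennreal_def top.not_eq_extremum)
    with False eq show ?thesis by (simp add: not_less top_unique)
  qed
qed


lemma borel_measurable_continuous_on_times_indicator:
  fixes f :: "complex \<Rightarrow> real"
  assumes "continuous_on U f" "open U" "A \<subseteq> U" "A \<in> sets borel"
  shows "(\<lambda>z. ennreal (f z) * indicator A z) \<in> borel_measurable borel"
proof -
  have "(\<lambda>z. if z \<in> U then f z else 0) \<in> borel_measurable borel"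
    using assms by (intro borel_measurable_continuous_on_if) auto
  then have "(\<lambda>z. ennreal (if z \<in> U then f z else 0) * indicator A z) \<in> borel_measurable borel"
    using assms(4) by measurable
  also have "(\<lambda>z. ennreal (if z \<in> U then f z else 0) * indicator A z) = (\<lambda>z. ennreal (f z) * indicator A z)"
    using assms(3) by (auto simp: indicator_def fun_eq_iff)
  finally show ?thesis .
qed

text \<open>
  The complex plane is identified with the space of real pairs. The real derivative of a
  holomorphic function is multiplication by \<open>g'\<close>, whose determinant is \<open>\<bar>g'\<bar>\<^sup>2\<close>.
\<close>

lemma emeasure_injective_holomorphic_image:
  assumes U: "open U" and g: "g holomorphic_on U" and inj: "inj_on g U"
    and A: "A \<subseteq> U" "A \<in> sets borel"
  shows "g ` A \<in> sets borel"
    and "emeasure lborel (g ` A) = (\<integral>\<^sup>+z\<in>A. ennreal ((norm (deriv g z))\<^sup>2) \<partial>lborel)"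
proof -
  obtain h where h: "h holomorphic_on (g ` U)" "\<And>z. z \<in> U \<Longrightarrow> h (g z) = z"
    using holomorphic_has_inverse[OF g U inj] by metis
  have op: "open (g ` U)"
    using invariance_of_domain[OF holomorphic_on_imp_continuous_on[OF g] U inj] .
  have "g ` A = g ` U \<inter> (\<lambda>w. if w \<in> g ` U then h w else 0) -` A"
    using A(1) h(2) by fastforce
  moreover have "(\<lambda>w. if w \<in> g ` U then h w else 0) \<in> borel_measurable borel"
    using op by (intro borel_measurable_continuous_on_if holomorphic_on_imp_continuous_on h) auto
  ultimately show gA: "g ` A \<in> sets borel"
    using op A(2) by (auto intro!: sets.Int dest: measurable_sets_borel)
  let ?C = "\<lambda>v::real^2. Complex (v$1) (v$2)"
  define R :: "complex \<Rightarrow> real^2" where "R = (\<lambda>z. vector [Re z, Im z])"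
  have [measurable]: "?C \<in> borel_measurable borel"
    by (intro borel_measurable_continuous_onI) (auto simp: Complex_eq intro!: continuous_intros)
  have CR [simp]: "?C (R z) = z" and RC [simp]: "R (?C v) = v" for z v
    by (auto simp: R_def vec_eq_iff forall_2)
  have linR: "bounded_linear R"
    unfolding linear_conv_bounded_linear[symmetric]
    by (auto intro!: linearI simp: R_def vec_eq_iff forall_2)
  have linC: "bounded_linear ?C"
    unfolding linear_conv_bounded_linear[symmetric]
    by (auto intro!: linearI simp: complex_eq_iff)
  let ?S = "?C -` A"
  let ?f = "\<lambda>x. R (g (?C x))"
  let ?f' = "\<lambda>x y. R (deriv g (?C x) * ?C y)"
  have S: "?S \<in> sets borel"
    using A(2) by (rule measurable_sets_borel[rotated]) auto
  have fS: "?f ` ?S = ?C -` (g ` A)"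
  proof (intro equalityI subsetI)
    fix x assume "x \<in> ?C -` (g ` A)"
    then obtain z where "z \<in> A" "g z = ?C x" by auto
    then have "x = ?f (R z)" "R z \<in> ?S" by auto
    then show "x \<in> ?f ` ?S" by blast
  qed auto
  have fSb: "?f ` ?S \<in> sets borel"
    unfolding fS using gA by (rule measurable_sets_borel[rotated]) auto
  have der: "(?f has_derivative ?f' x) (at x within ?S)" if "x \<in> ?S" for x
  proof -
    have "(g has_field_derivative deriv g (?C x)) (at (?C x))"
      using that A(1) g U by (intro holomorphic_derivI[of g U]) auto
    then have "(g has_derivative (\<lambda>y. deriv g (?C x) * y)) (at (?C x))"
      by (simp add: has_field_derivative_def)
    moreover have "(?C has_derivative ?C) (at x within ?S)"
      using linC by (rule bounded_linear_imp_has_derivative)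
    ultimately have "((\<lambda>x. g (?C x)) has_derivative (\<lambda>y. deriv g (?C x) * ?C y)) (at x within ?S)"
      using has_derivative_compose by blast
    then show ?thesis
      by (rule bounded_linear.has_derivative[OF linR])
  qed
  have injf: "inj_on ?f ?S"
  proof (rule inj_onI)
    fix x y assume xy: "x \<in> ?S" "y \<in> ?S" "?f x = ?f y"
    then have "g (?C x) = g (?C y)" by (metis CR)
    then have "?C x = ?C y" using xy A(1) inj by (auto dest: inj_onD)
    then show "x = y" by (metis RC)
  qed
  have detf: "\<bar>det (matrix (?f' x))\<bar> = (norm (deriv g (?C x)))\<^sup>2" for x
    unfolding det_2 matrix_def R_def
    by (simp add: axis_def cmod_power2) (simp add: power2_eq_square)
  have cont: "continuous_on U (\<lambda>z. (norm (deriv g z))\<^sup>2)"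
    by (intro continuous_intros holomorphic_on_imp_continuous_on holomorphic_deriv g U)
  have G: "(\<lambda>z. ennreal ((norm (deriv g z))\<^sup>2) * indicator A z) \<in> borel_measurable borel"
    by (rule borel_measurable_continuous_on_times_indicator[OF cont U A])
  have contS: "continuous_on (?C -` U) (\<lambda>x. \<bar>det (matrix (?f' x))\<bar>)"
    unfolding detf
    by (rule continuous_on_compose2[OF cont]) (auto simp: Complex_eq intro!: continuous_intros)
  have opCU: "open (?C -` U)"
    by (rule open_vimage[OF U]) (auto simp: Complex_eq intro!: continuous_intros)
  have "(\<lambda>x. if x \<in> ?C -` U then \<bar>det (matrix (?f' x))\<bar> else 0) \<in> borel_measurable borel"
    using contS opCU by (intro borel_measurable_continuous_on_if) auto
  then have "(\<lambda>x. if x \<in> ?C -` U then \<bar>det (matrix (?f' x))\<bar> else 0) \<in> borel_measurable lebesgue"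
    by (intro measurable_completion) simp
  then have "(\<lambda>x. if x \<in> ?C -` U then \<bar>det (matrix (?f' x))\<bar> else 0) \<in> borel_measurable (lebesgue_on ?S)"
    by (rule measurable_restrict_space1)
  then have meas: "(\<lambda>x. \<bar>det (matrix (?f' x))\<bar>) \<in> borel_measurable (lebesgue_on ?S)"
    by (rule measurable_cong[THEN iffD1, rotated]) (use A(1) in auto)
  have "emeasure lborel (g ` A) = emeasure (distr lborel borel ?C) (g ` A)"
    by (simp add: lborel_complex_eq_distr_vec2)
  also have "\<dots> = emeasure lborel (?f ` ?S)"
    using gA by (subst emeasure_distr) (auto simp: fS)
  also have "\<dots> = emeasure lebesgue (?f ` ?S)"
    using fSb by (simp add: main_part_sets)
  also have "\<dots> = (\<integral>\<^sup>+x\<in>?S. ennreal \<bar>det (matrix (?f' x))\<bar> \<partial>lebesgue)"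
    by (rule emeasure_differentiable_image[OF _ der injf _ meas]) (use S fSb in auto)
  also have "\<dots> = (\<integral>\<^sup>+x. ennreal ((norm (deriv g (?C x)))\<^sup>2) * indicator A (?C x) \<partial>lborel)"
    unfolding detf by (subst nn_integral_completion) (auto intro!: nn_integral_cong simp: indicator_def)
  also have "\<dots> = (\<integral>\<^sup>+z. ennreal ((norm (deriv g z))\<^sup>2) * indicator A z \<partial>distr lborel borel ?C)"
    using G by (subst nn_integral_distr) auto
  finally show "emeasure lborel (g ` A) = (\<integral>\<^sup>+z\<in>A. ennreal ((norm (deriv g z))\<^sup>2) \<partial>lborel)"
    by (simp add: lborel_complex_eq_distr_vec2)
qed

text \<open>
  The previous lemma says that two measures agree: the image under \<open>g\<close> of the measure with
  density \<open>\<bar>g'\<bar>\<^sup>2\<close> on \<open>U\<close>, and area measure on \<open>g ` U\<close>.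
\<close>

theorem nn_integral_injective_holomorphic_image:
  assumes U: "open U" and g: "g holomorphic_on U" and inj: "inj_on g U"
    and F: "F \<in> borel_measurable borel"
  shows "(\<integral>\<^sup>+w\<in>g ` U. F w \<partial>lborel) = (\<integral>\<^sup>+z\<in>U. F (g z) * ennreal ((norm (deriv g z))\<^sup>2) \<partial>lborel)"
proof -
  define G where "G = (\<lambda>z. if z \<in> U then g z else 0)"
  define J where "J = (\<lambda>z. ennreal ((norm (deriv g z))\<^sup>2) * indicator U z)"
  have [measurable]: "G \<in> borel_measurable borel"
    unfolding G_def using U by (intro borel_measurable_continuous_on_if holomorphic_on_imp_continuous_on g) auto
  have cont: "continuous_on U (\<lambda>z. (norm (deriv g z))\<^sup>2)"
    by (intro continuous_intros holomorphic_on_imp_continuous_on holomorphic_deriv g U)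
  have [measurable]: "U \<in> sets borel" using U by auto
  have [measurable]: "g ` U \<in> sets borel"
    by (rule emeasure_injective_holomorphic_image[OF U g inj]) auto
  have [measurable]: "J \<in> borel_measurable borel"
    unfolding J_def by (rule borel_measurable_continuous_on_times_indicator[OF cont U]) auto
  have "distr (density lborel J) borel G = density lborel (indicator (g ` U))"
  proof (rule measure_eqI)
    fix B assume "B \<in> sets (distr (density lborel J) borel G)"
    then have [measurable]: "B \<in> sets borel" by simp
    have [measurable]: "G -` B \<in> sets borel"
      using measurable_sets_borel[of G borel B] by simp
    have "emeasure (distr (density lborel J) borel G) B = (\<integral>\<^sup>+z. J z * indicator (G -` B) z \<partial>lborel)"
      by (simp add: emeasure_distr emeasure_density)
    also have "\<dots> = (\<integral>\<^sup>+z\<in>U \<inter> G -` B. ennreal ((norm (deriv g z))\<^sup>2) \<partial>lborel)"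
      by (intro nn_integral_cong) (auto simp: J_def indicator_def)
    also have "\<dots> = emeasure lborel (g ` (U \<inter> G -` B))"
      by (rule emeasure_injective_holomorphic_image(2)[OF U g inj, symmetric]) auto
    also have "g ` (U \<inter> G -` B) = g ` U \<inter> B"
      by (auto simp: G_def)
    also have "emeasure lborel (g ` U \<inter> B) = emeasure (density lborel (indicator (g ` U))) B"
      by (simp add: emeasure_density flip: indicator_inter_arith)
    finally show "emeasure (distr (density lborel J) borel G) B = \<dots>" .
  qed simp
  then have "(\<integral>\<^sup>+w. F w \<partial>density lborel (indicator (g ` U))) = (\<integral>\<^sup>+w. F w \<partial>distr (density lborel J) borel G)"
    by simp
  then have "(\<integral>\<^sup>+w. indicator (g ` U) w * F w \<partial>lborel) = (\<integral>\<^sup>+z. J z * F (G z) \<partial>lborel)"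
    using F by (simp add: nn_integral_distr nn_integral_density)
  also have "\<dots> = (\<integral>\<^sup>+z\<in>U. F (g z) * ennreal ((norm (deriv g z))\<^sup>2) \<partial>lborel)"
    by (intro nn_integral_cong) (auto simp: J_def G_def indicator_def mult.commute)
  finally show ?thesis by (simp add: mult.commute)
qed

section \<open>Polar coordinates on the disc and Parseval's identity\<close>

lemma lborel_complex_eq_distr_pair:
  "distr (lborel \<Otimes>\<^sub>M lborel) borel (\<lambda>(x, y). Complex x y) = (lborel :: complex measure)"
proof (rule lborel_eqI[symmetric])
  let ?C = "\<lambda>(x, y). Complex x y"
  have meas [measurable]: "?C \<in> borel_measurable (lborel \<Otimes>\<^sub>M lborel)"
    unfolding lborel_prod measurable_lborel1 measurable_lborel2
    by (intro borel_measurable_continuous_onI) (auto simp: case_prod_beta Complex_eq intro!: continuous_intros)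
  fix l u :: complex assume le: "\<And>b. b \<in> Basis \<Longrightarrow> l \<bullet> b \<le> u \<bullet> b"
  have le': "Re l \<le> Re u" "Im l \<le> Im u"
    using le[of 1] le[of \<i>] by (auto simp: Basis_complex_def)
  have eq: "?C -` box l u = {Re l<..<Re u} \<times> {Im l<..<Im u}"
    by (auto simp: in_box_complex_iff)
  have "emeasure (distr (lborel \<Otimes>\<^sub>M lborel) borel ?C) (box l u)
      = emeasure (lborel \<Otimes>\<^sub>M lborel) (?C -` box l u)"
    by (subst emeasure_distr) (auto simp: space_pair_measure)
  also have "\<dots> = ennreal ((Re u - Re l) * (Im u - Im l))"
    unfolding eq using le' by (subst lborel.emeasure_pair_measure_Times) (auto simp: ennreal_mult)
  also have "\<dots> = ennreal (\<Prod>b\<in>Basis. (u - l) \<bullet> b)"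
    by (simp add: Basis_complex_def complex_eq_iff)
  finally show "emeasure (distr (lborel \<Otimes>\<^sub>M lborel) borel ?C) (box l u) = (\<Prod>b\<in>Basis. (u - l) \<bullet> b)" .
qed simp

lemma exp_image_strip:
  "exp ` {w. Re w < 0 \<and> \<bar>Im w\<bar> < pi} = {z \<in> unit_disc. Im z \<noteq> 0 \<or> 0 < Re z}"
proof (intro equalityI subsetI)
  fix z assume "z \<in> exp ` {w. Re w < 0 \<and> \<bar>Im w\<bar> < pi}"
  then obtain w where w: "z = exp w" "Re w < 0" "\<bar>Im w\<bar> < pi" by auto
  have "Im z \<noteq> 0 \<or> 0 < Re z"
  proof (cases "Im w = 0")
    case True
    then show ?thesis by (simp add: w Re_exp)
  next
    case False
    then have "sin (Im w) \<noteq> 0"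
      using w(3) sin_gt_zero[of "Im w"] sin_gt_zero[of "- Im w"] by force
    then show ?thesis by (simp add: w Im_exp)
  qed
  then show "z \<in> {z \<in> unit_disc. Im z \<noteq> 0 \<or> 0 < Re z}"
    using w by simp
next
  fix z assume z: "z \<in> {z \<in> unit_disc. Im z \<noteq> 0 \<or> 0 < Re z}"
  then have "z \<noteq> 0" by auto
  then have "Im (Ln z) \<noteq> pi" using z by (auto simp: Im_Ln_eq_pi)
  then have "\<bar>Im (Ln z)\<bar> < pi"
    using mpi_less_Im_Ln[OF \<open>z \<noteq> 0\<close>] Im_Ln_le_pi[OF \<open>z \<noteq> 0\<close>] by auto
  moreover have "Re (Ln z) < 0" using z \<open>z \<noteq> 0\<close> by auto
  ultimately show "z \<in> exp ` {w. Re w < 0 \<and> \<bar>Im w\<bar> < pi}"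
    using \<open>z \<noteq> 0\<close> by (intro image_eqI[of _ _ "Ln z"]) auto
qed

text \<open>
  Polar coordinates in logarithmic form: \<open>exp\<close> maps the half strip injectively onto the disc
  without a radius, and \<open>\<bar>exp' (s + i t)\<bar>\<^sup>2 = exp (2 s)\<close>.
\<close>

lemma nn_integral_disc_log_polar:
  assumes F: "F \<in> borel_measurable borel"
  shows "(\<integral>\<^sup>+z\<in>unit_disc. F z \<partial>lborel) =
    (\<integral>\<^sup>+s\<in>{..<0}. (\<integral>\<^sup>+t\<in>{-pi<..<pi}. F (of_real (exp s) * cis t) \<partial>lborel) * ennreal (exp (2 * s)) \<partial>lborel)"
proof -
  let ?S = "{w. Re w < 0 \<and> \<bar>Im w\<bar> < pi}"
  have opS: "open ?S"
    by (intro open_Collect_conj open_Collect_less continuous_intros)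
  then have [measurable]: "?S \<in> sets borel" by auto
  have inj: "inj_on exp ?S"
    by (rule inj_onI, rule exp_complex_eqI) auto
  have hol: "exp holomorphic_on ?S" by (intro holomorphic_intros)
  have "negligible {z::complex. z \<bullet> \<i> = 0}"
    by (rule negligible_standard_hyperplane) (auto simp: Basis_complex_def)
  then have "{z::complex. z \<bullet> \<i> = 0} \<in> null_sets lebesgue"
    by (simp add: negligible_iff_null_sets)
  moreover have "{z::complex. z \<bullet> \<i> = 0} \<in> sets borel" by measurable
  ultimately have "{z::complex. z \<bullet> \<i> = 0} \<in> null_sets lborel"
    by (simp add: null_sets_completion_iff)
  then have AE: "AE z in lborel. z \<bullet> \<i> \<noteq> 0" by (auto dest: AE_not_in)
  have "(\<integral>\<^sup>+z\<in>unit_disc. F z \<partial>lborel) = (\<integral>\<^sup>+z\<in>exp ` ?S. F z \<partial>lborel)"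
    unfolding exp_image_strip
    by (intro nn_integral_cong_AE eventually_mono[OF AE]) (auto simp: indicator_def)
  also have "\<dots> = (\<integral>\<^sup>+w\<in>?S. F (exp w) * ennreal ((norm (deriv exp w))\<^sup>2) \<partial>lborel)"
    by (rule nn_integral_injective_holomorphic_image[OF opS hol inj F])
  also have "\<dots> = (\<integral>\<^sup>+w. F (exp w) * ennreal (exp (2 * Re w)) * indicator ?S w \<partial>lborel)"
    by (intro nn_integral_cong)
      (simp add: DERIV_imp_deriv[OF DERIV_exp] power2_eq_square flip: exp_add)
  also have "\<dots> = (\<integral>\<^sup>+w. F (exp w) * ennreal (exp (2 * Re w)) * indicator ?S w
                      \<partial>distr (lborel \<Otimes>\<^sub>M lborel) borel (\<lambda>(x, y). Complex x y))"
    by (simp add: lborel_complex_eq_distr_pair)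
  also have "\<dots> = (\<integral>\<^sup>+p. F (of_real (exp (fst p)) * cis (snd p)) * ennreal (exp (2 * fst p)) *
                 (indicator {..<0} (fst p) * indicator {-pi<..<pi} (snd p)) \<partial>(lborel \<Otimes>\<^sub>M lborel))"
  proof (subst nn_integral_distr)
    show "(\<lambda>(x, y). Complex x y) \<in> lborel \<Otimes>\<^sub>M lborel \<rightarrow>\<^sub>M borel"
      unfolding lborel_prod measurable_lborel1 measurable_lborel2
      by (intro borel_measurable_continuous_onI) (auto simp: case_prod_beta Complex_eq intro!: continuous_intros)
    have [measurable]: "(exp :: complex \<Rightarrow> complex) \<in> borel_measurable borel"
      by (intro borel_measurable_continuous_onI continuous_intros)
    show "(\<lambda>w. F (exp w) * ennreal (exp (2 * Re w)) * indicator ?S w)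
      \<in> borel_measurable (distr (lborel \<Otimes>\<^sub>M lborel) borel (\<lambda>(x, y). Complex x y))"
      using F by simp
  qed (auto intro!: nn_integral_cong simp: exp_eq_polar indicator_def)
  also have "\<dots> = (\<integral>\<^sup>+s. \<integral>\<^sup>+t. F (of_real (exp s) * cis t) * ennreal (exp (2 * s)) *
                 (indicator {..<0} s * indicator {-pi<..<pi} t) \<partial>lborel \<partial>lborel)"
  proof (subst lborel.nn_integral_fst[symmetric])
    have [measurable]: "cis \<in> borel_measurable borel"
      by (intro borel_measurable_continuous_onI continuous_intros)
    show "(\<lambda>p. F (of_real (exp (fst p)) * cis (snd p)) * ennreal (exp (2 * fst p)) *
                 (indicator {..<0} (fst p) * indicator {-pi<..<pi} (snd p)))
       \<in> borel_measurable (lborel \<Otimes>\<^sub>M lborel)"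
      using F by measurable
  qed simp
  also have "\<dots> = (\<integral>\<^sup>+s\<in>{..<0}. (\<integral>\<^sup>+t\<in>{-pi<..<pi}. F (of_real (exp s) * cis t) \<partial>lborel) * ennreal (exp (2 * s)) \<partial>lborel)"
  proof (rule nn_integral_cong)
    fix s :: real
    have [measurable]: "cis \<in> borel_measurable borel"
      by (intro borel_measurable_continuous_onI continuous_intros)
    have "(\<integral>\<^sup>+t. F (of_real (exp s) * cis t) * ennreal (exp (2 * s)) * (indicator {..<0} s * indicator {-pi<..<pi} t) \<partial>lborel)
      = (\<integral>\<^sup>+t. (F (of_real (exp s) * cis t) * indicator {-pi<..<pi} t) * (ennreal (exp (2 * s)) * indicator {..<0} s) \<partial>lborel)"
      by (intro nn_integral_cong) (simp add: mult_ac)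
    also have "\<dots> = (\<integral>\<^sup>+t\<in>{-pi<..<pi}. F (of_real (exp s) * cis t) \<partial>lborel) * (ennreal (exp (2 * s)) * indicator {..<0} s)"
      by (rule nn_integral_multc) (use F in measurable)
    finally show "(\<integral>\<^sup>+t. F (of_real (exp s) * cis t) * ennreal (exp (2 * s)) * (indicator {..<0} s * indicator {-pi<..<pi} t) \<partial>lborel)
      = (\<integral>\<^sup>+t\<in>{-pi<..<pi}. F (of_real (exp s) * cis t) \<partial>lborel) * ennreal (exp (2 * s)) * indicator {..<0} s"
      by (simp add: mult.assoc)
  qed
  finally show ?thesis .
qed

lemma has_integral_cis_int:
  "((\<lambda>t. cis (of_int k * t)) has_integral (if k = 0 then of_real (2 * pi) else 0)) {-pi..pi}"
proof (cases "k = 0")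
  case True
  then show ?thesis using has_integral_const_real[of "1::complex" "-pi" pi] by (simp add: scaleR_conv_of_real)
next
  case False
  have "((\<lambda>t. cis (of_int k * t)) has_integral
      (cis (of_int k * pi) / (\<i> * of_int k) - cis (of_int k * (-pi)) / (\<i> * of_int k))) {-pi..pi}"
  proof (rule fundamental_theorem_of_calculus)
    fix t :: real
    have "((\<lambda>t. exp (\<i> * of_int k * t) / (\<i> * of_int k)) has_vector_derivative exp (\<i> * of_int k * t)) (at t within {-pi..pi})"
      by (rule has_vector_derivative_real_field) (use False in \<open>auto intro!: derivative_eq_intros\<close>)
    then show "((\<lambda>t. cis (of_int k * t) / (\<i> * of_int k)) has_vector_derivative cis (of_int k * t)) (at t within {-pi..pi})"
      by (simp add: cis_conv_exp mult_ac)
  qed simp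
  moreover have "cis (of_int k * pi) = cis (of_int k * (-pi))"
    by (simp add: complex_eq_iff) (metis sin_zero_iff_int2)
  ultimately show ?thesis using False by simp
qed

lemma has_integral_norm_square_trig_poly:
  fixes c :: "nat \<Rightarrow> complex"
  shows "((\<lambda>t. (norm (\<Sum>n<N. c n * cis (real n * t)))\<^sup>2) has_integral (2 * pi * (\<Sum>n<N. (norm (c n))\<^sup>2))) {-pi..pi}"
proof -
  let ?s = "\<lambda>t. \<Sum>n<N. \<Sum>m<N. c n * cnj (c m) * cis (of_int (int n - int m) * t)"
  have "(?s has_integral (\<Sum>n<N. \<Sum>m<N. c n * cnj (c m) * (if int n - int m = 0 then of_real (2 * pi) else 0))) {-pi..pi}"
    by (intro has_integral_sum has_integral_mult_right has_integral_cis_int) auto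
  also have "(\<Sum>n<N. \<Sum>m<N. c n * cnj (c m) * (if int n - int m = 0 then of_real (2 * pi) else 0))
    = (\<Sum>n<N. \<Sum>m<N. if m = n then c n * cnj (c n) * of_real (2 * pi) else 0)"
    by (intro sum.cong) auto
  also have "\<dots> = of_real (2 * pi * (\<Sum>n<N. (norm (c n))\<^sup>2))"
    by (simp add: sum_distrib_left mult_ac complex_norm_square flip: of_real_power)
  also have "?s = (\<lambda>t. of_real ((norm (\<Sum>n<N. c n * cis (real n * t)))\<^sup>2))"
  proof
    fix t
    have "of_real ((norm (\<Sum>n<N. c n * cis (real n * t)))\<^sup>2)
       = (\<Sum>n<N. c n * cis (real n * t)) * cnj (\<Sum>n<N. c n * cis (real n * t))"
      by (simp only: complex_norm_square)
    also have "\<dots> = (\<Sum>n<N. \<Sum>m<N. (c n * cis (real n * t)) * (cnj (c m) * cis (- (real m * t))))"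
      by (simp add: sum_product cis_cnj)
    also have "\<dots> = ?s t"
      by (intro sum.cong refl) (simp add: cis_mult algebra_simps)
    finally show "?s t = of_real ((norm (\<Sum>n<N. c n * cis (real n * t)))\<^sup>2)" ..
  qed
  finally have "((\<lambda>t. complex_of_real ((norm (\<Sum>n<N. c n * cis (real n * t)))\<^sup>2)) has_integral
      of_real (2 * pi * (\<Sum>n<N. (norm (c n))\<^sup>2))) {-pi..pi}" .
  from has_integral_linear[OF this bounded_linear_Re] show ?thesis by (simp add: o_def)
qed

lemma taylor_coeff_sums:
  assumes "g holomorphic_on unit_disc" "z \<in> unit_disc"
  shows "(\<lambda>n. taylor_coeff g n * z ^ n) sums g z"
  using holomorphic_power_series[OF assms] by (simp add: taylor_coeff_def fps_expansion_def)

lemma summable_norm_taylor_coeff: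
  assumes g: "g holomorphic_on unit_disc" and r: "0 \<le> r" "r < 1"
  shows "summable (\<lambda>n. norm (taylor_coeff g n) * r ^ n)"
proof -
  obtain R where R: "r < R" "R < 1" using dense[OF r(2)] by auto
  have "summable (\<lambda>n. taylor_coeff g n * (of_real R) ^ n)"
    using taylor_coeff_sums[OF g, of "of_real R"] R r by (auto simp: sums_iff)
  then have "summable (\<lambda>n. norm (taylor_coeff g n * (of_real r) ^ n))"
    by (rule powser_insidea) (use R r in auto)
  then show ?thesis using r by (simp add: norm_mult norm_power)
qed

text \<open>
  On a smaller circle the Taylor polynomials converge boundedly, so the identity passes to the
  limit from trigonometric polynomials.
\<close>

lemma nn_integral_circle_parseval:
  assumes g: "g holomorphic_on unit_disc" and r: "0 \<le> r" "r < 1"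
  shows "(\<integral>\<^sup>+t\<in>{-pi<..<pi}. ennreal ((norm (g (of_real r * cis t)))\<^sup>2) \<partial>lborel)
    = ennreal (2 * pi) * (\<Sum>n. ennreal ((norm (taylor_coeff g n))\<^sup>2 * r ^ (2 * n)))"
proof -
  define c where "c = (\<lambda>n. taylor_coeff g n * of_real (r ^ n))"
  define B where "B = (\<Sum>n. norm (c n))"
  let ?P = "\<lambda>N t. \<Sum>n<N. c n * cis (real n * t)"
  let ?G = "\<lambda>t. g (of_real r * cis t)"
  have sc: "summable (\<lambda>n. norm (c n))"
    using summable_norm_taylor_coeff[OF g r] r by (simp add: c_def norm_mult norm_power)
  have lim: "(\<lambda>N. ?P N t) \<longlonglongrightarrow> ?G t" for t
    using taylor_coeff_sums[OF g, of "of_real r * cis t"] r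
    by (simp add: sums_def c_def norm_mult power_mult_distrib Complex.DeMoivre mult_ac)
  have bd: "norm (?P N t) \<le> B" for N t
  proof -
    have "norm (?P N t) \<le> (\<Sum>n<N. norm (c n))"
      by (rule order_trans[OF norm_sum]) (simp add: norm_mult)
    also have "\<dots> \<le> B" unfolding B_def by (rule sum_le_suminf[OF sc]) auto
    finally show ?thesis .
  qed
  have I: "((\<lambda>t. (norm (?P N t))\<^sup>2) has_integral (2 * pi * (\<Sum>n<N. (norm (c n))\<^sup>2))) {-pi..pi}" for N
    by (rule has_integral_norm_square_trig_poly)
  have "(\<lambda>t. (norm (?P N t))\<^sup>2) integrable_on {-pi..pi}" for N
    using I by (rule has_integral_integrable)
  moreover have "(\<lambda>t. B\<^sup>2) integrable_on {-pi..pi}"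
    by (rule integrable_const_ivl)
  moreover have "norm ((norm (?P N t))\<^sup>2) \<le> B\<^sup>2" for N t
    using bd by (auto intro!: power_mono)
  moreover have "(\<lambda>N. (norm (?P N t))\<^sup>2) \<longlonglongrightarrow> (norm (?G t))\<^sup>2" for t
    by (intro tendsto_intros lim)
  ultimately have dc: "(\<lambda>t. (norm (?G t))\<^sup>2) integrable_on {-pi..pi}"
    "(\<lambda>N. integral {-pi..pi} (\<lambda>t. (norm (?P N t))\<^sup>2)) \<longlonglongrightarrow> integral {-pi..pi} (\<lambda>t. (norm (?G t))\<^sup>2)"
    using dominated_convergence[of "\<lambda>N t. (norm (?P N t))\<^sup>2" "{-pi..pi}" "\<lambda>t. B\<^sup>2" "\<lambda>t. (norm (?G t))\<^sup>2"]
    by blast+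
  have "(\<lambda>N. 2 * pi * (\<Sum>n<N. (norm (c n))\<^sup>2)) \<longlonglongrightarrow> integral {-pi..pi} (\<lambda>t. (norm (?G t))\<^sup>2)"
    using dc(2) by (simp only: integral_unique[OF I])
  then have "(\<lambda>n. 2 * pi * (norm (c n))\<^sup>2) sums integral {-pi..pi} (\<lambda>t. (norm (?G t))\<^sup>2)"
    by (simp add: sums_def sum_distrib_left)
  then have s: "(\<Sum>n. ennreal (2 * pi * (norm (c n))\<^sup>2)) = ennreal (integral {-pi..pi} (\<lambda>t. (norm (?G t))\<^sup>2))"
    by (intro suminf_ennreal_eq) auto
  have "((\<lambda>t. (norm (?G t))\<^sup>2) has_integral integral {-pi..pi} (\<lambda>t. (norm (?G t))\<^sup>2)) {-pi<..<pi}"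
    using integrable_integral[OF dc(1)] by (simp add: has_integral_Icc_iff_Ioo)
  then have "(\<integral>\<^sup>+t. ennreal (indicator {-pi<..<pi} t * (norm (?G t))\<^sup>2) \<partial>lborel)
    = ennreal (integral {-pi..pi} (\<lambda>t. (norm (?G t))\<^sup>2))"
    by (intro nn_integral_has_integral_lebesgue) auto
  also have "\<dots> = (\<Sum>n. ennreal (2 * pi) * ennreal ((norm (taylor_coeff g n))\<^sup>2 * r ^ (2 * n)))"
    unfolding s[symmetric] using r
    by (intro suminf_cong) (simp add: c_def norm_mult norm_power power_mult_distrib power_mult[symmetric] mult.commute[of _ 2] flip: ennreal_mult' mult.assoc)
  also have "\<dots> = ennreal (2 * pi) * (\<Sum>n. ennreal ((norm (taylor_coeff g n))\<^sup>2 * r ^ (2 * n)))"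
    by (rule ennreal_suminf_cmult)
  finally have "(\<integral>\<^sup>+t. ennreal (indicator {-pi<..<pi} t * (norm (?G t))\<^sup>2) \<partial>lborel)
    = ennreal (2 * pi) * (\<Sum>n. ennreal ((norm (taylor_coeff g n))\<^sup>2 * r ^ (2 * n)))" .
  moreover have "ennreal (indicator {-pi<..<pi} t * (norm (?G t))\<^sup>2)
    = ennreal ((norm (?G t))\<^sup>2) * indicator {-pi<..<pi} t" for t
    by (auto simp: indicator_def)
  ultimately show ?thesis by simp
qed

section \<open>Taylor coefficients and weighted area integrals\<close>

text \<open>
  The substitution \<open>u = -2 c s\<close> turns this into Euler's integral for the Gamma function.
\<close>

lemma nn_integral_exp_powr:
  assumes c: "c > 0" and \<beta>: "\<beta> > (-1::real)"
  shows "(\<integral>\<^sup>+s\<in>{..<0}. ennreal (exp (2 * c * s) * (-2 * s) powr \<beta>) \<partial>lborel)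
    = ennreal (Gamma (\<beta> + 1) / 2 * c powr (- \<beta> - 1))" (is "?I = _")
proof -
  have ptw: "ennreal (indicator {0..} (0 + (-2 * c) * s) * (0 + (-2 * c) * s) powr (\<beta> + 1 - 1) / exp (0 + (-2 * c) * s))
     = ennreal (c powr \<beta>) * (ennreal (exp (2 * c * s) * (-2 * s) powr \<beta>) * indicator {..<0} s)" for s
  proof (cases "s < 0")
    case True
    then have "c * s < 0" using c by (simp add: mult_pos_neg)
    moreover have "(-2 * c * s) powr \<beta> = c powr \<beta> * (-2 * s) powr \<beta>"
      using c True powr_mult[of c "-2 * s" \<beta>] by (simp add: mult_ac)
    ultimately show ?thesis using True
      by (simp add: exp_minus field_simps flip: ennreal_mult')
  next
    case False
    then have "s = 0 \<or> c * s > 0" using c by (cases "s = 0") auto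
    then show ?thesis using False by auto
  qed
  have "ennreal (Gamma (\<beta> + 1)) = (\<integral>\<^sup>+t. ennreal (indicator {0..} t * t powr (\<beta> + 1 - 1) / exp t) \<partial>lborel)"
    using \<beta> by (intro Gamma_conv_nn_integral_real) auto
  also have "\<dots> = ennreal \<bar>-2 * c\<bar> * (\<integral>\<^sup>+s. ennreal (indicator {0..} (0 + (-2 * c) * s) *
      (0 + (-2 * c) * s) powr (\<beta> + 1 - 1) / exp (0 + (-2 * c) * s)) \<partial>lborel)"
    by (rule nn_integral_real_affine) (use c in auto)
  also have "\<dots> = ennreal (2 * c) * (\<integral>\<^sup>+s. ennreal (c powr \<beta>) *
      (ennreal (exp (2 * c * s) * (-2 * s) powr \<beta>) * indicator {..<0} s) \<partial>lborel)"
    unfolding ptw using c by simp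
  also have "(\<integral>\<^sup>+s. ennreal (c powr \<beta>) * (ennreal (exp (2 * c * s) * (-2 * s) powr \<beta>) * indicator {..<0} s) \<partial>lborel)
    = ennreal (c powr \<beta>) * ?I"
    by (rule nn_integral_cmult) measurable
  also have "ennreal (2 * c) * (ennreal (c powr \<beta>) * ?I) = ennreal (2 * c powr (\<beta> + 1)) * ?I"
    using c by (simp add: powr_add ennreal_mult' mult_ac)
  finally have G: "ennreal (Gamma (\<beta> + 1)) = ennreal (2 * c powr (\<beta> + 1)) * ?I" .
  have "1 / 2 * c powr (- \<beta> - 1) * (2 * c powr (\<beta> + 1)) = 1"
    using c by (simp flip: powr_add)
  then have "?I = ennreal (1 / 2 * c powr (- \<beta> - 1) * (2 * c powr (\<beta> + 1))) * ?I"
    by simp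
  also have "\<dots> = ennreal (1 / 2 * c powr (- \<beta> - 1)) * (ennreal (2 * c powr (\<beta> + 1)) * ?I)"
    by (subst ennreal_mult) (auto simp: mult.assoc)
  also have "\<dots> = ennreal (1 / 2 * c powr (- \<beta> - 1)) * ennreal (Gamma (\<beta> + 1))"
    by (simp only: G)
  also have "\<dots> = ennreal (Gamma (\<beta> + 1) / 2 * c powr (- \<beta> - 1))"
    by (subst ennreal_mult'[symmetric]) (auto simp: mult_ac)
  finally show ?thesis .
qed

text \<open>
  The integral of \<open>\<bar>z\<bar> powr (2 (c - 1)) \<cdot> (1 - \<bar>z\<bar>\<^sup>2) powr \<beta>\<close> over the disc, up to the factor
  \<open>2 \<pi>\<close>, in the logarithmic radial coordinate \<open>s = ln \<bar>z\<bar>\<close>.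
\<close>

definition radial_moment :: "real \<Rightarrow> real \<Rightarrow> ennreal" where
  "radial_moment \<beta> c = (\<integral>\<^sup>+s\<in>{..<0}. ennreal (exp (2 * c * s) * (1 - exp (2 * s)) powr \<beta>) \<partial>lborel)"

lemma set_nn_integral_negative_mono:
  fixes f g :: "real \<Rightarrow> real"
  assumes "\<And>s. s < 0 \<Longrightarrow> f s \<le> g s"
  shows "(\<integral>\<^sup>+s\<in>{..<0}. ennreal (f s) \<partial>lborel) \<le> (\<integral>\<^sup>+s\<in>{..<0}. ennreal (g s) \<partial>lborel)"
  using assms by (intro nn_integral_mono) (auto simp: indicator_def intro!: ennreal_leI)

text \<open>
  Since \<open>u exp (-u) \<le> 1 - exp (-u) \<le> u\<close>, the moment lies between two explicit Gamma integrals,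
  with parameters \<open>c\<close> and \<open>c + \<beta>\<close>. Which of them is the larger depends on the sign of \<open>\<beta>\<close>.
\<close>

lemma radial_moment_bounds:
  assumes \<beta>: "\<beta> > (-1::real)"
  obtains L U where "L > 0" "U > 0"
    "\<And>c. c \<ge> 1 \<Longrightarrow> ennreal (L * c powr (- \<beta> - 1)) \<le> radial_moment \<beta> c"
    "\<And>c. c \<ge> 1 \<Longrightarrow> radial_moment \<beta> c \<le> ennreal (U * c powr (- \<beta> - 1))"
proof -
  define G where "G = Gamma (\<beta> + 1) / 2"
  have G: "G > 0" using \<beta> by (simp add: G_def Gamma_real_pos)
  define q where "q = (1 + \<beta>) powr (- \<beta> - 1)"
  have q: "q > 0" using \<beta> by (simp add: q_def)
  let ?I = "\<lambda>c. ennreal (G * c powr (- \<beta> - 1))"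
  let ?g = "\<lambda>c s. exp (2 * c * s) * (-2 * s) powr \<beta>"
  let ?m = "\<lambda>c s. exp (2 * c * s) * (1 - exp (2 * s)) powr \<beta>"
  have I: "?I c = (\<integral>\<^sup>+s\<in>{..<0}. ennreal (?g c s) \<partial>lborel)" if "c > 0" for c
    using nn_integral_exp_powr[OF that \<beta>] by (simp add: G_def)
  have lo: "(-2 * s) * exp (2 * s) \<le> 1 - exp (2 * s)" for s :: real
    using exp_ge_add_one_self[of "-2 * s"] by (simp add: exp_minus field_simps)
  have hi: "1 - exp (2 * s) \<le> -2 * s" for s :: real
    using exp_ge_add_one_self[of "2 * s"] by linarith
  have shift: "?g (c + \<beta>) s = exp (2 * c * s) * ((-2 * s) * exp (2 * s)) powr \<beta>" for c s :: real
  proof -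
    have "((-2 * s) * exp (2 * s)) powr \<beta> = (-2 * s) powr \<beta> * exp (2 * s) powr \<beta>"
      by (rule powr_mult)
    moreover have "exp (2 * (c + \<beta>) * s) = exp (2 * c * s) * exp (2 * s) powr \<beta>"
      by (simp add: powr_def algebra_simps flip: exp_add)
    ultimately show ?thesis by (simp only: mult_ac)
  qed
  have q_shift: "G * q * c powr (- \<beta> - 1) = G * ((1 + \<beta>) * c) powr (- \<beta> - 1)" for c
    by (simp add: q_def powr_mult)
  show ?thesis
  proof (cases "\<beta> \<ge> 0")
    case True
    show ?thesis
    proof (rule that[of "G * q" G])
      fix c :: real assume c: "c \<ge> 1"
      have "?m c s \<le> ?g c s" if "s < 0" for s
        using hi[of s] that True by (intro mult_left_mono powr_mono2) auto
      then show "radial_moment \<beta> c \<le> ?I c"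
        using c by (simp only: I radial_moment_def) (rule set_nn_integral_negative_mono)
      have "?g (c + \<beta>) s \<le> ?m c s" if "s < 0" for s
        unfolding shift using lo[of s] that True
        by (intro mult_left_mono powr_mono2) (auto simp: mult_le_0_iff)
      then have "?I (c + \<beta>) \<le> radial_moment \<beta> c"
        using c True by (subst I) (auto simp: radial_moment_def intro!: set_nn_integral_negative_mono)
      moreover have "G * q * c powr (- \<beta> - 1) \<le> G * (c + \<beta>) powr (- \<beta> - 1)"
        unfolding q_shift using G c True mult_left_mono[OF c True]
        by (intro mult_left_mono powr_mono2') (auto simp: algebra_simps)
      ultimately show "ennreal (G * q * c powr (- \<beta> - 1)) \<le> radial_moment \<beta> c"
        by (meson ennreal_leI order_trans)
    qed (use G q in auto)
  next
    case False
    show ?thesis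
    proof (rule that[of G "G * q"])
      fix c :: real assume c: "c \<ge> 1"
      have "?g c s \<le> ?m c s" if "s < 0" for s
        using hi[of s] that False by (intro mult_left_mono powr_mono2') auto
      then show "?I c \<le> radial_moment \<beta> c"
        using c by (subst I) (auto simp: radial_moment_def intro!: set_nn_integral_negative_mono)
      have "?m c s \<le> ?g (c + \<beta>) s" if "s < 0" for s
        unfolding shift using lo[of s] that False
        by (intro mult_left_mono powr_mono2') (auto simp: mult_less_0_iff)
      then have "radial_moment \<beta> c \<le> ?I (c + \<beta>)"
        using c \<beta> by (subst I) (auto simp: radial_moment_def intro!: set_nn_integral_negative_mono)
      moreover have "G * (c + \<beta>) powr (- \<beta> - 1) \<le> G * q * c powr (- \<beta> - 1)"
        unfolding q_shift
      proof (intro mult_left_mono powr_mono2')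
        show "0 < (1 + \<beta>) * c" using c \<beta> by (intro mult_pos_pos) auto
        show "(1 + \<beta>) * c \<le> c + \<beta>"
          using c False mult_left_mono_neg[OF c, of \<beta>] by (simp add: algebra_simps)
      qed (use G \<beta> in auto)
      ultimately show "radial_moment \<beta> c \<le> ennreal (G * q * c powr (- \<beta> - 1))"
        by (meson ennreal_leI order_trans)
    qed (use G q in auto)
  qed
qed

definition defect :: "complex \<Rightarrow> real" where
  "defect z = 1 - (norm z)\<^sup>2"

text \<open>
  The squared norm in the weighted Bergman space with weight \<open>(1 - \<bar>z\<bar>\<^sup>2) powr \<beta>\<close>. Values in the
  extended nonnegative reals allow estimates that prove membership and a norm bound at the same
  time.
\<close>

definition bergman_integral :: "real \<Rightarrow> (complex \<Rightarrow> complex) \<Rightarrow> ennreal" where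
  "bergman_integral \<beta> g = (\<integral>\<^sup>+z\<in>unit_disc. ennreal ((norm (g z))\<^sup>2 * defect z powr \<beta>) \<partial>lborel)"

text \<open>
  For \<open>s = 1 - \<alpha>\<close> this is the squared norm of the weighted Dirichlet space with parameter \<open>\<alpha>\<close>;
  the other values of \<open>s\<close> measure lower order terms and derivatives.
\<close>

definition coeff_energy :: "real \<Rightarrow> (complex \<Rightarrow> complex) \<Rightarrow> ennreal" where
  "coeff_energy s g = (\<Sum>n. ennreal ((real n + 1) powr s * (norm (taylor_coeff g n))\<^sup>2))"

lemma defect_pos: "z \<in> unit_disc \<Longrightarrow> 0 < defect z"
  by (simp add: defect_def power_less_one_iff)

lemma continuous_on_defect [continuous_intros]: "continuous_on A defect"
  unfolding defect_def by (intro continuous_intros)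

lemma continuous_on_defect_powr [continuous_intros]: "continuous_on unit_disc (\<lambda>z. defect z powr \<beta>)"
  by (intro continuous_intros) (use defect_pos in fastforce)

lemma borel_measurable_disc_integrand:
  assumes "continuous_on unit_disc f"
  shows "(\<lambda>z. ennreal (f z) * indicator unit_disc z) \<in> borel_measurable borel"
  by (rule borel_measurable_continuous_on_times_indicator[OF assms]) auto

lemma bergman_integral_series:
  assumes g: "g holomorphic_on unit_disc"
  shows "bergman_integral \<beta> g
    = ennreal (2 * pi) * (\<Sum>n. ennreal ((norm (taylor_coeff g n))\<^sup>2) * radial_moment \<beta> (real n + 1))"
proof -
  let ?F = "\<lambda>z. ennreal ((norm (g z))\<^sup>2 * defect z powr \<beta>) * indicator unit_disc z"
  have "bergman_integral \<beta> g = (\<integral>\<^sup>+z\<in>unit_disc. ?F z \<partial>lborel)"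
    unfolding bergman_integral_def by (intro nn_integral_cong) (auto simp: indicator_def)
  also have "\<dots> = (\<integral>\<^sup>+s\<in>{..<0}. (\<integral>\<^sup>+t\<in>{-pi<..<pi}. ?F (of_real (exp s) * cis t) \<partial>lborel) * ennreal (exp (2 * s)) \<partial>lborel)"
    by (intro nn_integral_disc_log_polar borel_measurable_disc_integrand continuous_intros
          holomorphic_on_imp_continuous_on g)
  also have "\<dots> = (\<integral>\<^sup>+s. (\<Sum>n. ennreal (2 * pi) * (ennreal ((norm (taylor_coeff g n))\<^sup>2) *
      (ennreal (exp (2 * (real n + 1) * s) * (1 - exp (2 * s)) powr \<beta>) * indicator {..<0} s))) \<partial>lborel)"
  proof (rule nn_integral_cong)
    fix s :: real
    show "(\<integral>\<^sup>+t\<in>{-pi<..<pi}. ?F (of_real (exp s) * cis t) \<partial>lborel) * ennreal (exp (2 * s)) * indicator {..<0} s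
      = (\<Sum>n. ennreal (2 * pi) * (ennreal ((norm (taylor_coeff g n))\<^sup>2) *
          (ennreal (exp (2 * (real n + 1) * s) * (1 - exp (2 * s)) powr \<beta>) * indicator {..<0} s)))"
    proof (cases "s < 0")
      case s: True
      have D: "of_real (exp s) * cis t \<in> unit_disc" "defect (of_real (exp s) * cis t) = 1 - exp (2 * s)" for t
        using s by (auto simp: norm_mult defect_def power2_eq_square simp flip: exp_add)
      have contc: "continuous_on UNIV (\<lambda>t. (norm (g (of_real (exp s) * cis t)))\<^sup>2)"
        by (intro continuous_intros continuous_on_compose2[OF holomorphic_on_imp_continuous_on[OF g]])
           (use D in auto)
      have "(\<integral>\<^sup>+t\<in>{-pi<..<pi}. ?F (of_real (exp s) * cis t) \<partial>lborel)
        = (\<integral>\<^sup>+t. ennreal ((1 - exp (2 * s)) powr \<beta>) *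
            (ennreal ((norm (g (of_real (exp s) * cis t)))\<^sup>2) * indicator {-pi<..<pi} t) \<partial>lborel)"
        using D by (intro nn_integral_cong) (simp add: ennreal_mult mult_ac)
      also have "\<dots> = ennreal ((1 - exp (2 * s)) powr \<beta>) *
            (\<integral>\<^sup>+t\<in>{-pi<..<pi}. ennreal ((norm (g (of_real (exp s) * cis t)))\<^sup>2) \<partial>lborel)"
        by (rule nn_integral_cmult) (use borel_measurable_continuous_onI[OF contc] in measurable)
      also have "\<dots> = ennreal ((1 - exp (2 * s)) powr \<beta>) * (ennreal (2 * pi) *
            (\<Sum>n. ennreal ((norm (taylor_coeff g n))\<^sup>2 * exp s ^ (2 * n))))"
        using s by (subst nn_integral_circle_parseval[OF g]) auto
      finally have "(\<integral>\<^sup>+t\<in>{-pi<..<pi}. ?F (of_real (exp s) * cis t) \<partial>lborel) * ennreal (exp (2 * s)) * indicator {..<0} s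
        = (ennreal ((1 - exp (2 * s)) powr \<beta>) * ennreal (2 * pi) * ennreal (exp (2 * s))) *
            (\<Sum>n. ennreal ((norm (taylor_coeff g n))\<^sup>2 * exp s ^ (2 * n)))"
        using s by (simp add: mult_ac)
      also have "\<dots> = (\<Sum>n. (ennreal ((1 - exp (2 * s)) powr \<beta>) * ennreal (2 * pi) * ennreal (exp (2 * s))) *
            ennreal ((norm (taylor_coeff g n))\<^sup>2 * exp s ^ (2 * n)))"
        by (rule ennreal_suminf_cmult[symmetric])
      also have "\<dots> = (\<Sum>n. ennreal (2 * pi) * (ennreal ((norm (taylor_coeff g n))\<^sup>2) *
          (ennreal (exp (2 * (real n + 1) * s) * (1 - exp (2 * s)) powr \<beta>) * indicator {..<0} s)))"
      proof (rule suminf_cong)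
        fix n
        have "exp (2 * (real n + 1) * s) = exp (2 * s) * exp s ^ (2 * n)"
          by (simp add: algebra_simps flip: exp_of_nat_mult exp_add)
        then show "(ennreal ((1 - exp (2 * s)) powr \<beta>) * ennreal (2 * pi) * ennreal (exp (2 * s))) *
            ennreal ((norm (taylor_coeff g n))\<^sup>2 * exp s ^ (2 * n))
          = ennreal (2 * pi) * (ennreal ((norm (taylor_coeff g n))\<^sup>2) *
          (ennreal (exp (2 * (real n + 1) * s) * (1 - exp (2 * s)) powr \<beta>) * indicator {..<0} s))"
          using s by (simp add: ennreal_mult mult_ac)
      qed
      finally show ?thesis .
    qed simp
  qed
  also have "\<dots> = (\<Sum>n. \<integral>\<^sup>+s. ennreal (2 * pi) * (ennreal ((norm (taylor_coeff g n))\<^sup>2) *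
      (ennreal (exp (2 * (real n + 1) * s) * (1 - exp (2 * s)) powr \<beta>) * indicator {..<0} s)) \<partial>lborel)"
    by (rule nn_integral_suminf) measurable
  also have "\<dots> = (\<Sum>n. ennreal (2 * pi) * (ennreal ((norm (taylor_coeff g n))\<^sup>2) * radial_moment \<beta> (real n + 1)))"
    unfolding radial_moment_def by (simp add: nn_integral_cmult)
  finally show ?thesis by (simp only: ennreal_suminf_cmult)
qed

text \<open>
  Monomials are orthogonal for every radial weight, and the moments of this weight decay like
  \<open>(n + 1) powr (- \<beta> - 1)\<close>.
\<close>

lemma bergman_integral_equiv_coeff_energy:
  assumes \<beta>: "\<beta> > (-1::real)"
  obtains L U where "L > 0" "U > 0"
    "\<And>g. g holomorphic_on unit_disc \<Longrightarrow> coeff_energy (- \<beta> - 1) g \<le> ennreal L * bergman_integral \<beta> g"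
    "\<And>g. g holomorphic_on unit_disc \<Longrightarrow> bergman_integral \<beta> g \<le> ennreal U * coeff_energy (- \<beta> - 1) g"
proof -
  obtain L U where LU: "L > 0" "U > 0"
    and L: "\<And>c. c \<ge> 1 \<Longrightarrow> ennreal (L * c powr (- \<beta> - 1)) \<le> radial_moment \<beta> c"
    and U: "\<And>c. c \<ge> 1 \<Longrightarrow> radial_moment \<beta> c \<le> ennreal (U * c powr (- \<beta> - 1))"
    using radial_moment_bounds[OF \<beta>] by metis
  show ?thesis
  proof (rule that[of "1 / (2 * pi * L)" "2 * pi * U"])
    fix g assume g: "g holomorphic_on unit_disc"
    have "coeff_energy (- \<beta> - 1) g = (\<Sum>n. ennreal (1 / (2 * pi * L)) * (ennreal (2 * pi) *
        (ennreal ((norm (taylor_coeff g n))\<^sup>2) * ennreal (L * (real n + 1) powr (- \<beta> - 1)))))"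
      unfolding coeff_energy_def
      using LU by (intro suminf_cong) (simp add: field_simps flip: ennreal_mult')
    also have "\<dots> \<le> (\<Sum>n. ennreal (1 / (2 * pi * L)) * (ennreal (2 * pi) *
        (ennreal ((norm (taylor_coeff g n))\<^sup>2) * radial_moment \<beta> (real n + 1))))"
      by (intro suminf_le mult_left_mono L) auto
    also have "\<dots> = ennreal (1 / (2 * pi * L)) * bergman_integral \<beta> g"
      by (simp only: ennreal_suminf_cmult bergman_integral_series[OF g])
    finally show "coeff_energy (- \<beta> - 1) g \<le> ennreal (1 / (2 * pi * L)) * bergman_integral \<beta> g" .
    have "bergman_integral \<beta> g = (\<Sum>n. ennreal (2 * pi) * (ennreal ((norm (taylor_coeff g n))\<^sup>2) * radial_moment \<beta> (real n + 1)))"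
      by (simp only: ennreal_suminf_cmult bergman_integral_series[OF g])
    also have "\<dots> \<le> (\<Sum>n. ennreal (2 * pi) * (ennreal ((norm (taylor_coeff g n))\<^sup>2) * ennreal (U * (real n + 1) powr (- \<beta> - 1))))"
      by (intro suminf_le mult_left_mono U) auto
    also have "\<dots> = (\<Sum>n. ennreal (2 * pi * U) * ennreal ((real n + 1) powr (- \<beta> - 1) * (norm (taylor_coeff g n))\<^sup>2))"
      using LU by (intro suminf_cong) (simp add: mult_ac flip: ennreal_mult')
    finally show "bergman_integral \<beta> g \<le> ennreal (2 * pi * U) * coeff_energy (- \<beta> - 1) g"
      by (simp only: ennreal_suminf_cmult coeff_energy_def)
  qed (use LU in auto)
qed

lemma coeff_energy_mono:
  assumes "s \<le> t"
  shows "coeff_energy s g \<le> coeff_energy t g"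
  unfolding coeff_energy_def
  by (intro suminf_le ennreal_leI mult_right_mono powr_mono) (use assms in auto)

text \<open>
  This is where a high order of vanishing pays off: lowering the exponent by \<open>t - s\<close> gains the
  factor \<open>(n + 1) powr (s - t)\<close>.
\<close>

lemma coeff_energy_gain:
  assumes st: "s \<le> t" and van: "\<And>k. k < n \<Longrightarrow> taylor_coeff g k = 0"
  shows "coeff_energy s g \<le> ennreal ((real n + 1) powr (s - t)) * coeff_energy t g"
  unfolding coeff_energy_def ennreal_suminf_cmult[symmetric]
proof (intro suminf_le)
  fix k
  show "ennreal ((real k + 1) powr s * (norm (taylor_coeff g k))\<^sup>2)
    \<le> ennreal ((real n + 1) powr (s - t)) * ennreal ((real k + 1) powr t * (norm (taylor_coeff g k))\<^sup>2)"
  proof (cases "k < n")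
    case True
    then show ?thesis by (simp add: van)
  next
    case False
    have "(real k + 1) powr s = (real k + 1) powr (s - t) * (real k + 1) powr t"
      by (simp flip: powr_add)
    also have "\<dots> \<le> (real n + 1) powr (s - t) * (real k + 1) powr t"
      using False st by (intro mult_right_mono powr_mono2') auto
    finally have "(real k + 1) powr s * (norm (taylor_coeff g k))\<^sup>2
      \<le> (real n + 1) powr (s - t) * (real k + 1) powr t * (norm (taylor_coeff g k))\<^sup>2"
      by (intro mult_right_mono) auto
    then show ?thesis by (simp add: mult.assoc ennreal_leI flip: ennreal_mult')
  qed
qed auto

lemma taylor_coeff_deriv: "taylor_coeff (deriv g) n = of_nat (Suc n) * taylor_coeff g (Suc n)"
  by (simp add: taylor_coeff_def fps_expansion_def fps_nth_Abs_fps funpow_swap1 field_simps del: of_nat_Suc)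

lemma powr_ratio_bound:
  "(real n + 1) powr p \<le> 2 powr \<bar>p\<bar> * (real n + 2) powr p"
  "(real n + 2) powr p \<le> 2 powr \<bar>p\<bar> * (real n + 1) powr p"
proof -
  have A: "(real n + 1) powr q \<le> 2 powr q * (real n + 2) powr q"
      "(real n + 2) powr q \<le> 2 powr q * (real n + 1) powr q" if "q \<ge> 0" for q
    using that by (auto simp flip: powr_mult intro!: powr_mono2)
  show "(real n + 1) powr p \<le> 2 powr \<bar>p\<bar> * (real n + 2) powr p"
    "(real n + 2) powr p \<le> 2 powr \<bar>p\<bar> * (real n + 1) powr p"
    using A[of p] A[of "- p"] by (cases "p \<ge> 0"; simp add: powr_minus field_simps)+
qed

lemma suminf_ennreal_split_head: "(\<Sum>n. f n) = (\<Sum>n. f (Suc n)) + (f 0 :: ennreal)"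
proof -
  have "(\<lambda>n. f (Suc n)) sums (\<Sum>n. f (Suc n))"
    by (rule summable_sums) simp
  then have "f sums ((\<Sum>n. f (Suc n)) + f 0)"
    by (rule sums_Suc)
  then show ?thesis by (rule sums_unique[symmetric])
qed

lemma coeff_energy_deriv_le:
  "coeff_energy s (deriv g) \<le> ennreal (2 powr \<bar>s + 2\<bar>) * coeff_energy (s + 2) g"
proof -
  let ?a = "\<lambda>n. ennreal ((real n + 1) powr (s + 2) * (norm (taylor_coeff g n))\<^sup>2)"
  have "coeff_energy s (deriv g) \<le> (\<Sum>n. ennreal (2 powr \<bar>s + 2\<bar>) * ?a (Suc n))"
    unfolding coeff_energy_def
  proof (intro suminf_le)
    fix n
    have "(real n + 1) powr s * (norm (taylor_coeff (deriv g) n))\<^sup>2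
       = (real n + 1) powr (s + 2) * (norm (taylor_coeff g (Suc n)))\<^sup>2"
      by (simp add: taylor_coeff_deriv norm_mult power_mult_distrib powr_add add.commute flip: of_nat_Suc)
    also have "\<dots> \<le> (2 powr \<bar>s + 2\<bar> * (real n + 2) powr (s + 2)) * (norm (taylor_coeff g (Suc n)))\<^sup>2"
      by (intro mult_right_mono powr_ratio_bound) auto
    finally show "ennreal ((real n + 1) powr s * (norm (taylor_coeff (deriv g) n))\<^sup>2)
       \<le> ennreal (2 powr \<bar>s + 2\<bar>) * ?a (Suc n)"
      by (simp add: mult.assoc add_ac ennreal_leI flip: ennreal_mult')
  qed auto
  also have "\<dots> = ennreal (2 powr \<bar>s + 2\<bar>) * (\<Sum>n. ?a (Suc n))"
    by (rule ennreal_suminf_cmult)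
  finally have *: "coeff_energy s (deriv g) \<le> ennreal (2 powr \<bar>s + 2\<bar>) * (\<Sum>n. ?a (Suc n))" .
  have eq: "(\<Sum>n. ?a (Suc n)) + ?a 0 = (\<Sum>n. ?a n)"
    by (rule suminf_ennreal_split_head[of ?a, symmetric])
  have "(\<Sum>n. ?a (Suc n)) \<le> (\<Sum>n. ?a (Suc n)) + ?a 0"
    by (rule add_increasing2) auto
  then have "(\<Sum>n. ?a (Suc n)) \<le> coeff_energy (s + 2) g"
    unfolding coeff_energy_def by (simp only: eq)
  then show ?thesis by (rule order_trans[OF * mult_left_mono]) simp
qed

text \<open>
  Together with the preceding lemma: differentiation lowers the exponent by 2, up to constants
  and the value at the origin.
\<close>

lemma coeff_energy_le_deriv:
  "coeff_energy (s + 2) g \<le> ennreal ((norm (g 0))\<^sup>2) + ennreal (2 powr \<bar>s + 2\<bar>) * coeff_energy s (deriv g)"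
proof -
  let ?a = "\<lambda>n. ennreal ((real n + 1) powr (s + 2) * (norm (taylor_coeff g n))\<^sup>2)"
  have "coeff_energy (s + 2) g = (\<Sum>n. ?a (Suc n)) + ?a 0"
    unfolding coeff_energy_def by (rule suminf_ennreal_split_head[of ?a])
  moreover have "?a 0 = ennreal ((norm (g 0))\<^sup>2)"
    by (simp add: taylor_coeff_def fps_expansion_def)
  moreover have "(\<Sum>n. ?a (Suc n)) \<le> (\<Sum>n. ennreal (2 powr \<bar>s + 2\<bar>) *
      ennreal ((real n + 1) powr s * (norm (taylor_coeff (deriv g) n))\<^sup>2))"
  proof (intro suminf_le)
    fix n
    have "(real n + 1) powr s * (norm (taylor_coeff (deriv g) n))\<^sup>2
       = (real n + 1) powr (s + 2) * (norm (taylor_coeff g (Suc n)))\<^sup>2"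
      by (simp add: taylor_coeff_deriv norm_mult power_mult_distrib powr_add add.commute flip: of_nat_Suc)
    moreover have "(real n + 2) powr (s + 2) * (norm (taylor_coeff g (Suc n)))\<^sup>2
        \<le> (2 powr \<bar>s + 2\<bar> * (real n + 1) powr (s + 2)) * (norm (taylor_coeff g (Suc n)))\<^sup>2"
      by (intro mult_right_mono powr_ratio_bound) auto
    ultimately show "?a (Suc n) \<le> ennreal (2 powr \<bar>s + 2\<bar>) *
      ennreal ((real n + 1) powr s * (norm (taylor_coeff (deriv g) n))\<^sup>2)"
      by (simp add: mult.assoc add_ac ennreal_leI flip: ennreal_mult')
  qed auto
  moreover have "\<dots> = ennreal (2 powr \<bar>s + 2\<bar>) * coeff_energy s (deriv g)"
    unfolding coeff_energy_def by (rule ennreal_suminf_cmult)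
  ultimately show ?thesis by (simp add: add.commute add_left_mono)
qed

lemma summable_powr_times_geometric:
  fixes x :: real
  assumes "0 \<le> x" "x < 1"
  shows "summable (\<lambda>n. (real n + 1) powr p * x ^ n)"
proof -
  have "conv_radius (\<lambda>n. (real n + 1) powr p) = ereal 1"
  proof (rule conv_radius_ratio_limit[OF refl])
    show "eventually (\<lambda>n. (real n + 1) powr p \<noteq> 0) sequentially" by auto
    have "(\<lambda>n. (real (Suc n) / real (Suc (Suc n))) powr p) \<longlonglongrightarrow> 1 powr p"
      by (intro tendsto_powr tendsto_const LIMSEQ_Suc[OF LIMSEQ_n_over_Suc_n]) auto
    then show "(\<lambda>n. norm ((real n + 1) powr p) / norm ((real (Suc n) + 1) powr p)) \<longlonglongrightarrow> 1"
      by (simp add: powr_divide add_ac)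
  qed
  then show ?thesis
    using assms by (intro summable_in_conv_radius) auto
qed

text \<open>
  Cauchy-Schwarz for the power series; \<open>\<Sum>n. (n + 1) powr (- s) \<cdot> \<bar>w\<bar> ^ (2 n)\<close> is finite for
  every \<open>s\<close>.
\<close>

lemma point_evaluation_coeff_energy:
  assumes w: "w \<in> unit_disc"
  obtains C where "C > 0"
    "\<And>g. g holomorphic_on unit_disc \<Longrightarrow> ennreal ((norm (g w))\<^sup>2) \<le> ennreal C * coeff_energy s g"
proof -
  define x where "x = (norm w)\<^sup>2"
  have x: "0 \<le> x" "x < 1" using w by (auto simp: x_def power_less_one_iff)
  define A where "A = (\<Sum>n. (real n + 1) powr (- s) * x ^ n)"
  have sA: "summable (\<lambda>n. (real n + 1) powr (- s) * x ^ n)"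
    by (rule summable_powr_times_geometric[OF x])
  have A0: "A \<ge> 0" unfolding A_def by (intro suminf_nonneg sA) (use x in auto)
  show ?thesis
  proof (rule that[of "A + 1"])
    fix g assume g: "g holomorphic_on unit_disc"
    let ?a = "\<lambda>n. (real n + 1) powr s * (norm (taylor_coeff g n))\<^sup>2"
    show "ennreal ((norm (g w))\<^sup>2) \<le> ennreal (A + 1) * coeff_energy s g"
    proof (cases "coeff_energy s g = top")
      case True
      then show ?thesis using A0 by (simp add: ennreal_mult_top)
    next
      case False
      then have s: "summable ?a" and e: "coeff_energy s g = ennreal (\<Sum>n. ?a n)"
        unfolding coeff_energy_def by (auto intro!: summable_suminf_not_top suminf_ennreal2)
      have "(norm (\<Sum>n<N. taylor_coeff g n * w ^ n))\<^sup>2 \<le> (\<Sum>n. ?a n) * A" for N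
      proof -
        have "norm (\<Sum>n<N. taylor_coeff g n * w ^ n) \<le> (\<Sum>n<N. norm (taylor_coeff g n * w ^ n))"
          by (rule norm_sum)
        also have "\<dots> = (\<Sum>n<N. ((real n + 1) powr (s/2) * norm (taylor_coeff g n)) * ((real n + 1) powr (- s/2) * norm w ^ n))"
          by (intro sum.cong) (auto simp: norm_mult norm_power powr_minus field_simps)
        finally have "(norm (\<Sum>n<N. taylor_coeff g n * w ^ n))\<^sup>2 \<le>
          (\<Sum>n<N. ((real n + 1) powr (s/2) * norm (taylor_coeff g n)) * ((real n + 1) powr (- s/2) * norm w ^ n))\<^sup>2"
          by (intro power_mono) auto
        also have "\<dots> \<le> (\<Sum>n<N. ((real n + 1) powr (s/2) * norm (taylor_coeff g n))\<^sup>2) * (\<Sum>n<N. ((real n + 1) powr (- s/2) * norm w ^ n)\<^sup>2)"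
          by (rule Cauchy_Schwarz_ineq_sum)
        also have "\<dots> = (\<Sum>n<N. ?a n) * (\<Sum>n<N. (real n + 1) powr (- s) * x ^ n)"
        proof -
          have "((real n + 1) powr (t / 2) * y)\<^sup>2 = (real n + 1) powr t * y\<^sup>2" for n t y
            by (simp add: power_mult_distrib) (simp add: power2_eq_square flip: powr_add)
          moreover from this[of _ "- s"]
          have "((real n + 1) powr - (s / 2) * y)\<^sup>2 = (real n + 1) powr - s * y\<^sup>2" for n y
            by simp
          moreover have "(norm w ^ n)\<^sup>2 = x ^ n" for n
            by (simp add: x_def mult.commute flip: power_mult)
          ultimately show ?thesis by simp
        qed
        also have "\<dots> \<le> (\<Sum>n. ?a n) * A"
          unfolding A_def using x
          by (intro mult_mono sum_le_suminf s sA suminf_nonneg sum_nonneg) auto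
        finally show ?thesis .
      qed
      moreover have "(\<lambda>N. (norm (\<Sum>n<N. taylor_coeff g n * w ^ n))\<^sup>2) \<longlonglongrightarrow> (norm (g w))\<^sup>2"
        using taylor_coeff_sums[OF g w] unfolding sums_def by (intro tendsto_intros)
      ultimately have "(norm (g w))\<^sup>2 \<le> (\<Sum>n. ?a n) * A"
        by (intro LIMSEQ_le_const2) auto
      also have "\<dots> \<le> (A + 1) * (\<Sum>n. ?a n)"
        using suminf_nonneg[OF s] by (simp add: algebra_simps)
      finally have "ennreal ((norm (g w))\<^sup>2) \<le> ennreal ((A + 1) * (\<Sum>n. ?a n))"
        by (rule ennreal_leI)
      also have "\<dots> = ennreal (A + 1) * ennreal (\<Sum>n. ?a n)"
        using A0 by (intro ennreal_mult') auto
      finally show ?thesis unfolding e .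
    qed
  qed (use A0 in auto)
qed

section \<open>Composition with a univalent self-map\<close>

lemma set_nn_integral_disc_cmult:
  assumes "continuous_on unit_disc f"
  shows "(\<integral>\<^sup>+z\<in>unit_disc. c * ennreal (f z) \<partial>lborel) = c * (\<integral>\<^sup>+z\<in>unit_disc. ennreal (f z) \<partial>lborel)"
  using borel_measurable_disc_integrand[OF assms]
  by (simp add: nn_integral_cmult mult.assoc)

lemma set_nn_integral_disc_add:
  assumes "continuous_on unit_disc f" "continuous_on unit_disc g"
  shows "(\<integral>\<^sup>+z\<in>unit_disc. (ennreal (f z) + ennreal (g z)) \<partial>lborel)
    = (\<integral>\<^sup>+z\<in>unit_disc. ennreal (f z) \<partial>lborel) + (\<integral>\<^sup>+z\<in>unit_disc. ennreal (g z) \<partial>lborel)"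
  using borel_measurable_disc_integrand[OF assms(1)] borel_measurable_disc_integrand[OF assms(2)]
  by (simp add: nn_integral_add distrib_right)

lemma holomorphic_self_mapD:
  assumes "holomorphic_self_map \<phi>"
  shows "\<phi> holomorphic_on unit_disc" "z \<in> unit_disc \<Longrightarrow> \<phi> z \<in> unit_disc"
  using assms unfolding holomorphic_self_map_def by blast+

lemma holomorphic_on_comp_self_map:
  assumes "holomorphic_self_map \<phi>" "g holomorphic_on unit_disc"
  shows "(\<lambda>z. g (\<phi> z)) holomorphic_on unit_disc"
  using holomorphic_on_compose_gen[of \<phi> unit_disc g unit_disc] assms
  by (simp add: o_def holomorphic_self_map_def)

lemma defect_le_1: "defect z \<le> 1"
  by (simp add: defect_def)

lemma defect_Moebius:
  assumes "w \<in> unit_disc" "z \<in> unit_disc"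
  shows "defect (Moebius_function 0 w z) = defect w * defect z / (norm (1 - cnj w * z))\<^sup>2"
proof -
  have "norm (cnj w * z) < 1"
    using assms norm_mult_less[of "cnj w" 1 z 1] by simp
  then have "1 - cnj w * z \<noteq> 0" by auto
  then have nz: "(norm (1 - cnj w * z))\<^sup>2 \<noteq> 0" by simp
  have "(norm (1 - cnj w * z))\<^sup>2 - (norm (z - w))\<^sup>2 = defect w * defect z"
    unfolding defect_def cmod_power2 by (simp add: algebra_simps power2_eq_square)
  then show ?thesis
    using nz unfolding defect_def Moebius_function_simple
    by (simp add: norm_divide power_divide field_simps)
qed

lemma norm_one_minus_cnj_mult:
  assumes "w \<in> unit_disc" "z \<in> unit_disc"
  shows "1 - norm w \<le> norm (1 - cnj w * z)" "norm (1 - cnj w * z) \<le> 2"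
proof -
  have "norm (cnj w * z) \<le> norm w"
    using assms by (simp add: norm_mult mult_left_le)
  then show "1 - norm w \<le> norm (1 - cnj w * z)"
    using norm_triangle_ineq2[of 1 "cnj w * z"] by simp
  show "norm (1 - cnj w * z) \<le> 2"
    using norm_triangle_ineq4[of 1 "cnj w * z"] \<open>norm (cnj w * z) \<le> norm w\<close> assms(1) by simp
qed

text \<open>
  A form of the Schwarz-Pick lemma. After composing with the Moebius transformation that sends
  \<open>\<phi> 0\<close> to 0, the Schwarz lemma applies; Moebius transformations change the defect by a bounded
  factor.
\<close>

lemma defect_le_defect_self_map:
  assumes "holomorphic_self_map \<phi>"
  obtains C where "C \<ge> 1" "\<And>z. z \<in> unit_disc \<Longrightarrow> defect z \<le> C * defect (\<phi> z)"
proof -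
  define w where "w = \<phi> 0"
  note hol = holomorphic_self_mapD(1)[OF assms] and im = holomorphic_self_mapD(2)[OF assms]
  have w: "w \<in> unit_disc" unfolding w_def by (rule im) simp
  define h where "h = (\<lambda>z. Moebius_function 0 w (\<phi> z))"
  have "h holomorphic_on unit_disc"
    unfolding h_def using w by (intro holomorphic_on_comp_self_map[OF assms] Moebius_function_holomorphic) auto
  moreover have "h 0 = 0" by (simp add: h_def w_def Moebius_function_eq_zero)
  moreover have "norm (h z) < 1" if "norm z < 1" for z
    unfolding h_def using im[of z] w that by (auto intro!: Moebius_function_norm_lt_1)
  ultimately have sch: "norm (h z) \<le> norm z" if "norm z < 1" for z
    using Schwarz_Lemma(1)[of h z] that by blast
  show ?thesis
  proof (rule that[of "1 / (1 - norm w)\<^sup>2"])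
    have "0 < 1 - norm w" "1 - norm w \<le> 1" using w by auto
    then show "1 \<le> 1 / (1 - norm w)\<^sup>2"
      by (simp add: power_le_one)
    fix z assume z: "z \<in> unit_disc"
    have "(norm (h z))\<^sup>2 \<le> (norm z)\<^sup>2"
      using sch z by (intro power_mono) auto
    then have "defect z \<le> defect (h z)" by (simp add: defect_def)
    also have "\<dots> = defect w * defect (\<phi> z) / (norm (1 - cnj w * \<phi> z))\<^sup>2"
      unfolding h_def by (rule defect_Moebius[OF w im[OF z]])
    also have "\<dots> \<le> 1 * defect (\<phi> z) / (1 - norm w)\<^sup>2"
      using w im[OF z] defect_pos[OF im[OF z]] defect_pos[OF w]
      by (intro frac_le mult_right_mono power_mono norm_one_minus_cnj_mult defect_le_1) auto
    finally show "defect z \<le> 1 / (1 - norm w)\<^sup>2 * defect (\<phi> z)" by simp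
  qed
qed

text \<open>
  The change of variables turns the left-hand side into an integral over the image of \<open>\<phi>\<close>; this
  is the place where \<open>\<phi>\<close> has to be injective.
\<close>

lemma nn_integral_univalent_comp_le:
  assumes \<phi>: "holomorphic_self_map \<phi>" "inj_on \<phi> unit_disc"
    and u: "continuous_on unit_disc u"
  shows "(\<integral>\<^sup>+z\<in>unit_disc. ennreal (u (\<phi> z) * (norm (deriv \<phi> z))\<^sup>2) \<partial>lborel) \<le> (\<integral>\<^sup>+w\<in>unit_disc. ennreal (u w) \<partial>lborel)"
proof -
  note hol = holomorphic_self_mapD(1)[OF \<phi>(1)] and im = holomorphic_self_mapD(2)[OF \<phi>(1)]
  let ?F = "\<lambda>w. ennreal (u w) * indicator unit_disc w"
  have "(\<integral>\<^sup>+z\<in>unit_disc. ennreal (u (\<phi> z) * (norm (deriv \<phi> z))\<^sup>2) \<partial>lborel)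
    = (\<integral>\<^sup>+z\<in>unit_disc. ?F (\<phi> z) * ennreal ((norm (deriv \<phi> z))\<^sup>2) \<partial>lborel)"
    using im by (intro nn_integral_cong) (auto simp: indicator_def ennreal_mult'')
  also have "\<dots> = (\<integral>\<^sup>+w\<in>\<phi> ` unit_disc. ?F w \<partial>lborel)"
    by (rule nn_integral_injective_holomorphic_image[OF _ hol \<phi>(2) borel_measurable_disc_integrand[OF u], symmetric]) simp
  also have "\<dots> \<le> (\<integral>\<^sup>+w\<in>unit_disc. ennreal (u w) \<partial>lborel)"
    by (intro nn_integral_mono) (auto simp: indicator_def)
  finally show ?thesis .
qed

lemma ennreal_mult_trans:
  assumes "x \<le> ennreal a * y" "y \<le> ennreal b * z" "0 \<le> a" "0 \<le> b"
  shows "x \<le> ennreal (a * b) * z"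
  using order_trans[OF assms(1) mult_left_mono[OF assms(2), of "ennreal a"]] assms(3,4)
  by (simp add: ennreal_mult mult.assoc)

text \<open>
  The integral of \<open>\<bar>g \<circ> \<phi>\<bar>\<^sup>2\<close> has no factor \<open>\<bar>\<phi>'\<bar>\<^sup>2\<close>, so the change of variables does not apply
  directly. Passing to the derivative of \<open>g \<circ> \<phi>\<close> produces that factor and raises the exponent of
  the weight by 2.
\<close>

lemma bergman_integral_univalent_comp_le:
  assumes \<beta>: "\<beta> > (-1::real)" and \<phi>: "holomorphic_self_map \<phi>" "inj_on \<phi> unit_disc"
  obtains C where "C \<ge> 0" "\<And>g. g holomorphic_on unit_disc \<Longrightarrow>
    bergman_integral \<beta> (\<lambda>z. g (\<phi> z)) \<le> ennreal C * coeff_energy (- \<beta> - 1) g"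
proof -
  note hol = holomorphic_self_mapD(1)[OF \<phi>(1)] and im = holomorphic_self_mapD(2)[OF \<phi>(1)]
  obtain U where U: "U > 0" "\<And>g. g holomorphic_on unit_disc \<Longrightarrow> bergman_integral \<beta> g \<le> ennreal U * coeff_energy (- \<beta> - 1) g"
    using bergman_integral_equiv_coeff_energy[OF \<beta>] by metis
  have "\<beta> + 2 > -1" using \<beta> by simp
  then obtain L V where L: "L > 0" "\<And>g. g holomorphic_on unit_disc \<Longrightarrow> coeff_energy (- (\<beta> + 2) - 1) g \<le> ennreal L * bergman_integral (\<beta> + 2) g"
    and V: "V > 0" "\<And>g. g holomorphic_on unit_disc \<Longrightarrow> bergman_integral (\<beta> + 2) g \<le> ennreal V * coeff_energy (- (\<beta> + 2) - 1) g"
    using bergman_integral_equiv_coeff_energy by metis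
  obtain P where P: "P > 0" "\<And>g. g holomorphic_on unit_disc \<Longrightarrow> ennreal ((norm (g (\<phi> 0)))\<^sup>2) \<le> ennreal P * coeff_energy (- \<beta> - 1) g"
    using point_evaluation_coeff_energy[OF im, of 0] by (metis centre_in_ball zero_less_one)
  obtain S where S: "S \<ge> 1" "\<And>z. z \<in> unit_disc \<Longrightarrow> defect z \<le> S * defect (\<phi> z)"
    using defect_le_defect_self_map[OF \<phi>(1)] by metis
  define s where "s = - \<beta> - 3"
  define K where "K = 2 powr \<bar>s + 2\<bar>"
  have K: "K \<ge> 0" by (simp add: K_def)
  have s: "- (\<beta> + 2) - 1 = s" "- \<beta> - 1 = s + 2" by (auto simp: s_def)
  define Q where "Q = S powr (\<beta> + 2)"
  have Q: "Q \<ge> 0" by (simp add: Q_def)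
  show ?thesis
  proof (rule that[of "U * (P + K * (L * (Q * (V * K))))"])
    fix g assume g: "g holomorphic_on unit_disc"
    let ?h = "\<lambda>z. g (\<phi> z)"
    have h: "?h holomorphic_on unit_disc"
      by (rule holomorphic_on_comp_self_map[OF \<phi>(1) g])
    have dg: "deriv g holomorphic_on unit_disc" by (rule holomorphic_deriv[OF g]) simp
    have dh: "deriv ?h z = deriv g (\<phi> z) * deriv \<phi> z" if "z \<in> unit_disc" for z
      using deriv_chain[of \<phi> z g] that im[OF that] holomorphic_on_imp_differentiable_at[OF hol]
        holomorphic_on_imp_differentiable_at[OF g] by (simp add: o_def)
    have "bergman_integral (\<beta> + 2) (deriv ?h) \<le> (\<integral>\<^sup>+z\<in>unit_disc. ennreal Q *
        ennreal ((norm (deriv g (\<phi> z)))\<^sup>2 * defect (\<phi> z) powr (\<beta> + 2) * (norm (deriv \<phi> z))\<^sup>2) \<partial>lborel)"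
      unfolding bergman_integral_def
    proof (rule nn_integral_mono)
      fix z
      show "ennreal ((norm (deriv ?h z))\<^sup>2 * defect z powr (\<beta> + 2)) * indicator unit_disc z
         \<le> ennreal Q * ennreal ((norm (deriv g (\<phi> z)))\<^sup>2 * defect (\<phi> z) powr (\<beta> + 2) * (norm (deriv \<phi> z))\<^sup>2) * indicator unit_disc z"
      proof (cases "z \<in> unit_disc")
        case True
        have "defect z powr (\<beta> + 2) \<le> (S * defect (\<phi> z)) powr (\<beta> + 2)"
          using S(2)[OF True] defect_pos[OF True] \<beta> by (intro powr_mono2) auto
        also have "\<dots> = Q * defect (\<phi> z) powr (\<beta> + 2)"
          using S(1) defect_pos[OF im[OF True]] by (simp add: Q_def powr_mult)
        finally have "(norm (deriv ?h z))\<^sup>2 * defect z powr (\<beta> + 2)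
           \<le> (norm (deriv ?h z))\<^sup>2 * (Q * defect (\<phi> z) powr (\<beta> + 2))"
          by (intro mult_left_mono) auto
        also have "\<dots> = Q * ((norm (deriv g (\<phi> z)))\<^sup>2 * defect (\<phi> z) powr (\<beta> + 2) * (norm (deriv \<phi> z))\<^sup>2)"
          by (simp add: dh[OF True] norm_mult power_mult_distrib)
        finally show ?thesis using True Q by (simp add: ennreal_leI flip: ennreal_mult')
      qed simp
    qed
    also have "\<dots> = ennreal Q * (\<integral>\<^sup>+z\<in>unit_disc.
        ennreal ((norm (deriv g (\<phi> z)))\<^sup>2 * defect (\<phi> z) powr (\<beta> + 2) * (norm (deriv \<phi> z))\<^sup>2) \<partial>lborel)"
      by (intro set_nn_integral_disc_cmult continuous_intros continuous_on_compose2[OF continuous_on_defect_powr]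
           continuous_on_compose2[OF holomorphic_on_imp_continuous_on[OF dg]]
           holomorphic_on_imp_continuous_on holomorphic_deriv hol) (use im in auto)
    also have "\<dots> \<le> ennreal Q * bergman_integral (\<beta> + 2) (deriv g)"
      unfolding bergman_integral_def
      by (intro mult_left_mono nn_integral_univalent_comp_le[OF \<phi>] continuous_intros
            holomorphic_on_imp_continuous_on dg) auto
    finally have 1: "bergman_integral (\<beta> + 2) (deriv ?h) \<le> ennreal Q * bergman_integral (\<beta> + 2) (deriv g)" .
    have 2: "bergman_integral (\<beta> + 2) (deriv g) \<le> ennreal (V * K) * coeff_energy (s + 2) g"
      by (rule ennreal_mult_trans[OF V(2)[OF dg, unfolded s] coeff_energy_deriv_le[of s g, folded K_def]]) (use V K in auto)
    have "coeff_energy s (deriv ?h) \<le> ennreal (L * (Q * (V * K))) * coeff_energy (s + 2) g"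
      by (rule ennreal_mult_trans[OF L(2)[unfolded s] ennreal_mult_trans[OF 1 2]])
         (use h L V K Q in \<open>auto intro!: holomorphic_deriv\<close>)
    then have "ennreal K * coeff_energy s (deriv ?h) \<le> ennreal K * (ennreal (L * (Q * (V * K))) * coeff_energy (s + 2) g)"
      by (rule mult_left_mono) simp
    then have "coeff_energy (s + 2) ?h \<le> ennreal P * coeff_energy (s + 2) g + ennreal K * (ennreal (L * (Q * (V * K))) * coeff_energy (s + 2) g)"
      using coeff_energy_le_deriv[of s ?h, folded K_def] P(2)[OF g, unfolded s]
      by (meson add_mono order_trans)
    also have "\<dots> = ennreal (P + K * (L * (Q * (V * K)))) * coeff_energy (s + 2) g"
      using P K L Q V by (simp add: ennreal_plus ennreal_mult distrib_right mult.assoc)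
    finally have "coeff_energy (s + 2) ?h \<le> \<dots>" .
    from ennreal_mult_trans[OF U(2)[OF h, unfolded s] this]
    show "bergman_integral \<beta> ?h \<le> ennreal (U * (P + K * (L * (Q * (V * K))))) * coeff_energy (- \<beta> - 1) g"
      using U P K L Q V by (simp add: s)
  qed (use U P K L Q V in auto)
qed

section \<open>The second derivative of a weighted composition\<close>

lemma taylor_coeff_cong:
  assumes "\<And>z. z \<in> unit_disc \<Longrightarrow> f z = g z"
  shows "taylor_coeff f = taylor_coeff g"
proof -
  have "eventually (\<lambda>z. f z = g z) (nhds 0)"
    using eventually_nhds_in_open[of unit_disc 0] by (rule eventually_mono) (use assms in auto)
  then show ?thesis
    by (simp add: taylor_coeff_def fps_expansion_cong fun_eq_iff)
qed

lemma coeff_energy_cong: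
  assumes "\<And>z. z \<in> unit_disc \<Longrightarrow> f z = g z"
  shows "coeff_energy s f = coeff_energy s g"
proof -
  have "taylor_coeff f = taylor_coeff g" using assms by (rule taylor_coeff_cong)
  then show ?thesis by (simp add: coeff_energy_def)
qed

lemma deriv_weighted_comp:
  assumes \<phi>: "holomorphic_self_map \<phi>" and \<psi>: "\<psi> holomorphic_on unit_disc" and f: "f holomorphic_on unit_disc"
    and z: "z \<in> unit_disc"
  shows "deriv (\<lambda>z. \<psi> z * f (\<phi> z)) z = deriv \<psi> z * f (\<phi> z) + \<psi> z * deriv \<phi> z * deriv f (\<phi> z)"
proof -
  note hol = holomorphic_self_mapD(1)[OF \<phi>] and im = holomorphic_self_mapD(2)[OF \<phi>]
  have 1: "(\<psi> has_field_derivative deriv \<psi> z) (at z)" "(\<phi> has_field_derivative deriv \<phi> z) (at z)"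
    "(f has_field_derivative deriv f (\<phi> z)) (at (\<phi> z))"
    using z im hol \<psi> f by (auto intro!: holomorphic_derivI[of _ unit_disc])
  have c: "((\<lambda>z. f (\<phi> z)) has_field_derivative deriv f (\<phi> z) * deriv \<phi> z) (at z)"
    using DERIV_chain[OF 1(3) 1(2)] by (simp add: o_def)
  show ?thesis
    by (rule DERIV_imp_deriv) (rule derivative_eq_intros 1(1) c refl | simp add: algebra_simps)+
qed

lemma deriv2_weighted_comp:
  assumes \<phi>: "holomorphic_self_map \<phi>" and \<psi>: "\<psi> holomorphic_on unit_disc" and f: "f holomorphic_on unit_disc"
    and z: "z \<in> unit_disc"
  shows "deriv (deriv (\<lambda>z. \<psi> z * f (\<phi> z))) z = deriv (deriv \<psi>) z * f (\<phi> z)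
    + (2 * deriv \<psi> z * deriv \<phi> z + \<psi> z * deriv (deriv \<phi>) z) * deriv f (\<phi> z)
    + \<psi> z * (deriv \<phi> z)\<^sup>2 * deriv (deriv f) (\<phi> z)"
proof -
  note hol = holomorphic_self_mapD(1)[OF \<phi>] and im = holomorphic_self_mapD(2)[OF \<phi>]
  have d: "deriv \<psi> holomorphic_on unit_disc" "deriv \<phi> holomorphic_on unit_disc" "deriv f holomorphic_on unit_disc"
    using hol \<psi> f by (auto intro!: holomorphic_deriv)
  have 1: "(\<psi> has_field_derivative deriv \<psi> z) (at z)" "(\<phi> has_field_derivative deriv \<phi> z) (at z)"
    "(f has_field_derivative deriv f (\<phi> z)) (at (\<phi> z))"
    "(deriv \<psi> has_field_derivative deriv (deriv \<psi>) z) (at z)" "(deriv \<phi> has_field_derivative deriv (deriv \<phi>) z) (at z)"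
    "(deriv f has_field_derivative deriv (deriv f) (\<phi> z)) (at (\<phi> z))"
    using z im hol \<psi> f d by (auto intro!: holomorphic_derivI[of _ unit_disc])
  have c: "((\<lambda>z. f (\<phi> z)) has_field_derivative deriv f (\<phi> z) * deriv \<phi> z) (at z)"
    "((\<lambda>z. deriv f (\<phi> z)) has_field_derivative deriv (deriv f) (\<phi> z) * deriv \<phi> z) (at z)"
    using DERIV_chain[OF 1(3) 1(2)] DERIV_chain[OF 1(6) 1(2)] by (simp_all add: o_def)
  have "((\<lambda>z. deriv \<psi> z * f (\<phi> z) + \<psi> z * deriv \<phi> z * deriv f (\<phi> z)) has_field_derivative
     deriv (deriv \<psi>) z * f (\<phi> z)
    + (2 * deriv \<psi> z * deriv \<phi> z + \<psi> z * deriv (deriv \<phi>) z) * deriv f (\<phi> z)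
    + \<psi> z * (deriv \<phi> z)\<^sup>2 * deriv (deriv f) (\<phi> z)) (at z)"
    by (rule derivative_eq_intros 1(1,2,4,5) c refl | simp add: algebra_simps power2_eq_square)+
  then have "(deriv (\<lambda>z. \<psi> z * f (\<phi> z)) has_field_derivative
     deriv (deriv \<psi>) z * f (\<phi> z)
    + (2 * deriv \<psi> z * deriv \<phi> z + \<psi> z * deriv (deriv \<phi>) z) * deriv f (\<phi> z)
    + \<psi> z * (deriv \<phi> z)\<^sup>2 * deriv (deriv f) (\<phi> z)) (at z)"
    by (rule has_field_derivative_transform_within_open[where S = unit_disc])
       (use z deriv_weighted_comp[OF \<phi> \<psi> f] in auto)
  then show ?thesis by (rule DERIV_imp_deriv)
qed

lemma norm_add3_square_le:
  fixes a b c :: "'a::real_normed_vector"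
  shows "(norm (a + b + c))\<^sup>2 \<le> 3 * ((norm a)\<^sup>2 + (norm b)\<^sup>2 + (norm c)\<^sup>2)"
proof -
  have "norm (a + b + c) \<le> norm a + norm b + norm c"
    using norm_triangle_ineq[of "a + b" c] norm_triangle_ineq[of a b] by linarith
  then have "(norm (a + b + c))\<^sup>2 \<le> (norm a + norm b + norm c)\<^sup>2"
    by (intro power_mono) auto
  also have "\<dots> \<le> 3 * ((norm a)\<^sup>2 + (norm b)\<^sup>2 + (norm c)\<^sup>2)"
    using sum_squares_ge_zero[of "norm a - norm b" "norm b - norm c"] zero_le_power2[of "norm a - norm c"]
    by (simp add: power2_eq_square algebra_simps)
  finally show ?thesis .
qed

lemma norm_add2_square_le:
  fixes a b :: "'a::real_normed_vector"
  shows "(norm (a + b))\<^sup>2 \<le> 2 * ((norm a)\<^sup>2 + (norm b)\<^sup>2)"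
proof -
  have "(norm (a + b))\<^sup>2 \<le> (norm a + norm b)\<^sup>2"
    by (intro power_mono norm_triangle_ineq) auto
  also have "\<dots> \<le> 2 * ((norm a)\<^sup>2 + (norm b)\<^sup>2)"
    using zero_le_power2[of "norm a - norm b"] by (simp add: power2_eq_square algebra_simps)
  finally show ?thesis .
qed

text \<open>
  The three terms of the second derivative are estimated pointwise. Each factor \<open>1 - \<bar>z\<bar>\<^sup>2\<close>
  spent on bounding \<open>\<psi>''\<close> or \<open>\<psi>'\<close> lowers the exponent of the weight. The form
  \<open>\<epsilon> + K \<cdot> defect (\<phi> z)\<close> of the bound for the leading coefficient combines smallness near the
  circle with mere boundedness on compact sets: its second part raises the exponent of the
  weight at \<open>\<phi> z\<close> by 1 and so is of lower order.
\<close>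

lemma bergman_integral_deriv2_weighted_comp_le:
  fixes \<alpha> M :: real
  assumes \<phi>: "holomorphic_self_map \<phi>" "inj_on \<phi> unit_disc"
    and \<psi>: "\<psi> holomorphic_on unit_disc" and f: "f holomorphic_on unit_disc"
    and \<phi>1: "\<And>z. z \<in> unit_disc \<Longrightarrow> norm (deriv \<phi> z) \<le> M"
    and \<phi>2: "\<And>z. z \<in> unit_disc \<Longrightarrow> norm (deriv (deriv \<phi>) z) \<le> M"
    and \<psi>0: "\<And>z. z \<in> unit_disc \<Longrightarrow> norm (\<psi> z) \<le> M"
    and \<psi>1: "\<And>z. z \<in> unit_disc \<Longrightarrow> (norm (deriv \<psi> z))\<^sup>2 * defect z \<le> M"
    and \<psi>2: "\<And>z. z \<in> unit_disc \<Longrightarrow> norm (deriv (deriv \<psi>) z) * defect z \<le> M"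
    and small: "\<And>z. z \<in> unit_disc \<Longrightarrow>
       (norm (\<psi> z))\<^sup>2 * defect z powr (\<alpha> + 2) \<le> (\<epsilon> + K * defect (\<phi> z)) * defect (\<phi> z) powr (\<alpha> + 2)"
    and \<epsilon>: "\<epsilon> \<ge> 0" and K: "K \<ge> 0"
  shows "bergman_integral (\<alpha> + 2) (deriv (deriv (\<lambda>z. \<psi> z * f (\<phi> z))))
    \<le> ennreal (3 * M\<^sup>2) * bergman_integral \<alpha> (\<lambda>z. f (\<phi> z))
    + ennreal (3 * (8 * M ^ 3 + 2 * M ^ 4)) * bergman_integral (\<alpha> + 1) (\<lambda>z. deriv f (\<phi> z))
    + ennreal (3 * M\<^sup>2 * \<epsilon>) * bergman_integral (\<alpha> + 2) (deriv (deriv f))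
    + ennreal (3 * M\<^sup>2 * K) * bergman_integral (\<alpha> + 3) (deriv (deriv f))"
proof -
  note hol = holomorphic_self_mapD(1)[OF \<phi>(1)] and im = holomorphic_self_mapD(2)[OF \<phi>(1)]
  have M: "M \<ge> 0" using order_trans[OF norm_ge_zero \<phi>1[of 0]] by simp
  have d: "deriv f holomorphic_on unit_disc" "deriv (deriv f) holomorphic_on unit_disc"
    using f by (auto intro!: holomorphic_deriv)
  let ?A = "\<lambda>z. (norm (f (\<phi> z)))\<^sup>2 * defect z powr \<alpha>"
  let ?B = "\<lambda>z. (norm (deriv f (\<phi> z)))\<^sup>2 * defect z powr (\<alpha> + 1)"
  let ?u = "\<lambda>\<beta> w. (norm (deriv (deriv f) w))\<^sup>2 * defect w powr \<beta>"
  let ?C = "\<lambda>\<beta> z. ?u \<beta> (\<phi> z) * (norm (deriv \<phi> z))\<^sup>2"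
  let ?a = "3 * M\<^sup>2" and ?b = "3 * (8 * M ^ 3 + 2 * M ^ 4)" and ?c = "3 * M\<^sup>2 * \<epsilon>" and ?e = "3 * M\<^sup>2 * K"
  have ab: "?a \<ge> 0" "?b \<ge> 0" "?c \<ge> 0" "?e \<ge> 0" using M \<epsilon> K by auto
  have ptw: "(norm (deriv (deriv (\<lambda>z. \<psi> z * f (\<phi> z))) z))\<^sup>2 * defect z powr (\<alpha> + 2)
      \<le> ?a * ?A z + ?b * ?B z + ?c * ?C (\<alpha> + 2) z + ?e * ?C (\<alpha> + 3) z" if z: "z \<in> unit_disc" for z
  proof -
    let ?d = "defect z"
    have dz: "?d > 0" "?d \<le> 1" using z by (auto simp: defect_pos defect_le_1)
    have dirichlet_weight: "defect (\<phi> z) > 0" using im[OF z] by (rule defect_pos)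
    have p: "?d powr (\<alpha> + 2) = ?d\<^sup>2 * ?d powr \<alpha>" "?d powr (\<alpha> + 2) = ?d * ?d powr (\<alpha> + 1)"
      "defect (\<phi> z) powr (\<alpha> + 3) = defect (\<phi> z) * defect (\<phi> z) powr (\<alpha> + 2)"
      using dz dirichlet_weight by (simp_all add: powr_add powr_numeral power2_eq_square power3_eq_cube)
    let ?X = "deriv (deriv \<psi>) z * f (\<phi> z)"
    let ?Y = "(2 * deriv \<psi> z * deriv \<phi> z + \<psi> z * deriv (deriv \<phi>) z) * deriv f (\<phi> z)"
    let ?Z = "\<psi> z * (deriv \<phi> z)\<^sup>2 * deriv (deriv f) (\<phi> z)"
    have X: "(norm ?X)\<^sup>2 * ?d powr (\<alpha> + 2) \<le> M\<^sup>2 * ?A z"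
    proof -
      have "(norm ?X)\<^sup>2 * ?d powr (\<alpha> + 2) = (norm (deriv (deriv \<psi>) z) * ?d)\<^sup>2 * ?A z"
        by (simp add: p(1) norm_mult power_mult_distrib)
      also have "\<dots> \<le> M\<^sup>2 * ?A z"
        using \<psi>2[OF z] dz by (intro mult_right_mono power_mono) auto
      finally show ?thesis .
    qed
    have Y: "(norm ?Y)\<^sup>2 * ?d powr (\<alpha> + 2) \<le> (8 * M ^ 3 + 2 * M ^ 4) * ?B z"
    proof -
      have "(norm (2 * deriv \<psi> z * deriv \<phi> z + \<psi> z * deriv (deriv \<phi>) z))\<^sup>2 * ?d
         \<le> 2 * ((norm (2 * deriv \<psi> z * deriv \<phi> z))\<^sup>2 + (norm (\<psi> z * deriv (deriv \<phi>) z))\<^sup>2) * ?d"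
        using dz by (intro mult_right_mono norm_add2_square_le) auto
      also have "\<dots> = 8 * (((norm (deriv \<psi> z))\<^sup>2 * ?d) * (norm (deriv \<phi> z))\<^sup>2)
          + 2 * (((norm (\<psi> z))\<^sup>2 * (norm (deriv (deriv \<phi>) z))\<^sup>2) * ?d)"
        by (simp add: norm_mult power_mult_distrib algebra_simps)
      also have "\<dots> \<le> 8 * (M * M\<^sup>2) + 2 * ((M\<^sup>2 * M\<^sup>2) * 1)"
        using \<psi>1[OF z] \<phi>1[OF z] \<psi>0[OF z] \<phi>2[OF z] dz M
        by (intro add_mono mult_mono power_mono) auto
      also have "\<dots> = 8 * M ^ 3 + 2 * M ^ 4"
        by (simp add: power2_eq_square power3_eq_cube power4_eq_xxxx mult.assoc)
      finally have 1: "(norm (2 * deriv \<psi> z * deriv \<phi> z + \<psi> z * deriv (deriv \<phi>) z))\<^sup>2 * ?d \<le> \<dots>" .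
      have "(norm ?Y)\<^sup>2 * ?d powr (\<alpha> + 2)
        = ((norm (2 * deriv \<psi> z * deriv \<phi> z + \<psi> z * deriv (deriv \<phi>) z))\<^sup>2 * ?d) * ?B z"
        unfolding p(2) norm_mult[of _ "deriv f (\<phi> z)"] power_mult_distrib by (simp add: mult_ac)
      also have "\<dots> \<le> (8 * M ^ 3 + 2 * M ^ 4) * ?B z"
        by (rule mult_right_mono[OF 1]) auto
      finally show ?thesis .
    qed
    have Z: "(norm ?Z)\<^sup>2 * ?d powr (\<alpha> + 2) \<le> M\<^sup>2 * (\<epsilon> * ?C (\<alpha> + 2) z + K * ?C (\<alpha> + 3) z)"
    proof -
      have "(norm ?Z)\<^sup>2 * ?d powr (\<alpha> + 2) = ((norm (\<psi> z))\<^sup>2 * ?d powr (\<alpha> + 2)) *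
          ((norm (deriv \<phi> z))\<^sup>2 * ((norm (deriv (deriv f) (\<phi> z)))\<^sup>2 * (norm (deriv \<phi> z))\<^sup>2))"
        by (simp add: norm_mult norm_power power_mult_distrib power2_eq_square)
      also have "\<dots> \<le> ((\<epsilon> + K * defect (\<phi> z)) * defect (\<phi> z) powr (\<alpha> + 2)) *
          (M\<^sup>2 * ((norm (deriv (deriv f) (\<phi> z)))\<^sup>2 * (norm (deriv \<phi> z))\<^sup>2))"
      proof (rule mult_mono)
        show "(norm (\<psi> z))\<^sup>2 * ?d powr (\<alpha> + 2) \<le> (\<epsilon> + K * defect (\<phi> z)) * defect (\<phi> z) powr (\<alpha> + 2)"
          by (rule small[OF z])
      qed (use \<phi>1[OF z] \<epsilon> K dirichlet_weight in \<open>auto intro!: mult_right_mono power_mono\<close>)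
      also have "\<dots> = M\<^sup>2 * (\<epsilon> * ?C (\<alpha> + 2) z + K * ?C (\<alpha> + 3) z)"
        unfolding p(3) by (simp add: algebra_simps)
      finally show ?thesis .
    qed
    have "(norm (deriv (deriv (\<lambda>z. \<psi> z * f (\<phi> z))) z))\<^sup>2 * ?d powr (\<alpha> + 2)
       \<le> 3 * ((norm ?X)\<^sup>2 + (norm ?Y)\<^sup>2 + (norm ?Z)\<^sup>2) * ?d powr (\<alpha> + 2)"
      unfolding deriv2_weighted_comp[OF \<phi>(1) \<psi> f z] by (intro mult_right_mono norm_add3_square_le) auto
    also have "\<dots> = 3 * ((norm ?X)\<^sup>2 * ?d powr (\<alpha> + 2) + (norm ?Y)\<^sup>2 * ?d powr (\<alpha> + 2) + (norm ?Z)\<^sup>2 * ?d powr (\<alpha> + 2))"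
      by (simp only: mult.assoc distrib_right)
    also have "\<dots> \<le> 3 * (M\<^sup>2 * ?A z + (8 * M ^ 3 + 2 * M ^ 4) * ?B z + M\<^sup>2 * (\<epsilon> * ?C (\<alpha> + 2) z + K * ?C (\<alpha> + 3) z))"
      using X Y Z by (intro mult_left_mono add_mono) auto
    also have "\<dots> = ?a * ?A z + ?b * ?B z + ?c * ?C (\<alpha> + 2) z + ?e * ?C (\<alpha> + 3) z"
    proof -
      have "3 * (M\<^sup>2 * A + y * B + M\<^sup>2 * (\<epsilon> * C + K * E)) = 3 * M\<^sup>2 * A + 3 * y * B + 3 * M\<^sup>2 * \<epsilon> * C + 3 * M\<^sup>2 * K * E"
        for A B C E y :: real by (simp add: algebra_simps)
      then show ?thesis .
    qed
    finally show ?thesis .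
  qed
  have contA: "continuous_on unit_disc ?A"
    by (intro continuous_intros continuous_on_compose2[OF holomorphic_on_imp_continuous_on[OF f]]
        holomorphic_on_imp_continuous_on[OF hol]) (use im in auto)
  have contB: "continuous_on unit_disc ?B"
    by (intro continuous_intros continuous_on_compose2[OF holomorphic_on_imp_continuous_on[OF d(1)]]
        holomorphic_on_imp_continuous_on[OF hol]) (use im in auto)
  have contu: "continuous_on unit_disc (?u \<beta>)" for \<beta>
    by (intro continuous_intros holomorphic_on_imp_continuous_on d)
  have contC: "continuous_on unit_disc (?C \<beta>)" for \<beta>
    by (intro continuous_on_mult continuous_on_compose2[OF contu] continuous_intros
        holomorphic_on_imp_continuous_on holomorphic_deriv hol) (use im in auto)
  have "bergman_integral (\<alpha> + 2) (deriv (deriv (\<lambda>z. \<psi> z * f (\<phi> z))))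
    \<le> (\<integral>\<^sup>+z\<in>unit_disc. (ennreal (?a * ?A z + ?b * ?B z + ?c * ?C (\<alpha> + 2) z) + ennreal (?e * ?C (\<alpha> + 3) z)) \<partial>lborel)"
    unfolding bergman_integral_def
  proof (intro nn_integral_mono)
    fix z
    show "ennreal ((norm (deriv (deriv (\<lambda>z. \<psi> z * f (\<phi> z))) z))\<^sup>2 * defect z powr (\<alpha> + 2)) * indicator unit_disc z
      \<le> (ennreal (?a * ?A z + ?b * ?B z + ?c * ?C (\<alpha> + 2) z) + ennreal (?e * ?C (\<alpha> + 3) z)) * indicator unit_disc z"
    proof (cases "z \<in> unit_disc")
      case True
      have "0 \<le> ?a * ?A z + ?b * ?B z + ?c * ?C (\<alpha> + 2) z" "0 \<le> ?e * ?C (\<alpha> + 3) z"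
        using ab by (auto intro!: add_nonneg_nonneg mult_nonneg_nonneg)
      then show ?thesis using ptw[OF True] True by (simp add: ennreal_leI flip: ennreal_plus)
    qed simp
  qed
  also have "\<dots> = (\<integral>\<^sup>+z\<in>unit_disc. ennreal (?a * ?A z + ?b * ?B z + ?c * ?C (\<alpha> + 2) z) \<partial>lborel)
      + (\<integral>\<^sup>+z\<in>unit_disc. ennreal (?e * ?C (\<alpha> + 3) z) \<partial>lborel)"
    by (intro set_nn_integral_disc_add continuous_on_add continuous_on_mult continuous_on_const contA contB contC)
  also have "(\<integral>\<^sup>+z\<in>unit_disc. ennreal (?a * ?A z + ?b * ?B z + ?c * ?C (\<alpha> + 2) z) \<partial>lborel)
    = (\<integral>\<^sup>+z\<in>unit_disc. (ennreal (?a * ?A z + ?b * ?B z) + ennreal (?c * ?C (\<alpha> + 2) z)) \<partial>lborel)"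
    using ab by (subst ennreal_plus) (auto intro!: add_nonneg_nonneg mult_nonneg_nonneg)
  also have "\<dots> = (\<integral>\<^sup>+z\<in>unit_disc. ennreal (?a * ?A z + ?b * ?B z) \<partial>lborel)
      + (\<integral>\<^sup>+z\<in>unit_disc. ennreal (?c * ?C (\<alpha> + 2) z) \<partial>lborel)"
    by (intro set_nn_integral_disc_add continuous_on_add continuous_on_mult continuous_on_const contA contB contC)
  also have "(\<integral>\<^sup>+z\<in>unit_disc. ennreal (?a * ?A z + ?b * ?B z) \<partial>lborel)
    = (\<integral>\<^sup>+z\<in>unit_disc. (ennreal (?a * ?A z) + ennreal (?b * ?B z)) \<partial>lborel)"
    using ab by (subst ennreal_plus) (auto intro!: add_nonneg_nonneg mult_nonneg_nonneg)
  also have "\<dots> = (\<integral>\<^sup>+z\<in>unit_disc. ennreal (?a * ?A z) \<partial>lborel) + (\<integral>\<^sup>+z\<in>unit_disc. ennreal (?b * ?B z) \<partial>lborel)"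
    by (intro set_nn_integral_disc_add continuous_on_add continuous_on_mult continuous_on_const contA contB contC)
  also have "(\<integral>\<^sup>+z\<in>unit_disc. ennreal (?a * ?A z) \<partial>lborel) = ennreal ?a * bergman_integral \<alpha> (\<lambda>z. f (\<phi> z))"
    unfolding bergman_integral_def ennreal_mult'[OF ab(1)] by (rule set_nn_integral_disc_cmult[OF contA])
  also have "(\<integral>\<^sup>+z\<in>unit_disc. ennreal (?b * ?B z) \<partial>lborel) = ennreal ?b * bergman_integral (\<alpha> + 1) (\<lambda>z. deriv f (\<phi> z))"
    unfolding bergman_integral_def ennreal_mult'[OF ab(2)] by (rule set_nn_integral_disc_cmult[OF contB])
  also have "(\<integral>\<^sup>+z\<in>unit_disc. ennreal (?c * ?C (\<alpha> + 2) z) \<partial>lborel) = ennreal ?c * (\<integral>\<^sup>+z\<in>unit_disc. ennreal (?C (\<alpha> + 2) z) \<partial>lborel)"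
    unfolding ennreal_mult'[OF ab(3)] by (rule set_nn_integral_disc_cmult[OF contC])
  also have "(\<integral>\<^sup>+z\<in>unit_disc. ennreal (?e * ?C (\<alpha> + 3) z) \<partial>lborel) = ennreal ?e * (\<integral>\<^sup>+z\<in>unit_disc. ennreal (?C (\<alpha> + 3) z) \<partial>lborel)"
    unfolding ennreal_mult'[OF ab(4)] by (rule set_nn_integral_disc_cmult[OF contC])
  finally have *: "bergman_integral (\<alpha> + 2) (deriv (deriv (\<lambda>z. \<psi> z * f (\<phi> z))))
    \<le> ennreal ?a * bergman_integral \<alpha> (\<lambda>z. f (\<phi> z)) + ennreal ?b * bergman_integral (\<alpha> + 1) (\<lambda>z. deriv f (\<phi> z))
    + ennreal ?c * (\<integral>\<^sup>+z\<in>unit_disc. ennreal (?C (\<alpha> + 2) z) \<partial>lborel)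
    + ennreal ?e * (\<integral>\<^sup>+z\<in>unit_disc. ennreal (?C (\<alpha> + 3) z) \<partial>lborel)" .
  have **: "(\<integral>\<^sup>+z\<in>unit_disc. ennreal (?C \<beta> z) \<partial>lborel) \<le> bergman_integral \<beta> (deriv (deriv f))" for \<beta>
    unfolding bergman_integral_def by (rule nn_integral_univalent_comp_le[OF \<phi> contu])
  show ?thesis
    by (rule order_trans[OF *]) (intro add_mono mult_left_mono order_refl **, auto)
qed

text \<open>
  The second derivative is estimated by the previous lemma; the values of the function and of
  its derivative at 0 are bounded by point evaluations, hence in the weaker norm. The constant
  \<open>C\<close> does not depend on \<open>\<epsilon>\<close>, so that \<open>C \<cdot> \<epsilon>\<close> can be made small; only \<open>K'\<close> depends on it.
\<close>

lemma coeff_energy_weighted_comp_estimate: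
  fixes \<alpha> M :: real
  assumes \<alpha>: "\<alpha> > -1" and \<phi>: "holomorphic_self_map \<phi>" "inj_on \<phi> unit_disc"
    and \<psi>: "\<psi> holomorphic_on unit_disc"
    and \<phi>1: "\<And>z. z \<in> unit_disc \<Longrightarrow> norm (deriv \<phi> z) \<le> M"
    and \<phi>2: "\<And>z. z \<in> unit_disc \<Longrightarrow> norm (deriv (deriv \<phi>) z) \<le> M"
    and \<psi>0: "\<And>z. z \<in> unit_disc \<Longrightarrow> norm (\<psi> z) \<le> M"
    and \<psi>1: "\<And>z. z \<in> unit_disc \<Longrightarrow> (norm (deriv \<psi> z))\<^sup>2 * defect z \<le> M"
    and \<psi>2: "\<And>z. z \<in> unit_disc \<Longrightarrow> norm (deriv (deriv \<psi>) z) * defect z \<le> M"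
  obtains C where "C > 0"
    "\<And>\<epsilon> K. \<epsilon> \<ge> 0 \<Longrightarrow> K \<ge> 0 \<Longrightarrow>
      (\<And>z. z \<in> unit_disc \<Longrightarrow> (norm (\<psi> z))\<^sup>2 * defect z powr (\<alpha> + 2)
          \<le> (\<epsilon> + K * defect (\<phi> z)) * defect (\<phi> z) powr (\<alpha> + 2)) \<Longrightarrow>
      \<exists>K'\<ge>0. \<forall>f. f holomorphic_on unit_disc \<longrightarrow> coeff_energy (1 - \<alpha>) (\<lambda>z. \<psi> z * f (\<phi> z))
        \<le> ennreal (C * \<epsilon>) * coeff_energy (1 - \<alpha>) f + ennreal K' * coeff_energy (- \<alpha>) f"
proof -
  note hol = holomorphic_self_mapD(1)[OF \<phi>(1)] and im = holomorphic_self_mapD(2)[OF \<phi>(1)]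
  have M: "M \<ge> 0" using order_trans[OF norm_ge_zero \<phi>1[of 0]] by simp
  have w: "\<phi> 0 \<in> unit_disc" by (rule im) simp
  define k where "k = (\<lambda>s::real. 2 powr \<bar>s + 2\<bar>)"
  have k: "k s > 0" for s by (simp add: k_def)
  have dle: "s + 2 = t \<Longrightarrow> coeff_energy s (deriv g) \<le> ennreal (k s) * coeff_energy t g" for s t g
    unfolding k_def using coeff_energy_deriv_le by metis
  have led: "s + 2 = t \<Longrightarrow> coeff_energy t g \<le> ennreal ((norm (g 0))\<^sup>2) + ennreal (k s) * coeff_energy s (deriv g)" for s t g
    unfolding k_def using coeff_energy_le_deriv by metis
  obtain P where P: "P > 0" "\<And>g. g holomorphic_on unit_disc \<Longrightarrow> ennreal ((norm (g (\<phi> 0)))\<^sup>2) \<le> ennreal P * coeff_energy (- \<alpha>) g"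
    using point_evaluation_coeff_energy[OF w] by metis
  obtain P' where P': "P' > 0" "\<And>g. g holomorphic_on unit_disc \<Longrightarrow> ennreal ((norm (g (\<phi> 0)))\<^sup>2) \<le> ennreal P' * coeff_energy (- \<alpha> - 2) g"
    using point_evaluation_coeff_energy[OF w] by metis
  have "\<alpha> + 2 > -1" "\<alpha> + 3 > -1" using \<alpha> by auto
  note equiv = this[THEN bergman_integral_equiv_coeff_energy]
  obtain L V where L: "L > 0" "\<And>g. g holomorphic_on unit_disc \<Longrightarrow> coeff_energy (- (\<alpha> + 2) - 1) g \<le> ennreal L * bergman_integral (\<alpha> + 2) g"
    and V: "V > 0" "\<And>g. g holomorphic_on unit_disc \<Longrightarrow> bergman_integral (\<alpha> + 2) g \<le> ennreal V * coeff_energy (- (\<alpha> + 2) - 1) g"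
    using equiv(1) by metis
  obtain V' where V': "V' > 0" "\<And>g. g holomorphic_on unit_disc \<Longrightarrow> bergman_integral (\<alpha> + 3) g \<le> ennreal V' * coeff_energy (- (\<alpha> + 3) - 1) g"
    using equiv(2) by metis
  obtain C1 where C1: "C1 \<ge> 0" "\<And>g. g holomorphic_on unit_disc \<Longrightarrow> bergman_integral \<alpha> (\<lambda>z. g (\<phi> z)) \<le> ennreal C1 * coeff_energy (- \<alpha> - 1) g"
    using bergman_integral_univalent_comp_le[OF \<alpha> \<phi>] by metis
  have "\<alpha> + 1 > -1" using \<alpha> by simp
  then obtain C2 where C2: "C2 \<ge> 0" "\<And>g. g holomorphic_on unit_disc \<Longrightarrow> bergman_integral (\<alpha> + 1) (\<lambda>z. g (\<phi> z)) \<le> ennreal C2 * coeff_energy (- (\<alpha> + 1) - 1) g"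
    using bergman_integral_univalent_comp_le[OF _ \<phi>] by metis
  let ?s = "- \<alpha> - 1" and ?t = "- \<alpha> - 3"
  define C where "C = k ?s * (k ?t * (L * (3 * M\<^sup>2 * (V * (k ?t * k ?s))))) + 1"
  have C: "C > 0" unfolding C_def using L V k[of ?s] k[of ?t]
    by (intro add_nonneg_pos mult_nonneg_nonneg) auto
  show ?thesis
  proof (rule that[OF C])
    fix \<epsilon> K :: real assume \<epsilon>: "\<epsilon> \<ge> 0" and K: "K \<ge> 0"
      and small: "\<And>z. z \<in> unit_disc \<Longrightarrow> (norm (\<psi> z))\<^sup>2 * defect z powr (\<alpha> + 2)
          \<le> (\<epsilon> + K * defect (\<phi> z)) * defect (\<phi> z) powr (\<alpha> + 2)"
    let ?a = "3 * M\<^sup>2" and ?b = "3 * (8 * M ^ 3 + 2 * M ^ 4)" and ?c = "3 * M\<^sup>2 * \<epsilon>" and ?e = "3 * M\<^sup>2 * K"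
    have ab: "?a \<ge> 0" "?b \<ge> 0" "?c \<ge> 0" "?e \<ge> 0" using M \<epsilon> K by auto
    define D0 where "D0 = (norm (\<psi> 0))\<^sup>2 * P"
    define D1 where "D1 = 2 * (norm (deriv \<psi> 0))\<^sup>2 * P + 2 * (norm (\<psi> 0 * deriv \<phi> 0))\<^sup>2 * (P' * k (- \<alpha> - 2))"
    define D2 where "D2 = ?a * C1 + ?b * (C2 * k (- \<alpha> - 2)) + ?e * (V' * (k (- \<alpha> - 4) * k (- \<alpha> - 2)))"
    define c2 where "c2 = ?c * (V * (k ?t * k ?s))"
    have k0: "k s \<ge> 0" for s using k[of s] by simp
    have D: "D0 \<ge> 0" "D1 \<ge> 0" "D2 \<ge> 0" "c2 \<ge> 0"
      unfolding D0_def D1_def D2_def c2_def using P P' C1 C2 V V' ab k0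
      by (auto intro!: add_nonneg_nonneg mult_nonneg_nonneg simp: less_imp_le)
    show "\<exists>K'\<ge>0. \<forall>f. f holomorphic_on unit_disc \<longrightarrow> coeff_energy (1 - \<alpha>) (\<lambda>z. \<psi> z * f (\<phi> z))
        \<le> ennreal (C * \<epsilon>) * coeff_energy (1 - \<alpha>) f + ennreal K' * coeff_energy (- \<alpha>) f"
    proof (intro exI[of _ "D0 + k ?s * (D1 + k ?t * (L * D2))"] conjI allI impI)
      show "0 \<le> D0 + k ?s * (D1 + k ?t * (L * D2))"
        using D L k0 by (auto intro!: add_nonneg_nonneg mult_nonneg_nonneg simp: less_imp_le)
      fix f assume f: "f holomorphic_on unit_disc"
      have d: "deriv f holomorphic_on unit_disc" "deriv (deriv f) holomorphic_on unit_disc"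
        using f by (auto intro!: holomorphic_deriv)
      let ?h = "\<lambda>z. \<psi> z * f (\<phi> z)"
      let ?W1 = "coeff_energy (1 - \<alpha>) f" and ?W0 = "coeff_energy (- \<alpha>) f"
      have st: "?t + 2 = ?s" "?s + 2 = 1 - \<alpha>" by auto
      have h: "?h holomorphic_on unit_disc"
        by (intro holomorphic_intros \<psi> holomorphic_on_comp_self_map[OF \<phi>(1) f])
      have d1: "coeff_energy (- \<alpha> - 2) (deriv f) \<le> ennreal (k (- \<alpha> - 2)) * ?W0"
        by (rule dle) simp
      have e0: "ennreal ((norm (?h 0))\<^sup>2) \<le> ennreal D0 * ?W0"
      proof -
        have "ennreal ((norm (?h 0))\<^sup>2) = ennreal ((norm (\<psi> 0))\<^sup>2) * ennreal ((norm (f (\<phi> 0)))\<^sup>2)"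
          by (simp add: norm_mult power_mult_distrib ennreal_mult)
        also have "\<dots> \<le> ennreal ((norm (\<psi> 0))\<^sup>2) * (ennreal P * ?W0)"
          by (intro mult_left_mono P(2) f) auto
        finally show ?thesis using P by (simp add: D0_def ennreal_mult mult.assoc)
      qed
      have e1: "ennreal ((norm (deriv ?h 0))\<^sup>2) \<le> ennreal D1 * ?W0"
      proof -
        have "(norm (deriv ?h 0))\<^sup>2 \<le> 2 * ((norm (deriv \<psi> 0 * f (\<phi> 0)))\<^sup>2 + (norm (\<psi> 0 * deriv \<phi> 0 * deriv f (\<phi> 0)))\<^sup>2)"
          by (subst deriv_weighted_comp[OF \<phi>(1) \<psi> f]) (simp, rule norm_add2_square_le)
        also have "\<dots> = (2 * (norm (deriv \<psi> 0))\<^sup>2) * (norm (f (\<phi> 0)))\<^sup>2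
            + (2 * (norm (\<psi> 0 * deriv \<phi> 0))\<^sup>2) * (norm (deriv f (\<phi> 0)))\<^sup>2"
          by (simp add: norm_mult power_mult_distrib algebra_simps)
        finally have "ennreal ((norm (deriv ?h 0))\<^sup>2) \<le> ennreal (2 * (norm (deriv \<psi> 0))\<^sup>2) * ennreal ((norm (f (\<phi> 0)))\<^sup>2)
            + ennreal (2 * (norm (\<psi> 0 * deriv \<phi> 0))\<^sup>2) * ennreal ((norm (deriv f (\<phi> 0)))\<^sup>2)"
          by (simp add: ennreal_leI flip: ennreal_mult ennreal_plus)
        also have "\<dots> \<le> ennreal (2 * (norm (deriv \<psi> 0))\<^sup>2) * (ennreal P * ?W0)
            + ennreal (2 * (norm (\<psi> 0 * deriv \<phi> 0))\<^sup>2) * (ennreal (P' * k (- \<alpha> - 2)) * ?W0)"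
          using P' k0
          by (intro add_mono mult_left_mono P(2) f ennreal_mult_trans[OF P'(2)[OF d(1)] d1]) auto
        also have "\<dots> = ennreal D1 * ?W0"
          using P P' k0 by (simp add: D1_def ennreal_mult ennreal_plus distrib_right mult.assoc)
        finally show ?thesis .
      qed
      have e2: "bergman_integral (\<alpha> + 2) (deriv (deriv ?h)) \<le> ennreal c2 * ?W1 + ennreal D2 * ?W0"
      proof -
        have A: "bergman_integral \<alpha> (\<lambda>z. f (\<phi> z)) \<le> ennreal C1 * ?W0"
          by (rule order_trans[OF C1(2)[OF f]]) (intro mult_left_mono coeff_energy_mono, auto)
        have B: "bergman_integral (\<alpha> + 1) (\<lambda>z. deriv f (\<phi> z)) \<le> ennreal (C2 * k (- \<alpha> - 2)) * ?W0"
          by (rule ennreal_mult_trans[OF _ d1]) (use C2 d k0 in \<open>auto simp: algebra_simps\<close>)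
        have d2: "coeff_energy ?t (deriv (deriv f)) \<le> ennreal (k ?t * k ?s) * ?W1"
          by (rule ennreal_mult_trans[OF dle dle]) (use k0 in auto)
        have E: "bergman_integral (\<alpha> + 2) (deriv (deriv f)) \<le> ennreal (V * (k ?t * k ?s)) * ?W1"
          by (rule ennreal_mult_trans[OF _ d2]) (use V d k0 in \<open>auto simp: algebra_simps\<close>)
        have d3: "coeff_energy (- \<alpha> - 4) (deriv (deriv f)) \<le> ennreal (k (- \<alpha> - 4) * k (- \<alpha> - 2)) * ?W0"
          by (rule ennreal_mult_trans[OF dle d1]) (use k0 in auto)
        have F: "bergman_integral (\<alpha> + 3) (deriv (deriv f)) \<le> ennreal (V' * (k (- \<alpha> - 4) * k (- \<alpha> - 2))) * ?W0"
          by (rule ennreal_mult_trans[OF _ d3]) (use V' d k0 in \<open>auto simp: algebra_simps\<close>)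
        have "bergman_integral (\<alpha> + 2) (deriv (deriv ?h)) \<le> ennreal ?a * bergman_integral \<alpha> (\<lambda>z. f (\<phi> z))
          + ennreal ?b * bergman_integral (\<alpha> + 1) (\<lambda>z. deriv f (\<phi> z))
          + ennreal ?c * bergman_integral (\<alpha> + 2) (deriv (deriv f))
          + ennreal ?e * bergman_integral (\<alpha> + 3) (deriv (deriv f))"
          by (rule bergman_integral_deriv2_weighted_comp_le[OF \<phi> \<psi> f \<phi>1 \<phi>2 \<psi>0 \<psi>1 \<psi>2 small \<epsilon> K])
        also have "\<dots> \<le> ennreal ?a * (ennreal C1 * ?W0)
          + ennreal ?b * (ennreal (C2 * k (- \<alpha> - 2)) * ?W0)
          + ennreal ?c * (ennreal (V * (k ?t * k ?s)) * ?W1)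
          + ennreal ?e * (ennreal (V' * (k (- \<alpha> - 4) * k (- \<alpha> - 2))) * ?W0)"
          by (intro add_mono mult_left_mono A B E F) auto
        also have "\<dots> = ennreal (?a * C1) * ?W0 + ennreal (?b * (C2 * k (- \<alpha> - 2))) * ?W0
            + ennreal c2 * ?W1 + ennreal (?e * (V' * (k (- \<alpha> - 4) * k (- \<alpha> - 2)))) * ?W0"
        proof -
          have "ennreal a * (ennreal b * x) = ennreal (a * b) * x" if "a \<ge> 0" for a b x
            using that by (simp add: ennreal_mult' mult.assoc)
          note this[OF ab(1)] this[OF ab(2)] this[OF ab(3)] this[OF ab(4)]
          then show ?thesis unfolding c2_def by (simp only:)
        qed
        also have "\<dots> = ennreal c2 * ?W1 + ennreal D2 * ?W0"
        proof -
          have "ennreal D2 = ennreal (?a * C1) + ennreal (?b * (C2 * k (- \<alpha> - 2))) + ennreal (?e * (V' * (k (- \<alpha> - 4) * k (- \<alpha> - 2))))"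
            unfolding D2_def using ab C1 C2 V' k0
            by (subst ennreal_plus; (auto intro!: add_nonneg_nonneg mult_nonneg_nonneg simp: less_imp_le)?)+
          then show ?thesis by (simp only: distrib_right add_ac)
        qed
        finally show ?thesis .
      qed
      have "coeff_energy ?t (deriv (deriv ?h)) \<le> ennreal L * (ennreal c2 * ?W1 + ennreal D2 * ?W0)"
        using L(2)[of "deriv (deriv ?h)"] h
        by (intro order_trans[OF _ mult_left_mono[OF e2]]) (auto intro!: holomorphic_deriv simp: algebra_simps)
      then have "ennreal (k ?t) * coeff_energy ?t (deriv (deriv ?h)) \<le> ennreal (k ?t) * (ennreal L * (ennreal c2 * ?W1 + ennreal D2 * ?W0))"
        by (rule mult_left_mono) simp
      then have "coeff_energy ?s (deriv ?h) \<le> ennreal D1 * ?W0 + ennreal (k ?t) * (ennreal L * (ennreal c2 * ?W1 + ennreal D2 * ?W0))"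
        by (rule order_trans[OF led[OF st(1), of "deriv ?h"] add_mono[OF e1]])
      then have "ennreal (k ?s) * coeff_energy ?s (deriv ?h) \<le> ennreal (k ?s) * (ennreal D1 * ?W0 + ennreal (k ?t) * (ennreal L * (ennreal c2 * ?W1 + ennreal D2 * ?W0)))"
        by (rule mult_left_mono) simp
      then have "coeff_energy (1 - \<alpha>) ?h \<le> ennreal D0 * ?W0 + ennreal (k ?s) * (ennreal D1 * ?W0 + ennreal (k ?t) * (ennreal L * (ennreal c2 * ?W1 + ennreal D2 * ?W0)))"
        by (rule order_trans[OF led[OF st(2), of ?h] add_mono[OF e0]])
      also have "\<dots> = ennreal (k ?s * (k ?t * (L * c2))) * ?W1 + ennreal (D0 + k ?s * (D1 + k ?t * (L * D2))) * ?W0"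
        using D L k0 by (simp add: ennreal_mult ennreal_plus distrib_left distrib_right mult.assoc add_ac)
      also have "\<dots> \<le> ennreal (C * \<epsilon>) * ?W1 + ennreal (D0 + k ?s * (D1 + k ?t * (L * D2))) * ?W0"
      proof -
        have "k ?s * (k ?t * (L * c2)) \<le> C * \<epsilon>"
          using \<epsilon> by (simp add: C_def c2_def algebra_simps)
        then show ?thesis by (rule add_right_mono[OF mult_right_mono[OF ennreal_leI]]) simp
      qed
      finally show "coeff_energy (1 - \<alpha>) ?h \<le> ennreal (C * \<epsilon>) * ?W1 + ennreal (D0 + k ?s * (D1 + k ?t * (L * D2))) * ?W0" .
    qed
  qed
qed

section \<open>Growth estimates and Moebius transformations\<close>

text \<open>
  Integration of the derivative along the radius through \<open>z\<close>.
\<close>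

lemma norm_le_radial_primitive:
  assumes g: "g holomorphic_on unit_disc" and z: "z \<in> unit_disc"
    and bd: "\<And>z. z \<in> unit_disc \<Longrightarrow> norm (deriv g z) \<le> b (norm z)"
    and B: "\<And>t. 0 \<le> t \<Longrightarrow> t < 1 \<Longrightarrow> (B has_real_derivative b t) (at t)"
  shows "norm (g z) \<le> norm (g 0) + B (norm z) - B 0"
proof (cases "z = 0")
  case False
  define u where "u = sgn z"
  have u: "norm u = 1" "z = of_real (norm z) * u"
    using False by (simp_all add: u_def sgn_eq norm_divide)
  have nz: "0 < norm z" "norm z < 1" using False z by auto
  have inD: "of_real t * u \<in> unit_disc" "norm (of_real t * u) = t" if "0 \<le> t" "t \<le> norm z" for t
    using that nz u(1) by (auto simp: norm_mult)
  have dg: "((\<lambda>t. g (of_real t * u)) has_vector_derivative deriv g (of_real t * u) * u) (at t)" if "0 \<le> t" "t \<le> norm z" for t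
  proof -
    have "(g has_field_derivative deriv g (of_real t * u)) (at (of_real t * u))"
      using inD[OF that] g by (intro holomorphic_derivI[of _ unit_disc]) auto
    then have "((\<lambda>x. g (x * u)) has_field_derivative deriv g (of_real t * u) * u) (at (of_real t))"
      by (rule DERIV_chain2) (auto intro!: derivative_eq_intros)
    then show ?thesis by (rule has_vector_derivative_real_field)
  qed
  have "norm (g (of_real (norm z) * u) - g (of_real 0 * u)) \<le> B (norm z) - B 0"
  proof (rule differentiable_bound_general[OF nz(1)])
    show "continuous_on {0..norm z} (\<lambda>t. g (of_real t * u))"
      by (rule continuous_at_imp_continuous_on)
         (use dg has_vector_derivative_continuous in force)
    show "continuous_on {0..norm z} B"
      by (rule continuous_at_imp_continuous_on)
         (use nz in \<open>auto intro!: DERIV_isCont[OF B]\<close>)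
    show "((\<lambda>t. g (of_real t * u)) has_vector_derivative deriv g (of_real t * u) * u) (at t)" if "0 < t" "t < norm z" for t
      using dg that by simp
    show "(B has_vector_derivative b t) (at t)" if "0 < t" "t < norm z" for t
      using B[of t] that nz by (simp add: has_real_derivative_iff_has_vector_derivative)
    show "norm (deriv g (of_real t * u) * u) \<le> b t" if "0 < t" "t < norm z" for t
      using bd[OF inD(1)] inD(2) that u(1) by (simp add: norm_mult)
  qed
  then show ?thesis using u(2) norm_triangle_ineq2[of "g z" "g 0"] by simp
qed simp

lemma tendsto_0_boundaryD:
  fixes f :: "complex \<Rightarrow> real"
  assumes "(f \<longlongrightarrow> 0) (norm going_to at_left 1)" "e > 0"
  obtains r where "0 < r" "r < 1" "\<And>z. r < norm z \<Longrightarrow> norm z < 1 \<Longrightarrow> \<bar>f z\<bar> < e"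
proof -
  have "eventually (\<lambda>z. \<bar>f z\<bar> < e) (norm going_to at_left 1)"
    using tendstoD[OF assms] by simp
  then obtain Q where Q: "eventually Q (at_left (1::real))" "\<And>z. Q (norm z) \<Longrightarrow> \<bar>f z\<bar> < e"
    unfolding going_to_def by (auto simp: eventually_filtercomap)
  then obtain b where b: "b < 1" "\<And>y. b < y \<Longrightarrow> y < 1 \<Longrightarrow> Q y"
    unfolding eventually_at_left_field by auto
  show ?thesis
    by (rule that[of "max b (1/2)"]) (use b Q in auto)
qed

lemma bounded_on_cball_if_continuous:
  fixes f :: "complex \<Rightarrow> 'a::real_normed_vector"
  assumes "continuous_on (cball 0 r) f"
  obtains B where "\<And>z. z \<in> cball 0 r \<Longrightarrow> norm (f z) \<le> B"
proof -
  have "bounded (f ` cball 0 r)"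
    by (intro compact_imp_bounded compact_continuous_image assms) auto
  then show ?thesis using that unfolding bounded_iff by blast
qed

lemma bounded_if_tendsto_0_boundary:
  fixes f :: "complex \<Rightarrow> real"
  assumes cont: "continuous_on unit_disc f" and lim: "(f \<longlongrightarrow> 0) (norm going_to at_left 1)"
  obtains M where "M > 0" "\<And>z. z \<in> unit_disc \<Longrightarrow> \<bar>f z\<bar> \<le> M"
proof -
  obtain r where r: "0 < r" "r < 1" "\<And>z. r < norm z \<Longrightarrow> norm z < 1 \<Longrightarrow> \<bar>f z\<bar> < 1"
    using tendsto_0_boundaryD[OF lim, of 1] by auto
  have "continuous_on (cball 0 r) f"
    by (rule continuous_on_subset[OF cont]) (use r in auto)
  then obtain B where B: "\<And>z. z \<in> cball 0 r \<Longrightarrow> \<bar>f z\<bar> \<le> B"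
    using bounded_on_cball_if_continuous[of r f] by auto
  show ?thesis
  proof (rule that[of "max B 1"])
    fix z assume z: "z \<in> unit_disc"
    show "\<bar>f z\<bar> \<le> max B 1"
    proof (cases "norm z \<le> r")
      case True
      then show ?thesis using B[of z] by simp
    next
      case False
      then show ?thesis using r(3)[of z] z by simp
    qed
  qed auto
qed

text \<open>
  Integrating the bound \<open>M / (1 - \<bar>z\<bar>)\<close> for \<open>\<psi>''\<close> would give a logarithm. The weaker bound with
  exponent \<open>-3/2\<close> avoids it: two integrations give the exponents \<open>-1/2\<close> and \<open>1/2\<close>, which
  suffice.
\<close>

lemma multiplier_bounds:
  assumes \<psi>: "\<psi> holomorphic_on unit_disc"
    and M: "\<And>z. z \<in> unit_disc \<Longrightarrow> norm (deriv (deriv \<psi>) z) * defect z \<le> M"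
  obtains M' where "\<And>z. z \<in> unit_disc \<Longrightarrow> (norm (deriv \<psi> z))\<^sup>2 * defect z \<le> M'"
    "\<And>z. z \<in> unit_disc \<Longrightarrow> norm (\<psi> z) \<le> M'"
proof -
  have M0: "M \<ge> 0" using order_trans[OF _ M[of 0]] by (simp add: defect_def)
  have d\<psi>: "deriv \<psi> holomorphic_on unit_disc" by (rule holomorphic_deriv[OF \<psi>]) simp
  define N where "N = norm (deriv \<psi> 0) + 2 * M"
  have N0: "N \<ge> 0" using M0 by (simp add: N_def)
  have b2: "norm (deriv (deriv \<psi>) z) \<le> M * (1 - norm z) powr (-3/2)" if z: "z \<in> unit_disc" for z
  proof -
    have p: "0 < 1 - norm z" "1 - norm z \<le> 1" using z by auto
    have "norm (deriv (deriv \<psi>) z) * (1 - norm z) \<le> norm (deriv (deriv \<psi>) z) * defect z"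
      using p by (intro mult_left_mono) (auto simp: defect_def power2_eq_square mult_left_le)
    also have "\<dots> \<le> M" by (rule M[OF z])
    finally have "norm (deriv (deriv \<psi>) z) \<le> M * (1 - norm z) powr (-1)"
      using p by (simp add: powr_minus field_simps)
    also have "\<dots> \<le> M * (1 - norm z) powr (-3/2)"
      using p M0 by (intro mult_left_mono powr_mono') auto
    finally show ?thesis .
  qed
  have *: "norm (deriv \<psi> z) \<le> norm (deriv \<psi> 0) + 2 * M * (1 - norm z) powr (-1/2) - 2 * M * (1 - 0) powr (-1/2)"
    if z: "z \<in> unit_disc" for z
    by (rule norm_le_radial_primitive[OF d\<psi> z b2])
       (auto intro!: derivative_eq_intros simp: field_simps)
  have b1: "norm (deriv \<psi> z) \<le> N * (1 - norm z) powr (-1/2)" if z: "z \<in> unit_disc" for z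
  proof -
    from *[OF z] have "norm (deriv \<psi> z) \<le> norm (deriv \<psi> 0) * 1 + 2 * M * (1 - norm z) powr (-1/2)"
      using M0 by simp
    also have "\<dots> \<le> norm (deriv \<psi> 0) * (1 - norm z) powr (-1/2) + 2 * M * (1 - norm z) powr (-1/2)"
      using z powr_mono'[of "-1/2" 0 "1 - norm z"] by (intro add_right_mono mult_left_mono) auto
    also have "\<dots> = N * (1 - norm z) powr (-1/2)" by (simp add: N_def algebra_simps)
    finally show ?thesis .
  qed
  have b0: "norm (\<psi> z) \<le> norm (\<psi> 0) + (- 2 * N * (1 - norm z) powr (1/2)) - (- 2 * N * (1 - 0) powr (1/2))"
    if z: "z \<in> unit_disc" for z
    by (rule norm_le_radial_primitive[OF \<psi> z b1])
       (auto intro!: derivative_eq_intros simp: field_simps)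
  show ?thesis
  proof (rule that[of "max (2 * N\<^sup>2) (norm (\<psi> 0) + 2 * N)"])
    fix z assume z: "z \<in> unit_disc"
    then have p: "0 < 1 - norm z" by simp
    have dz: "defect z = (1 - norm z) * (1 + norm z)"
      by (simp add: defect_def power2_eq_square algebra_simps)
    have "(norm (deriv \<psi> z))\<^sup>2 * defect z \<le> (N * (1 - norm z) powr (-1/2))\<^sup>2 * defect z"
      using b1[OF z] defect_pos[OF z] by (intro mult_right_mono power_mono) auto
    also have "(N * (1 - norm z) powr (-1/2))\<^sup>2 = N\<^sup>2 * (1 - norm z) powr (-1)"
      by (simp add: power_mult_distrib) (simp add: power2_eq_square flip: powr_add)
    also have "\<dots> = N\<^sup>2 / (1 - norm z)" using p by (simp add: powr_minus field_simps)
    also have "N\<^sup>2 / (1 - norm z) * defect z = N\<^sup>2 * (1 + norm z)"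
      unfolding dz using p by simp
    also have "\<dots> \<le> N\<^sup>2 * 2" using z by (intro mult_left_mono) auto
    finally show "(norm (deriv \<psi> z))\<^sup>2 * defect z \<le> max (2 * N\<^sup>2) (norm (\<psi> 0) + 2 * N)" by simp
    have "0 \<le> 2 * N * (1 - norm z) powr (1/2)" using N0 by simp
    then have "norm (\<psi> z) \<le> norm (\<psi> 0) + 2 * N" using b0[OF z] by simp
    then show "norm (\<psi> z) \<le> max (2 * N\<^sup>2) (norm (\<psi> 0) + 2 * N)" by simp
  qed
qed

lemma deriv_bounded_if_deriv2_bounded:
  assumes \<phi>: "\<phi> holomorphic_on unit_disc" and b: "deriv (deriv \<phi>) \<in> bounded_holomorphic"
  obtains M where "\<And>z. z \<in> unit_disc \<Longrightarrow> norm (deriv \<phi> z) \<le> M" "\<And>z. z \<in> unit_disc \<Longrightarrow> norm (deriv (deriv \<phi>) z) \<le> M"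
proof -
  have "bounded (deriv (deriv \<phi>) ` unit_disc)"
    using b by (simp add: bounded_holomorphic_def)
  then obtain B where "\<forall>x \<in> deriv (deriv \<phi>) ` unit_disc. norm x \<le> B"
    unfolding bounded_iff by blast
  then have B: "\<And>z. z \<in> unit_disc \<Longrightarrow> norm (deriv (deriv \<phi>) z) \<le> B"
    by blast
  have B0: "B \<ge> 0" using order_trans[OF norm_ge_zero B[of 0]] by simp
  have d\<phi>: "deriv \<phi> holomorphic_on unit_disc" by (rule holomorphic_deriv[OF \<phi>]) simp
  have *: "norm (deriv \<phi> z) \<le> norm (deriv \<phi> 0) + B * norm z - B * 0" if z: "z \<in> unit_disc" for z
    by (rule norm_le_radial_primitive[OF d\<phi> z, of "\<lambda>_. B"]) (use B in \<open>auto intro!: derivative_eq_intros\<close>)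
  have "norm (deriv \<phi> z) \<le> norm (deriv \<phi> 0) + B" if z: "z \<in> unit_disc" for z
    using *[OF z] mult_left_le[of "norm z" B] B0 z by simp
  moreover have "norm (deriv (deriv \<phi>) z) \<le> norm (deriv \<phi> 0) + B" if "z \<in> unit_disc" for z
    using B[OF that] norm_ge_zero[of "deriv \<phi> 0"] by linarith
  ultimately show ?thesis by (rule that)
qed

text \<open>
  The square of the boundary condition gives \<open>\<epsilon>\<close> near the circle; on the remaining compact disc
  \<open>defect (\<phi> z)\<close> is bounded below, so the left-hand side is at most a multiple of
  \<open>defect (\<phi> z) powr (\<alpha> + 3)\<close>.
\<close>

lemma boundary_smallness:
  assumes \<alpha>: "\<alpha> > (-1::real)" and \<phi>: "holomorphic_self_map \<phi>" and \<psi>: "\<psi> holomorphic_on unit_disc"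
    and lim: "((\<lambda>z. norm (\<psi> z) * (defect z / defect (\<phi> z)) powr (\<alpha> / 2 + 1)) \<longlongrightarrow> 0) (norm going_to at_left 1)"
    and \<epsilon>: "\<epsilon> > 0"
  obtains K where "K \<ge> 0" "\<And>z. z \<in> unit_disc \<Longrightarrow>
    (norm (\<psi> z))\<^sup>2 * defect z powr (\<alpha> + 2) \<le> (\<epsilon> + K * defect (\<phi> z)) * defect (\<phi> z) powr (\<alpha> + 2)"
proof -
  note hol = holomorphic_self_mapD(1)[OF \<phi>] and im = holomorphic_self_mapD(2)[OF \<phi>]
  let ?f = "\<lambda>z. norm (\<psi> z) * (defect z / defect (\<phi> z)) powr (\<alpha> / 2 + 1)"
  obtain r where r: "0 < r" "r < 1" "\<And>z. r < norm z \<Longrightarrow> norm z < 1 \<Longrightarrow> \<bar>?f z\<bar> < sqrt \<epsilon>"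
    using tendsto_0_boundaryD[OF lim, of "sqrt \<epsilon>"] \<epsilon> by auto
  have pos: "defect z > 0" "defect (\<phi> z) > 0" if "z \<in> unit_disc" for z
    using that im by (auto simp: defect_pos)
  let ?q = "\<lambda>z. (norm (\<psi> z))\<^sup>2 * defect z powr (\<alpha> + 2) / (defect (\<phi> z) * defect (\<phi> z) powr (\<alpha> + 2))"
  have sub: "cball 0 r \<subseteq> unit_disc" using r by auto
  have contq: "continuous_on unit_disc ?q"
    by (intro continuous_intros holomorphic_on_imp_continuous_on[OF hol] holomorphic_on_imp_continuous_on[OF \<psi>]
        continuous_on_compose2[OF continuous_on_defect_powr] continuous_on_compose2[OF continuous_on_defect[of unit_disc]])
       (use im pos in \<open>auto simp: less_imp_neq[symmetric]\<close>)
  obtain B where B: "\<And>z. z \<in> cball 0 r \<Longrightarrow> norm (?q z) \<le> B"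
    using bounded_on_cball_if_continuous[OF continuous_on_subset[OF contq sub]] by blast
  show ?thesis
  proof (rule that[of "max B 0"])
    fix z assume z: "z \<in> unit_disc"
    show "(norm (\<psi> z))\<^sup>2 * defect z powr (\<alpha> + 2) \<le> (\<epsilon> + max B 0 * defect (\<phi> z)) * defect (\<phi> z) powr (\<alpha> + 2)"
    proof (cases "norm z \<le> r")
      case True
      then have "norm (?q z) \<le> B" by (intro B) simp
      then have "?q z \<le> max B 0" unfolding real_norm_def by linarith
      then have "(norm (\<psi> z))\<^sup>2 * defect z powr (\<alpha> + 2) \<le> max B 0 * (defect (\<phi> z) * defect (\<phi> z) powr (\<alpha> + 2))"
        using pos[OF z] by (simp add: pos_divide_le_eq)
      also have "\<dots> \<le> (\<epsilon> + max B 0 * defect (\<phi> z)) * defect (\<phi> z) powr (\<alpha> + 2)"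
        using \<epsilon> by (simp add: distrib_right mult.assoc)
      finally show ?thesis .
    next
      case False
      then have "\<bar>?f z\<bar> < sqrt \<epsilon>" using r(3) z by simp
      then have "\<bar>?f z\<bar>\<^sup>2 \<le> (sqrt \<epsilon>)\<^sup>2" by (intro power_mono) auto
      then have "(?f z)\<^sup>2 \<le> \<epsilon>" using \<epsilon> by simp
      moreover have "((defect z / defect (\<phi> z)) powr (\<alpha> / 2 + 1))\<^sup>2 = (defect z / defect (\<phi> z)) powr (\<alpha> + 2)"
        by (simp add: power2_eq_square flip: powr_add)
      ultimately have "(norm (\<psi> z))\<^sup>2 * (defect z / defect (\<phi> z)) powr (\<alpha> + 2) \<le> \<epsilon>"
        by (simp add: power_mult_distrib)
      then have "(norm (\<psi> z))\<^sup>2 * defect z powr (\<alpha> + 2) \<le> \<epsilon> * defect (\<phi> z) powr (\<alpha> + 2)"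
        using pos[OF z] by (simp add: powr_divide pos_divide_le_eq)
      also have "\<dots> \<le> (\<epsilon> + max B 0 * defect (\<phi> z)) * defect (\<phi> z) powr (\<alpha> + 2)"
        using pos[OF z] by (intro mult_right_mono) auto
      finally show ?thesis .
    qed
  qed auto
qed

lemma coeff_energy_weighted_comp_small:
  assumes \<alpha>: "\<alpha> > (-1::real)" and \<phi>: "holomorphic_self_map \<phi>" "inj_on \<phi> unit_disc"
    and \<phi>2: "deriv (deriv \<phi>) \<in> bounded_holomorphic" and \<psi>: "\<psi> holomorphic_on unit_disc"
    and lim1: "((\<lambda>z. norm (deriv (deriv \<psi>) z) * defect z) \<longlongrightarrow> 0) (norm going_to at_left 1)"
    and lim2: "((\<lambda>z. norm (\<psi> z) * (defect z / defect (\<phi> z)) powr (\<alpha> / 2 + 1)) \<longlongrightarrow> 0) (norm going_to at_left 1)"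
    and \<epsilon>: "\<epsilon> > 0"
  obtains K where "K \<ge> 0" "\<And>f. f holomorphic_on unit_disc \<Longrightarrow>
     coeff_energy (1 - \<alpha>) (\<lambda>z. \<psi> z * f (\<phi> z))
        \<le> ennreal \<epsilon> * coeff_energy (1 - \<alpha>) f + ennreal K * coeff_energy (- \<alpha>) f"
proof -
  note hol = holomorphic_self_mapD(1)[OF \<phi>(1)]
  obtain M1 where M1: "\<And>z. z \<in> unit_disc \<Longrightarrow> norm (deriv \<phi> z) \<le> M1" "\<And>z. z \<in> unit_disc \<Longrightarrow> norm (deriv (deriv \<phi>) z) \<le> M1"
    using deriv_bounded_if_deriv2_bounded[OF hol \<phi>2] by metis
  have "continuous_on unit_disc (\<lambda>z. norm (deriv (deriv \<psi>) z) * defect z)"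
    by (intro continuous_intros holomorphic_on_imp_continuous_on holomorphic_deriv \<psi>) auto
  then obtain M2 where M2: "\<And>z. z \<in> unit_disc \<Longrightarrow> \<bar>norm (deriv (deriv \<psi>) z) * defect z\<bar> \<le> M2"
    using bounded_if_tendsto_0_boundary[OF _ lim1] by metis
  have M2': "norm (deriv (deriv \<psi>) z) * defect z \<le> M2" if "z \<in> unit_disc" for z
    using M2[OF that] by linarith
  obtain M3 where M3: "\<And>z. z \<in> unit_disc \<Longrightarrow> (norm (deriv \<psi> z))\<^sup>2 * defect z \<le> M3" "\<And>z. z \<in> unit_disc \<Longrightarrow> norm (\<psi> z) \<le> M3"
    using multiplier_bounds[OF \<psi> M2'] by metis
  define M where "M = max M1 (max M2 M3)"
  obtain C where C: "C > 0" "\<And>\<epsilon> K. \<epsilon> \<ge> 0 \<Longrightarrow> K \<ge> 0 \<Longrightarrow>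
      (\<And>z. z \<in> unit_disc \<Longrightarrow> (norm (\<psi> z))\<^sup>2 * defect z powr (\<alpha> + 2)
          \<le> (\<epsilon> + K * defect (\<phi> z)) * defect (\<phi> z) powr (\<alpha> + 2)) \<Longrightarrow>
      \<exists>K'\<ge>0. \<forall>f. f holomorphic_on unit_disc \<longrightarrow> coeff_energy (1 - \<alpha>) (\<lambda>z. \<psi> z * f (\<phi> z))
        \<le> ennreal (C * \<epsilon>) * coeff_energy (1 - \<alpha>) f + ennreal K' * coeff_energy (- \<alpha>) f"
  proof (rule coeff_energy_weighted_comp_estimate[OF \<alpha> \<phi> \<psi>, of M])
    fix z assume z: "z \<in> unit_disc"
    show "norm (deriv \<phi> z) \<le> M" "norm (deriv (deriv \<phi>) z) \<le> M" "norm (\<psi> z) \<le> M"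
      "(norm (deriv \<psi> z))\<^sup>2 * defect z \<le> M" "norm (deriv (deriv \<psi>) z) * defect z \<le> M"
      using M1[OF z] M2'[OF z] M3[OF z] unfolding M_def by linarith+
  qed blast
  have \<epsilon>': "\<epsilon> / C > 0" using \<epsilon> C by simp
  obtain K where K: "K \<ge> 0" "\<And>z. z \<in> unit_disc \<Longrightarrow>
    (norm (\<psi> z))\<^sup>2 * defect z powr (\<alpha> + 2) \<le> (\<epsilon> / C + K * defect (\<phi> z)) * defect (\<phi> z) powr (\<alpha> + 2)"
    using boundary_smallness[OF \<alpha> \<phi>(1) \<psi> lim2 \<epsilon>'] by metis
  show ?thesis
    using C(2)[of "\<epsilon> / C" K] K \<epsilon>' C(1) that by auto
qed

lemma Moebius_self_map:
  assumes w: "w \<in> unit_disc"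
  shows "holomorphic_self_map (Moebius_function 0 w)" "inj_on (Moebius_function 0 w) unit_disc"
    "z \<in> unit_disc \<Longrightarrow> Moebius_function 0 (- w) (Moebius_function 0 w z) = z"
proof -
  show "holomorphic_self_map (Moebius_function 0 w)"
    using w Moebius_function_holomorphic[of w 0] Moebius_function_norm_lt_1[of w _ 0]
    by (auto simp: holomorphic_self_map_def)
  show inv: "Moebius_function 0 (- w) (Moebius_function 0 w z) = z" if "z \<in> unit_disc" for z
    using Moebius_function_compose[of "- w" w z] w that by simp
  show "inj_on (Moebius_function 0 w) unit_disc"
    by (rule inj_on_inverseI[of _ "Moebius_function 0 (- w)"]) (rule inv)
qed

text \<open>
  The transformation is holomorphic on a neighbourhood of the closed disc, since its pole lies
  outside.
\<close>

lemma Moebius_derivs_bounded: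
  assumes w: "w \<in> unit_disc"
  obtains M where "M \<ge> 1" "\<And>z. z \<in> unit_disc \<Longrightarrow> norm (deriv (Moebius_function 0 w) z) \<le> M"
    "\<And>z. z \<in> unit_disc \<Longrightarrow> norm (deriv (deriv (Moebius_function 0 w)) z) \<le> M"
proof -
  let ?S = "{z. 1 - cnj w * z \<noteq> 0}"
  have op: "open ?S" by (intro open_Collect_neq continuous_intros)
  have sub: "cball 0 1 \<subseteq> ?S"
  proof
    fix z :: complex assume "z \<in> cball 0 1"
    then have "norm (cnj w * z) < 1"
      using w mult_left_le[of "norm z" "norm w"] by (simp add: norm_mult)
    then show "z \<in> ?S" by auto
  qed
  have hol: "Moebius_function 0 w holomorphic_on ?S"
    unfolding Moebius_function_def by (intro holomorphic_intros) auto
  have d: "deriv (Moebius_function 0 w) holomorphic_on ?S" "deriv (deriv (Moebius_function 0 w)) holomorphic_on ?S"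
    using hol op by (auto intro!: holomorphic_deriv)
  have bd: "\<exists>B. \<forall>z\<in>cball 0 1. norm (g z) \<le> B" if "g holomorphic_on ?S" for g :: "complex \<Rightarrow> complex"
  proof -
    have "continuous_on (cball 0 1) g"
      by (rule continuous_on_subset[OF holomorphic_on_imp_continuous_on[OF that] sub])
    then show ?thesis using bounded_on_cball_if_continuous[of 1 g] by metis
  qed
  obtain B1 B2 where B: "\<forall>z\<in>cball 0 1. norm (deriv (Moebius_function 0 w) z) \<le> B1"
    "\<forall>z\<in>cball 0 1. norm (deriv (deriv (Moebius_function 0 w)) z) \<le> B2"
    using bd[OF d(1)] bd[OF d(2)] by blast
  show ?thesis
    by (rule that[of "max 1 (max B1 B2)"]) (use B in \<open>auto simp: le_max_iff_disj\<close>)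
qed

text \<open>
  The main estimate with multiplier 1 and \<open>\<epsilon>\<close> not small: the quotient of defects is bounded.
\<close>

lemma coeff_energy_Moebius_comp_le:
  assumes w: "w \<in> unit_disc" and s: "s < (2::real)"
  obtains C where "C \<ge> 0" "\<And>f. f holomorphic_on unit_disc \<Longrightarrow>
    coeff_energy s (\<lambda>z. f (Moebius_function 0 w z)) \<le> ennreal C * coeff_energy s f"
proof -
  define \<alpha> where "\<alpha> = 1 - s"
  have \<alpha>: "\<alpha> > -1" using s by (simp add: \<alpha>_def)
  let ?\<tau> = "Moebius_function 0 w"
  note \<tau> = Moebius_self_map(1,2)[OF w]
  obtain M where M: "M \<ge> 1" "\<And>z. z \<in> unit_disc \<Longrightarrow> norm (deriv ?\<tau> z) \<le> M"
    "\<And>z. z \<in> unit_disc \<Longrightarrow> norm (deriv (deriv ?\<tau>) z) \<le> M"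
    using Moebius_derivs_bounded[OF w] by metis
  obtain S where S: "S \<ge> 1" "\<And>z. z \<in> unit_disc \<Longrightarrow> defect z \<le> S * defect (?\<tau> z)"
    using defect_le_defect_self_map[OF \<tau>(1)] by metis
  obtain C where C: "C > 0" "\<And>\<epsilon> K. \<epsilon> \<ge> 0 \<Longrightarrow> K \<ge> 0 \<Longrightarrow>
      (\<And>z. z \<in> unit_disc \<Longrightarrow> (norm (1::complex))\<^sup>2 * defect z powr (\<alpha> + 2)
          \<le> (\<epsilon> + K * defect (?\<tau> z)) * defect (?\<tau> z) powr (\<alpha> + 2)) \<Longrightarrow>
      \<exists>K'\<ge>0. \<forall>f. f holomorphic_on unit_disc \<longrightarrow> coeff_energy (1 - \<alpha>) (\<lambda>z. 1 * f (?\<tau> z))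
        \<le> ennreal (C * \<epsilon>) * coeff_energy (1 - \<alpha>) f + ennreal K' * coeff_energy (- \<alpha>) f"
  proof (rule coeff_energy_weighted_comp_estimate[OF \<alpha> \<tau>, of "\<lambda>_. 1" M])
    fix z assume z: "z \<in> unit_disc"
    have "deriv (\<lambda>_. 1 :: complex) = (\<lambda>_. 0)" by auto
    then show "(norm (deriv (\<lambda>_. 1 :: complex) z))\<^sup>2 * defect z \<le> M" "norm (deriv (deriv (\<lambda>_. 1 :: complex)) z) * defect z \<le> M"
      using M(1) by simp_all
  qed (use M in auto)
  have "(norm (1::complex))\<^sup>2 * defect z powr (\<alpha> + 2) \<le> (S powr (\<alpha> + 2) + 0 * defect (?\<tau> z)) * defect (?\<tau> z) powr (\<alpha> + 2)"
    if z: "z \<in> unit_disc" for z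
    using S(2)[OF z] S(1) defect_pos[OF z] \<alpha> powr_mono2[of "\<alpha> + 2" "defect z" "S * defect (?\<tau> z)"]
    by (simp add: powr_mult)
  then obtain K' where K': "K' \<ge> 0" "\<And>f. f holomorphic_on unit_disc \<Longrightarrow> coeff_energy (1 - \<alpha>) (\<lambda>z. 1 * f (?\<tau> z))
        \<le> ennreal (C * S powr (\<alpha> + 2)) * coeff_energy (1 - \<alpha>) f + ennreal K' * coeff_energy (- \<alpha>) f"
    using C(2)[of "S powr (\<alpha> + 2)" 0] by auto
  show ?thesis
  proof (rule that[of "C * S powr (\<alpha> + 2) + K'"])
    fix f assume f: "f holomorphic_on unit_disc"
    have "coeff_energy (1 - \<alpha>) (\<lambda>z. f (?\<tau> z))
       \<le> ennreal (C * S powr (\<alpha> + 2)) * coeff_energy (1 - \<alpha>) f + ennreal K' * coeff_energy (- \<alpha>) f"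
      using K'(2)[OF f] by simp
    also have "\<dots> \<le> ennreal (C * S powr (\<alpha> + 2)) * coeff_energy (1 - \<alpha>) f + ennreal K' * coeff_energy (1 - \<alpha>) f"
      by (intro add_left_mono mult_left_mono coeff_energy_mono) auto
    also have "\<dots> = ennreal (C * S powr (\<alpha> + 2) + K') * coeff_energy (1 - \<alpha>) f"
      using C K' by (simp add: ennreal_plus distrib_right)
    finally show "coeff_energy s (\<lambda>z. f (?\<tau> z)) \<le> ennreal (C * S powr (\<alpha> + 2) + K') * coeff_energy s f"
      by (simp add: \<alpha>_def)
  qed (use C K' in auto)
qed

section \<open>The weighted Dirichlet space as a complete normed space\<close>

lemma taylor_coeff_lincomb:
  assumes "f holomorphic_on unit_disc" "g holomorphic_on unit_disc"
  shows "taylor_coeff (\<lambda>z. c * f z + d * g z) n = c * taylor_coeff f n + d * taylor_coeff g n"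
proof -
  have "(deriv ^^ n) (\<lambda>z. c * f z + d * g z) 0 = (deriv ^^ n) (\<lambda>z. c * f z) 0 + (deriv ^^ n) (\<lambda>z. d * g z) 0"
    by (rule higher_deriv_add[of _ unit_disc]) (use assms in \<open>auto intro!: holomorphic_intros\<close>)
  also have "\<dots> = c * (deriv ^^ n) f 0 + d * (deriv ^^ n) g 0"
    using assms by (simp add: higher_deriv_cmult[of _ unit_disc])
  finally show ?thesis by (simp add: taylor_coeff_def fps_expansion_def add_divide_distrib)
qed

lemma hol_disc_eqI:
  assumes "f \<in> hol_disc" "g \<in> hol_disc" "\<And>n. taylor_coeff f n = taylor_coeff g n"
  shows "f = g"
proof
  fix z
  show "f z = g z"
  proof (cases "z \<in> unit_disc")
    case True
    have "(\<lambda>n. taylor_coeff g n * z ^ n) sums f z" "(\<lambda>n. taylor_coeff g n * z ^ n) sums g z"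
      using taylor_coeff_sums[of f z] taylor_coeff_sums[of g z] assms True by (simp_all add: hol_disc_def)
    then show ?thesis by (rule sums_unique2)
  next
    case False
    then show ?thesis using assms by (auto simp: hol_disc_def)
  qed
qed

lemma hol_disc_lincomb:
  "f \<in> hol_disc \<Longrightarrow> g \<in> hol_disc \<Longrightarrow> (\<lambda>z. c * f z + d * g z) \<in> hol_disc"
  by (auto simp: hol_disc_def intro!: holomorphic_intros)

abbreviation dirichlet_weight :: "real \<Rightarrow> nat \<Rightarrow> real" where
  "dirichlet_weight \<alpha> n \<equiv> (real n + 1) powr (1 - \<alpha>)"

lemma dirichlet_spaceD:
  assumes "f \<in> dirichlet_space \<alpha>"
  shows "f \<in> hol_disc" "f holomorphic_on unit_disc"
    "summable (\<lambda>n. dirichlet_weight \<alpha> n * (norm (taylor_coeff f n))\<^sup>2)"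
  using assms by (auto simp: dirichlet_space_def hol_disc_def)

lemma dirichlet_norm_nonneg: "f \<in> dirichlet_space \<alpha> \<Longrightarrow> 0 \<le> dirichlet_norm \<alpha> f"
  unfolding dirichlet_norm_def by (intro real_sqrt_ge_zero suminf_nonneg dirichlet_spaceD) auto

lemma dirichlet_norm_square:
  assumes "f \<in> dirichlet_space \<alpha>"
  shows "(dirichlet_norm \<alpha> f)\<^sup>2 = (\<Sum>n. dirichlet_weight \<alpha> n * (norm (taylor_coeff f n))\<^sup>2)"
  unfolding dirichlet_norm_def
  by (rule real_sqrt_pow2) (intro suminf_nonneg dirichlet_spaceD[OF assms], auto)

lemma coeff_energy_eq_dirichlet_norm:
  assumes "f \<in> dirichlet_space \<alpha>"
  shows "coeff_energy (1 - \<alpha>) f = ennreal ((dirichlet_norm \<alpha> f)\<^sup>2)"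
  unfolding coeff_energy_def dirichlet_norm_square[OF assms]
  by (rule suminf_ennreal2) (auto intro: dirichlet_spaceD[OF assms])

lemma dirichlet_space_if_coeff_energy_finite:
  assumes "f \<in> hol_disc" "coeff_energy (1 - \<alpha>) f < top"
  shows "f \<in> dirichlet_space \<alpha>"
  using assms unfolding dirichlet_space_def coeff_energy_def
  by (auto intro!: summable_suminf_not_top)

lemma dirichlet_partial_bound:
  assumes "f \<in> dirichlet_space \<alpha>"
  shows "L2_set (\<lambda>n. sqrt (dirichlet_weight \<alpha> n) * norm (taylor_coeff f n)) {..<N} \<le> dirichlet_norm \<alpha> f"
proof -
  have "(\<Sum>n<N. (sqrt (dirichlet_weight \<alpha> n) * norm (taylor_coeff f n))\<^sup>2) = (\<Sum>n<N. dirichlet_weight \<alpha> n * (norm (taylor_coeff f n))\<^sup>2)"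
    by (simp add: power_mult_distrib)
  also have "\<dots> \<le> (\<Sum>n. dirichlet_weight \<alpha> n * (norm (taylor_coeff f n))\<^sup>2)"
    by (rule sum_le_suminf[OF dirichlet_spaceD(3)[OF assms]]) auto
  finally show ?thesis unfolding L2_set_def dirichlet_norm_def by (rule real_sqrt_le_mono)
qed

lemma dirichlet_norm_leI:
  assumes f: "f \<in> hol_disc" and B: "\<And>N. L2_set (\<lambda>n. sqrt (dirichlet_weight \<alpha> n) * norm (taylor_coeff f n)) {..<N} \<le> B"
  shows "f \<in> dirichlet_space \<alpha>" "dirichlet_norm \<alpha> f \<le> B"
proof -
  let ?a = "\<lambda>n. dirichlet_weight \<alpha> n * (norm (taylor_coeff f n))\<^sup>2"
  have B0: "0 \<le> B" using B[of 0] by (simp add: L2_set_def)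
  have le: "(\<Sum>n<N. ?a n) \<le> B\<^sup>2" for N
  proof -
    have "(\<Sum>n<N. ?a n) = (L2_set (\<lambda>n. sqrt (dirichlet_weight \<alpha> n) * norm (taylor_coeff f n)) {..<N})\<^sup>2"
      by (simp add: L2_set_def power_mult_distrib sum_nonneg)
    also have "\<dots> \<le> B\<^sup>2" by (intro power_mono B L2_set_nonneg)
    finally show ?thesis .
  qed
  have s: "summable ?a" by (rule summableI_nonneg_bounded[OF _ le]) auto
  show "f \<in> dirichlet_space \<alpha>" using f s by (simp add: dirichlet_space_def)
  have "(\<Sum>n. ?a n) \<le> B\<^sup>2" by (rule suminf_le_const[OF s le])
  then show "dirichlet_norm \<alpha> f \<le> B"
    unfolding dirichlet_norm_def using B0 by (rule real_le_lsqrt[rotated])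
qed

lemma norm_taylor_coeff_le:
  assumes "f \<in> dirichlet_space \<alpha>"
  shows "norm (taylor_coeff f n) \<le> dirichlet_norm \<alpha> f / sqrt (dirichlet_weight \<alpha> n)"
proof -
  have "sqrt (dirichlet_weight \<alpha> n) * norm (taylor_coeff f n) \<le> L2_set (\<lambda>n. sqrt (dirichlet_weight \<alpha> n) * norm (taylor_coeff f n)) {..<Suc n}"
    by (rule member_le_L2_set) auto
  also have "\<dots> \<le> dirichlet_norm \<alpha> f" by (rule dirichlet_partial_bound[OF assms])
  finally show ?thesis by (simp add: pos_le_divide_eq mult.commute)
qed

lemma dirichlet_lincomb:
  assumes f: "f \<in> dirichlet_space \<alpha>" and g: "g \<in> dirichlet_space \<alpha>"
  shows "(\<lambda>z. c * f z + d * g z) \<in> dirichlet_space \<alpha>"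
    and "dirichlet_norm \<alpha> (\<lambda>z. c * f z + d * g z) \<le> norm c * dirichlet_norm \<alpha> f + norm d * dirichlet_norm \<alpha> g"
proof -
  let ?w = "\<lambda>n. sqrt (dirichlet_weight \<alpha> n)"
  note hf = dirichlet_spaceD[OF f] and hg = dirichlet_spaceD[OF g]
  have h: "(\<lambda>z. c * f z + d * g z) \<in> hol_disc" by (rule hol_disc_lincomb[OF hf(1) hg(1)])
  have "L2_set (\<lambda>n. ?w n * norm (taylor_coeff (\<lambda>z. c * f z + d * g z) n)) {..<N}
    \<le> norm c * dirichlet_norm \<alpha> f + norm d * dirichlet_norm \<alpha> g" for N
  proof -
    have "L2_set (\<lambda>n. ?w n * norm (taylor_coeff (\<lambda>z. c * f z + d * g z) n)) {..<N}
      \<le> L2_set (\<lambda>n. norm c * (?w n * norm (taylor_coeff f n)) + norm d * (?w n * norm (taylor_coeff g n))) {..<N}"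
    proof (rule L2_set_mono)
      fix n
      have "norm (taylor_coeff (\<lambda>z. c * f z + d * g z) n) \<le> norm c * norm (taylor_coeff f n) + norm d * norm (taylor_coeff g n)"
        unfolding taylor_coeff_lincomb[OF hf(2) hg(2)]
        using norm_triangle_ineq[of "c * taylor_coeff f n" "d * taylor_coeff g n"] by (simp add: norm_mult)
      then have "?w n * norm (taylor_coeff (\<lambda>z. c * f z + d * g z) n) \<le> ?w n * (norm c * norm (taylor_coeff f n) + norm d * norm (taylor_coeff g n))"
        by (rule mult_left_mono) simp
      then show "?w n * norm (taylor_coeff (\<lambda>z. c * f z + d * g z) n)
        \<le> norm c * (?w n * norm (taylor_coeff f n)) + norm d * (?w n * norm (taylor_coeff g n))"
        by (simp add: algebra_simps)
    qed auto
    also have "\<dots> \<le> L2_set (\<lambda>n. norm c * (?w n * norm (taylor_coeff f n))) {..<N} + L2_set (\<lambda>n. norm d * (?w n * norm (taylor_coeff g n))) {..<N}"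
      by (rule L2_set_triangle_ineq)
    also have "\<dots> = norm c * L2_set (\<lambda>n. ?w n * norm (taylor_coeff f n)) {..<N} + norm d * L2_set (\<lambda>n. ?w n * norm (taylor_coeff g n)) {..<N}"
      by (simp add: L2_set_right_distrib)
    also have "\<dots> \<le> norm c * dirichlet_norm \<alpha> f + norm d * dirichlet_norm \<alpha> g"
      by (intro add_mono mult_left_mono dirichlet_partial_bound f g) auto
    finally show ?thesis .
  qed
  from dirichlet_norm_leI[OF h this]
  show "(\<lambda>z. c * f z + d * g z) \<in> dirichlet_space \<alpha>"
    "dirichlet_norm \<alpha> (\<lambda>z. c * f z + d * g z) \<le> norm c * dirichlet_norm \<alpha> f + norm d * dirichlet_norm \<alpha> g"
    by auto
qed

lemma dirichlet_norm_eq_0: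
  assumes f: "f \<in> dirichlet_space \<alpha>" and "dirichlet_norm \<alpha> f = 0"
  shows "f = (\<lambda>_. 0)"
proof (rule hol_disc_eqI[OF dirichlet_spaceD(1)[OF f]])
  show "(\<lambda>_. 0) \<in> hol_disc" by (simp add: hol_disc_def)
  fix n
  have "taylor_coeff (\<lambda>_. 0) n = 0"
    using taylor_coeff_lincomb[of "\<lambda>_. 0" "\<lambda>_. 0" 0 0 n] by simp
  then show "taylor_coeff f n = taylor_coeff (\<lambda>_. 0) n"
    using norm_taylor_coeff_le[OF f, of n] assms(2) by simp
qed

lemma dirichlet_zero: "(\<lambda>_. 0) \<in> dirichlet_space \<alpha>" "dirichlet_norm \<alpha> (\<lambda>_. 0) = 0"
proof -
  have "taylor_coeff (\<lambda>_. 0) n = 0" for n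
    using taylor_coeff_lincomb[of "\<lambda>_. 0" "\<lambda>_. 0" 0 0 n] by simp
  then show "(\<lambda>_. 0) \<in> dirichlet_space \<alpha>" "dirichlet_norm \<alpha> (\<lambda>_. 0) = 0"
    by (simp_all add: dirichlet_space_def hol_disc_def dirichlet_norm_def)
qed

lemma hol_disc_with_taylor_coeffs:
  assumes "\<And>n. norm (a n) \<le> B * (real n + 1) powr p"
  obtains f where "f \<in> hol_disc" "\<And>n. taylor_coeff f n = a n"
proof -
  define F where "F = Abs_fps a"
  define f where "f = (\<lambda>z. if z \<in> unit_disc then eval_fps F z else 0)"
  have R: "fps_conv_radius F \<ge> 1"
    unfolding fps_conv_radius_def
  proof (rule conv_radius_geI_ex')
    fix r :: real assume r: "0 < r" "ereal r < 1"
    then have "summable (\<lambda>n. B * ((real n + 1) powr p * r ^ n))"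
      by (intro summable_mult summable_powr_times_geometric) auto
    moreover have "norm (fps_nth F n * of_real r ^ n) \<le> B * ((real n + 1) powr p * r ^ n)" for n
      using assms[of n] r mult_right_mono[OF assms[of n], of "r ^ n"]
      by (simp add: F_def norm_mult norm_power mult.assoc)
    ultimately show "summable (\<lambda>n. fps_nth F n * of_real r ^ n)"
      by (rule summable_comparison_test'[where N = 0])
  qed
  have "unit_disc \<subseteq> eball 0 (fps_conv_radius F)"
    using R by (auto simp: less_le_trans[of _ 1])
  then have hol: "eval_fps F holomorphic_on unit_disc" by (rule holomorphic_on_eval_fps)
  have "f holomorphic_on unit_disc"
    by (rule holomorphic_transform[OF hol]) (simp add: f_def)
  then have "f \<in> hol_disc" by (simp add: hol_disc_def f_def)
  moreover have "taylor_coeff f n = a n" for n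
  proof -
    have "taylor_coeff f = taylor_coeff (eval_fps F)"
      by (rule taylor_coeff_cong) (simp add: f_def)
    moreover have "fps_expansion (eval_fps F) 0 = F"
      by (rule fps_expansion_eqI, rule eval_fps_has_fps_expansion) (use R in \<open>auto intro: less_le_trans[of _ 1]\<close>)
    ultimately show ?thesis by (simp add: taylor_coeff_def F_def)
  qed
  ultimately show ?thesis by (rule that)
qed

text \<open>
  The limit is built from the coefficientwise limits; bounds on finitely many coefficients pass
  to the limit, which gives both membership and the stated rate. The rate \<open>e\<close> is kept in the
  statement because the norm of the solution of \<open>\<lambda> f - T f = g\<close> is read off from it.
\<close>

lemma dirichlet_complete:
  assumes F: "\<And>k. F k \<in> dirichlet_space \<alpha>"
    and cau: "\<And>k m. k \<le> m \<Longrightarrow> dirichlet_norm \<alpha> (\<lambda>z. F m z - F k z) \<le> e k"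
    and e: "e \<longlonglongrightarrow> 0"
  obtains f where "f \<in> dirichlet_space \<alpha>" "\<And>k. dirichlet_norm \<alpha> (\<lambda>z. f z - F k z) \<le> e k"
proof -
  let ?w = "\<lambda>n. sqrt (dirichlet_weight \<alpha> n)"
  note hF = dirichlet_spaceD[OF F]
  have D: "(\<lambda>z. F m z - F k z) \<in> dirichlet_space \<alpha>" for m k
    using dirichlet_lincomb(1)[OF F[of m] F[of k], of 1 "-1"] by simp
  have tc: "taylor_coeff (\<lambda>z. F m z - F k z) n = taylor_coeff (F m) n - taylor_coeff (F k) n" for m k n
    using taylor_coeff_lincomb[OF hF(2)[of m] hF(2)[of k], of 1 "-1" n] by simp
  have bd: "norm (taylor_coeff (F m) n - taylor_coeff (F k) n) \<le> e k / ?w n" if "k \<le> m" for k m n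
    using order_trans[OF norm_taylor_coeff_le[OF D, of m k n] divide_right_mono[OF cau[OF that]]]
    unfolding tc by simp
  have "Cauchy (\<lambda>k. taylor_coeff (F k) n)" for n
  proof (rule CauchyI')
    fix \<delta> :: real assume "\<delta> > 0"
    moreover have "(\<lambda>k. e k / ?w n) \<longlonglongrightarrow> 0"
      using tendsto_divide[OF e tendsto_const[of "?w n"]] by simp
    ultimately obtain K where K: "\<And>k. k \<ge> K \<Longrightarrow> norm (e k / ?w n) < \<delta>"
      using LIMSEQ_D[of "\<lambda>k. e k / ?w n" 0 \<delta>] by auto
    show "\<exists>M. \<forall>m\<ge>M. \<forall>k>m. dist (taylor_coeff (F m) n) (taylor_coeff (F k) n) < \<delta>"
    proof (intro exI[of _ K] allI impI)
      fix m k assume "K \<le> m" "m < k"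
      then have "norm (taylor_coeff (F k) n - taylor_coeff (F m) n) < \<delta>"
        using bd[of m k n] K[of m] unfolding real_norm_def by linarith
      then show "dist (taylor_coeff (F m) n) (taylor_coeff (F k) n) < \<delta>"
        by (simp add: dist_norm norm_minus_commute)
    qed
  qed
  then have "\<forall>n. \<exists>l. (\<lambda>k. taylor_coeff (F k) n) \<longlonglongrightarrow> l"
    using Cauchy_convergent unfolding convergent_def by blast
  from choice[OF this] obtain a where a: "\<And>n. (\<lambda>k. taylor_coeff (F k) n) \<longlonglongrightarrow> a n"
    by blast
  have lim: "L2_set (\<lambda>n. ?w n * norm (a n - taylor_coeff (F k) n)) {..<N} \<le> e k" for k N
  proof (rule LIMSEQ_le_const2)
    show "(\<lambda>m. L2_set (\<lambda>n. ?w n * norm (taylor_coeff (F m) n - taylor_coeff (F k) n)) {..<N})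
        \<longlonglongrightarrow> L2_set (\<lambda>n. ?w n * norm (a n - taylor_coeff (F k) n)) {..<N}"
      unfolding L2_set_def by (intro tendsto_intros a)
    show "\<exists>M. \<forall>m\<ge>M. L2_set (\<lambda>n. ?w n * norm (taylor_coeff (F m) n - taylor_coeff (F k) n)) {..<N} \<le> e k"
    proof (intro exI[of _ k] allI impI)
      fix m assume "k \<le> m"
      show "L2_set (\<lambda>n. ?w n * norm (taylor_coeff (F m) n - taylor_coeff (F k) n)) {..<N} \<le> e k"
        using order_trans[OF dirichlet_partial_bound[OF D, of m k N] cau[OF \<open>k \<le> m\<close>]] unfolding tc .
    qed
  qed
  have "norm (a n - taylor_coeff (F 0) n) \<le> e 0 * (real n + 1) powr (- ((1 - \<alpha>) / 2))" for n
  proof -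
    have "?w n * norm (a n - taylor_coeff (F 0) n) \<le> L2_set (\<lambda>n. ?w n * norm (a n - taylor_coeff (F 0) n)) {..<Suc n}"
      by (rule member_le_L2_set) auto
    also have "\<dots> \<le> e 0" by (rule lim)
    finally have "norm (a n - taylor_coeff (F 0) n) \<le> e 0 / ?w n" by (simp add: pos_le_divide_eq mult.commute)
    also have "?w n = (real n + 1) powr ((1 - \<alpha>) / 2)" by (simp add: powr_half_sqrt_powr)
    finally show ?thesis unfolding powr_minus_divide by simp
  qed
  then obtain h where h: "h \<in> hol_disc" "\<And>n. taylor_coeff h n = a n - taylor_coeff (F 0) n"
    by (rule hol_disc_with_taylor_coeffs) (rule that)
  define f where "f = (\<lambda>z. 1 * h z + 1 * F 0 z)"
  have hh: "h holomorphic_on unit_disc" using h by (simp add: hol_disc_def)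
  have f: "f \<in> hol_disc" unfolding f_def by (rule hol_disc_lincomb[OF h(1) hF(1)])
  have fh: "f holomorphic_on unit_disc" using f by (simp add: hol_disc_def)
  have tf: "taylor_coeff f n = a n" for n
    unfolding f_def taylor_coeff_lincomb[OF hh hF(2)] by (simp add: h)
  have "h \<in> dirichlet_space \<alpha>"
    by (rule dirichlet_norm_leI(1)[OF h(1), of _ "e 0"]) (simp only: h lim)
  then have fD: "f \<in> dirichlet_space \<alpha>" unfolding f_def by (rule dirichlet_lincomb(1)[OF _ F])
  show ?thesis
  proof (rule that[OF fD])
    fix k
    have 1: "(\<lambda>z. 1 * f z + (-1) * F k z) \<in> hol_disc" by (rule hol_disc_lincomb[OF f hF(1)])
    have "dirichlet_norm \<alpha> (\<lambda>z. 1 * f z + (-1) * F k z) \<le> e k"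
    proof (rule dirichlet_norm_leI(2)[OF 1])
      fix N show "L2_set (\<lambda>n. ?w n * norm (taylor_coeff (\<lambda>z. 1 * f z + (-1) * F k z) n)) {..<N} \<le> e k"
        using lim[where k = k and N = N] unfolding taylor_coeff_lincomb[OF fh hF(2)] tf by simp
    qed
    then show "dirichlet_norm \<alpha> (\<lambda>z. f z - F k z) \<le> e k" by simp
  qed
qed

section \<open>Spectrum of a triangular operator\<close>

definition vanishing_subspace :: "real \<Rightarrow> nat \<Rightarrow> (complex \<Rightarrow> complex) set" where
  "vanishing_subspace \<alpha> n = {f \<in> dirichlet_space \<alpha>. \<forall>k<n. taylor_coeff f k = 0}"

lemma vanishing_subspace_0: "vanishing_subspace \<alpha> 0 = dirichlet_space \<alpha>"
  by (simp add: vanishing_subspace_def)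

lemma vanishing_subspaceD: "f \<in> vanishing_subspace \<alpha> n \<Longrightarrow> f \<in> dirichlet_space \<alpha>"
  by (simp add: vanishing_subspace_def)

lemma vanishing_subspace_Suc:
  "f \<in> vanishing_subspace \<alpha> (Suc n) \<longleftrightarrow> f \<in> vanishing_subspace \<alpha> n \<and> taylor_coeff f n = 0"
  by (auto simp: vanishing_subspace_def less_Suc_eq)

lemma dirichlet_taylor_coeff_lincomb:
  assumes "f \<in> dirichlet_space \<alpha>" "g \<in> dirichlet_space \<alpha>"
  shows "taylor_coeff (\<lambda>z. c * f z + d * g z) n = c * taylor_coeff f n + d * taylor_coeff g n"
  by (rule taylor_coeff_lincomb) (use assms dirichlet_spaceD in auto)

lemma vanishing_subspace_lincomb:
  assumes "f \<in> vanishing_subspace \<alpha> n" "g \<in> vanishing_subspace \<alpha> n"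
  shows "(\<lambda>z. c * f z + d * g z) \<in> vanishing_subspace \<alpha> n"
  using assms by (auto simp: vanishing_subspace_def dirichlet_taylor_coeff_lincomb intro!: dirichlet_lincomb)

lemma vanishing_subspace_monomial:
  obtains e where "e \<in> vanishing_subspace \<alpha> n" "taylor_coeff e n = 1"
proof -
  obtain e where e: "e \<in> hol_disc" "\<And>k. taylor_coeff e k = (if k = n then 1 else 0)"
    by (rule hol_disc_with_taylor_coeffs[of "\<lambda>k. if k = n then 1 else 0" 1 0]) (auto intro: that)
  have "summable (\<lambda>k. dirichlet_weight \<alpha> k * (norm (taylor_coeff e k))\<^sup>2)"
    by (rule summable_finite[of "{n}"]) (auto simp: e)
  then have "e \<in> vanishing_subspace \<alpha> n"
    using e by (simp add: vanishing_subspace_def dirichlet_space_def)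
  then show ?thesis using that e by simp
qed

lemma bounded_operatorD:
  assumes "bounded_operator \<alpha> T"
  shows "f \<in> dirichlet_space \<alpha> \<Longrightarrow> T f \<in> dirichlet_space \<alpha>"
    and "f \<in> dirichlet_space \<alpha> \<Longrightarrow> g \<in> dirichlet_space \<alpha> \<Longrightarrow> T (\<lambda>z. c * f z + d * g z) = (\<lambda>z. c * T f z + d * T g z)"
proof -
  show "T f \<in> dirichlet_space \<alpha>" if "f \<in> dirichlet_space \<alpha>"
    using assms that by (simp add: bounded_operator_def)
  assume f: "f \<in> dirichlet_space \<alpha>" and g: "g \<in> dirichlet_space \<alpha>"
  have "(\<lambda>z. c * f z) \<in> dirichlet_space \<alpha>" "(\<lambda>z. d * g z) \<in> dirichlet_space \<alpha>"
    using dirichlet_lincomb(1)[OF f f, of c 0] dirichlet_lincomb(1)[OF g g, of d 0] by simp_all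
  then show "T (\<lambda>z. c * f z + d * g z) = (\<lambda>z. c * T f z + d * T g z)"
    using assms f g unfolding bounded_operator_def by simp
qed

lemma bounded_operator_bound:
  assumes "bounded_operator \<alpha> T"
  shows "\<exists>K>0. \<forall>f \<in> dirichlet_space \<alpha>. dirichlet_norm \<alpha> (T f) \<le> K * dirichlet_norm \<alpha> f"
proof -
  obtain K where K: "\<forall>f \<in> dirichlet_space \<alpha>. dirichlet_norm \<alpha> (T f) \<le> K * dirichlet_norm \<alpha> f"
    using assms unfolding bounded_operator_def by blast
  show ?thesis
  proof (intro exI[of _ "\<bar>K\<bar> + 1"] conjI ballI)
    fix f assume f: "f \<in> dirichlet_space \<alpha>"
    have "dirichlet_norm \<alpha> (T f) \<le> K * dirichlet_norm \<alpha> f" using K f by blast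
    also have "\<dots> \<le> (\<bar>K\<bar> + 1) * dirichlet_norm \<alpha> f"
      using dirichlet_norm_nonneg[OF f] by (intro mult_right_mono) auto
    finally show "dirichlet_norm \<alpha> (T f) \<le> (\<bar>K\<bar> + 1) * dirichlet_norm \<alpha> f" .
  qed simp
qed

lemma bounded_operatorI:
  assumes "\<And>f. f \<in> dirichlet_space \<alpha> \<Longrightarrow> T f \<in> dirichlet_space \<alpha>"
    and "\<And>f g c d. f \<in> dirichlet_space \<alpha> \<Longrightarrow> g \<in> dirichlet_space \<alpha> \<Longrightarrow> T (\<lambda>z. c * f z + d * g z) = (\<lambda>z. c * T f z + d * T g z)"
    and "\<And>f. f \<in> dirichlet_space \<alpha> \<Longrightarrow> dirichlet_norm \<alpha> (T f) \<le> K * dirichlet_norm \<alpha> f"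
  shows "bounded_operator \<alpha> T"
  unfolding bounded_operator_def
proof (intro conjI ballI allI)
  fix f g assume "f \<in> dirichlet_space \<alpha>" "g \<in> dirichlet_space \<alpha>"
  then show "T (\<lambda>z. f z + g z) = (\<lambda>z. T f z + T g z)" using assms(2)[of f g 1 1] by simp
next
  fix c f assume "f \<in> dirichlet_space \<alpha>"
  then show "T (\<lambda>z. c * f z) = (\<lambda>z. c * T f z)" using assms(2)[of f f c 0] by simp
qed (use assms(1) assms(3) in blast)+

lemma bounded_operator_comp:
  assumes S: "bounded_operator \<alpha> S" and T: "bounded_operator \<alpha> T"
  shows "bounded_operator \<alpha> (\<lambda>f. S (T f))"
proof -
  obtain K where K: "K > 0" "\<And>f. f \<in> dirichlet_space \<alpha> \<Longrightarrow> dirichlet_norm \<alpha> (S f) \<le> K * dirichlet_norm \<alpha> f"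
    using bounded_operator_bound[OF S] by blast
  obtain L where L: "L > 0" "\<And>f. f \<in> dirichlet_space \<alpha> \<Longrightarrow> dirichlet_norm \<alpha> (T f) \<le> L * dirichlet_norm \<alpha> f"
    using bounded_operator_bound[OF T] by blast
  show ?thesis
  proof (rule bounded_operatorI[where K = "K * L"])
    fix f assume f: "f \<in> dirichlet_space \<alpha>"
    show "S (T f) \<in> dirichlet_space \<alpha>" by (rule bounded_operatorD(1)[OF S bounded_operatorD(1)[OF T f]])
    have "dirichlet_norm \<alpha> (S (T f)) \<le> K * dirichlet_norm \<alpha> (T f)"
      by (rule K(2)[OF bounded_operatorD(1)[OF T f]])
    also have "\<dots> \<le> K * (L * dirichlet_norm \<alpha> f)"
      using f K by (intro mult_left_mono L) auto
    finally show "dirichlet_norm \<alpha> (S (T f)) \<le> K * L * dirichlet_norm \<alpha> f" by (simp add: mult.assoc)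
  next
    fix f g c d assume "f \<in> dirichlet_space \<alpha>" "g \<in> dirichlet_space \<alpha>"
    then show "S (T (\<lambda>z. c * f z + d * g z)) = (\<lambda>z. c * S (T f) z + d * S (T g) z)"
      by (simp add: bounded_operatorD(2)[OF T] bounded_operatorD(2)[OF S] bounded_operatorD(1)[OF T])
  qed
qed

lemma not_in_operator_spectrum_iff:
  "l \<notin> operator_spectrum \<alpha> T \<longleftrightarrow> (\<exists>S. bounded_operator \<alpha> S \<and>
     (\<forall>f \<in> dirichlet_space \<alpha>. S (\<lambda>z. l * f z - T f z) = f) \<and>
     (\<forall>f \<in> dirichlet_space \<alpha>. (\<lambda>z. l * S f z - T (S f) z) = f))"
  unfolding operator_spectrum_def by (simp only: mem_Collect_eq not_not)

text \<open>
  If \<open>S\<close> inverts \<open>l - T'\<close>, then \<open>V S U\<close> inverts \<open>l - T\<close>.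
\<close>

lemma operator_spectrum_conjugate_subset:
  assumes T: "bounded_operator \<alpha> T" and U: "bounded_operator \<alpha> U" and V: "bounded_operator \<alpha> V"
    and UV: "\<And>f. f \<in> dirichlet_space \<alpha> \<Longrightarrow> U (V f) = f" and VU: "\<And>f. f \<in> dirichlet_space \<alpha> \<Longrightarrow> V (U f) = f"
    and T': "\<And>f. f \<in> dirichlet_space \<alpha> \<Longrightarrow> T' f = U (T (V f))"
  shows "operator_spectrum \<alpha> T \<subseteq> operator_spectrum \<alpha> T'"
proof (rule ccontr)
  assume "\<not> ?thesis"
  then obtain l where l: "l \<in> operator_spectrum \<alpha> T" "l \<notin> operator_spectrum \<alpha> T'" by blast
  from l(2) obtain S where S': "bounded_operator \<alpha> S"
    "\<forall>f \<in> dirichlet_space \<alpha>. S (\<lambda>z. l * f z - T' f z) = f"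
    "\<forall>f \<in> dirichlet_space \<alpha>. (\<lambda>z. l * S f z - T' (S f) z) = f"
    unfolding not_in_operator_spectrum_iff by blast
  note S = S'(1) bspec[OF S'(2)] bspec[OF S'(3)]
  note D = bounded_operatorD(1)[OF T] bounded_operatorD(1)[OF U] bounded_operatorD(1)[OF V] bounded_operatorD(1)[OF S(1)]
  have lin: "R (\<lambda>z. l * f z - g z) = (\<lambda>z. l * R f z - R g z)"
    if "bounded_operator \<alpha> R" "f \<in> dirichlet_space \<alpha>" "g \<in> dirichlet_space \<alpha>" for R f g
    using bounded_operatorD(2)[OF that, of l "-1"] by simp
  have "l \<notin> operator_spectrum \<alpha> T"
    unfolding not_in_operator_spectrum_iff
  proof (intro exI[of _ "\<lambda>f. V (S (U f))"] conjI ballI)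
    show "bounded_operator \<alpha> (\<lambda>f. V (S (U f)))"
      by (rule bounded_operator_comp[OF V bounded_operator_comp[OF S(1) U]])
    fix f assume f: "f \<in> dirichlet_space \<alpha>"
    have "U (\<lambda>z. l * f z - T f z) = (\<lambda>z. l * U f z - T' (U f) z)"
      unfolding lin[OF U f D(1)[OF f]] T'[OF D(2)[OF f]] VU[OF f] ..
    then show "V (S (U (\<lambda>z. l * f z - T f z))) = f"
      by (simp only: S(2)[OF D(2)[OF f]] VU[OF f])
    let ?g = "S (U f)"
    have g: "?g \<in> dirichlet_space \<alpha>" by (rule D(4)[OF D(2)[OF f]])
    have Tg: "T (V ?g) \<in> dirichlet_space \<alpha>" by (rule D(1)[OF D(3)[OF g]])
    have VT: "V (T' ?g) = T (V ?g)" unfolding T'[OF g] by (rule VU[OF Tg])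
    have T'g: "T' ?g \<in> dirichlet_space \<alpha>" unfolding T'[OF g] by (rule D(2)[OF Tg])
    have "(\<lambda>z. l * V ?g z - T (V ?g) z) = V (\<lambda>z. l * ?g z - T' ?g z)"
      unfolding lin[OF V g T'g] VT ..
    also have "\<dots> = f" by (simp only: S(3)[OF D(2)[OF f]] VU[OF f])
    finally show "(\<lambda>z. l * V ?g z - T (V ?g) z) = f" .
  qed
  then show False using l(1) by contradiction
qed

lemma operator_spectrum_conjugate:
  assumes T: "bounded_operator \<alpha> T" and T'b: "bounded_operator \<alpha> T'" and U: "bounded_operator \<alpha> U" and V: "bounded_operator \<alpha> V"
    and UV: "\<And>f. f \<in> dirichlet_space \<alpha> \<Longrightarrow> U (V f) = f" and VU: "\<And>f. f \<in> dirichlet_space \<alpha> \<Longrightarrow> V (U f) = f"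
    and T': "\<And>f. f \<in> dirichlet_space \<alpha> \<Longrightarrow> T' f = U (T (V f))"
  shows "operator_spectrum \<alpha> T = operator_spectrum \<alpha> T'"
proof
  show "operator_spectrum \<alpha> T \<subseteq> operator_spectrum \<alpha> T'"
    by (rule operator_spectrum_conjugate_subset[of \<alpha> T U V T']) (fact T U V UV VU T')+
  show "operator_spectrum \<alpha> T' \<subseteq> operator_spectrum \<alpha> T"
  proof (rule operator_spectrum_conjugate_subset[of \<alpha> T' V U T])
    fix f assume f: "f \<in> dirichlet_space \<alpha>"
    show "T f = V (T' (U f))"
      unfolding T'[OF bounded_operatorD(1)[OF U f]] VU[OF f] VU[OF bounded_operatorD(1)[OF T f]] ..
    show "V (U f) = f" "U (V f) = f" by (rule VU[OF f], rule UV[OF f])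
  qed (fact T'b U V)+
qed

text \<open>
  The last assumption says that \<open>T\<close> is the norm limit of the finite-rank operators that apply
  \<open>T\<close> to a Taylor polynomial of the argument; so \<open>T\<close> is compact.
\<close>

locale small_triangular_operator =
  fixes \<alpha> :: real and T :: "(complex \<Rightarrow> complex) \<Rightarrow> (complex \<Rightarrow> complex)" and \<mu> :: "nat \<Rightarrow> complex"
  assumes T: "bounded_operator \<alpha> T"
    and triangular: "f \<in> vanishing_subspace \<alpha> n \<Longrightarrow> T f \<in> vanishing_subspace \<alpha> n \<and> taylor_coeff (T f) n = \<mu> n * taylor_coeff f n"
    and small: "\<delta> > 0 \<Longrightarrow> \<exists>n. \<forall>f \<in> vanishing_subspace \<alpha> n. dirichlet_norm \<alpha> (T f) \<le> \<delta> * dirichlet_norm \<alpha> f"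
begin

definition resolves :: "complex \<Rightarrow> nat \<Rightarrow> bool" where
  "resolves l n \<longleftrightarrow> (\<exists>C\<ge>0. \<forall>g \<in> vanishing_subspace \<alpha> n. \<exists>f \<in> vanishing_subspace \<alpha> n.
      (\<lambda>z. l * f z - T f z) = g \<and> dirichlet_norm \<alpha> f \<le> C * dirichlet_norm \<alpha> g) \<and>
    (\<forall>f \<in> vanishing_subspace \<alpha> n. (\<lambda>z. l * f z - T f z) = (\<lambda>_. 0) \<longrightarrow> f = (\<lambda>_. 0))"

lemma TD: "f \<in> dirichlet_space \<alpha> \<Longrightarrow> T f \<in> dirichlet_space \<alpha>"
  by (rule bounded_operatorD(1)[OF T])

lemma shifted_in_vanishing_subspace:
  assumes "f \<in> vanishing_subspace \<alpha> n"
  shows "(\<lambda>z. l * f z - T f z) \<in> vanishing_subspace \<alpha> n"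
    "taylor_coeff (\<lambda>z. l * f z - T f z) n = (l - \<mu> n) * taylor_coeff f n"
proof -
  have Tf: "T f \<in> vanishing_subspace \<alpha> n" "taylor_coeff (T f) n = \<mu> n * taylor_coeff f n"
    using triangular[OF assms] by auto
  show "(\<lambda>z. l * f z - T f z) \<in> vanishing_subspace \<alpha> n"
    using vanishing_subspace_lincomb[OF assms Tf(1), of l "-1"] by simp
  show "taylor_coeff (\<lambda>z. l * f z - T f z) n = (l - \<mu> n) * taylor_coeff f n"
    using dirichlet_taylor_coeff_lincomb[OF vanishing_subspaceD[OF assms] vanishing_subspaceD[OF Tf(1)], of l "-1" n]
    by (simp add: Tf(2) left_diff_distrib)
qed

text \<open>
  The solution is the fixed point of the contraction \<open>f \<mapsto> (g + T f) / l\<close>, reached from 0; the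
  partial sums of the Neumann series are its iterates.
\<close>

lemma resolves_if_small:
  assumes \<delta>: "0 \<le> \<delta>" "\<delta> < norm l"
    and Tn: "\<And>f. f \<in> vanishing_subspace \<alpha> n \<Longrightarrow> dirichlet_norm \<alpha> (T f) \<le> \<delta> * dirichlet_norm \<alpha> f"
  shows "resolves l n"
  unfolding resolves_def
proof (intro conjI exI[of _ "1 / (norm l - \<delta>)"] ballI impI)
  have l0: "l \<noteq> 0" using \<delta> by auto
  let ?X = "vanishing_subspace \<alpha> n"
  note XD = vanishing_subspaceD[of _ \<alpha> n]
  show "0 \<le> 1 / (norm l - \<delta>)" using \<delta> by simp
  {
    fix f assume f: "f \<in> ?X" and eq: "(\<lambda>z. l * f z - T f z) = (\<lambda>_. 0)"
    have "f = (\<lambda>z. (1 / l) * T f z + 0 * T f z)"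
      using fun_cong[OF eq] l0 by (auto simp: field_simps)
    then have "dirichlet_norm \<alpha> f \<le> norm (1 / l) * dirichlet_norm \<alpha> (T f)"
      using dirichlet_lincomb(2)[OF TD[OF XD[OF f]] TD[OF XD[OF f]], of "1 / l" 0] by simp
    also have "\<dots> \<le> norm (1 / l) * (\<delta> * dirichlet_norm \<alpha> f)"
      by (intro mult_left_mono Tn f) auto
    finally have "norm l * dirichlet_norm \<alpha> f \<le> \<delta> * dirichlet_norm \<alpha> f"
      using l0 by (simp add: norm_divide field_simps)
    then have "(norm l - \<delta>) * dirichlet_norm \<alpha> f \<le> 0"
      by (simp add: left_diff_distrib)
    then have "dirichlet_norm \<alpha> f \<le> 0" using \<delta> by (simp add: mult_le_0_iff)
    then have "dirichlet_norm \<alpha> f = 0" using dirichlet_norm_nonneg[OF XD[OF f]] by simp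
    then show "f = (\<lambda>_. 0)" by (rule dirichlet_norm_eq_0[OF XD[OF f]])
  }
  fix g assume g: "g \<in> ?X"
  define q where "q = \<delta> / norm l"
  have q: "0 \<le> q" "q < 1" using \<delta> l0 by (auto simp: q_def)
  define A where "A = (\<lambda>f z. (1 / l) * g z + (1 / l) * T f z)"
  define F where "F = (\<lambda>k. (A ^^ k) (\<lambda>_. 0))"
  define b where "b = dirichlet_norm \<alpha> g / norm l"
  have b0: "b \<ge> 0" using dirichlet_norm_nonneg[OF XD[OF g]] by (simp add: b_def)
  have AX: "A f \<in> ?X" if "f \<in> ?X" for f
    unfolding A_def using triangular[OF that] by (intro vanishing_subspace_lincomb g) auto
  have zX: "(\<lambda>_. 0) \<in> ?X"
    using vanishing_subspace_lincomb[OF g g, of 0 0] by simp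
  have FX: "F k \<in> ?X" for k
    by (induction k) (auto simp: F_def zX AX)
  have FS: "F (Suc k) = A (F k)" for k by (simp add: F_def)
  have dX: "(\<lambda>z. f z - h z) \<in> ?X" if "f \<in> ?X" "h \<in> ?X" for f h
    using vanishing_subspace_lincomb[OF that, of 1 "-1"] by simp
  have Td: "T (\<lambda>z. f z - h z) = (\<lambda>z. T f z - T h z)" if "f \<in> dirichlet_space \<alpha>" "h \<in> dirichlet_space \<alpha>" for f h
    using bounded_operatorD(2)[OF T that, of 1 "-1"] by simp
  have con: "dirichlet_norm \<alpha> (\<lambda>z. A f z - A h z) \<le> q * dirichlet_norm \<alpha> (\<lambda>z. f z - h z)"
    if "f \<in> ?X" "h \<in> ?X" for f h
  proof -
    let ?d = "\<lambda>z. f z - h z"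
    have d: "?d \<in> ?X" by (rule dX[OF that])
    have "(\<lambda>z. A f z - A h z) = (\<lambda>z. (1 / l) * T ?d z + 0 * T ?d z)"
      by (simp add: A_def Td that XD right_diff_distrib diff_divide_distrib)
    then have "dirichlet_norm \<alpha> (\<lambda>z. A f z - A h z) \<le> norm (1 / l) * dirichlet_norm \<alpha> (T ?d)"
      using dirichlet_lincomb(2)[OF TD[OF XD[OF d]] TD[OF XD[OF d]], of "1 / l" 0] by simp
    also have "\<dots> \<le> norm (1 / l) * (\<delta> * dirichlet_norm \<alpha> ?d)"
      by (intro mult_left_mono Tn d) auto
    also have "\<dots> = q * dirichlet_norm \<alpha> ?d" by (simp add: q_def norm_divide)
    finally show ?thesis .
  qed
  have step: "dirichlet_norm \<alpha> (\<lambda>z. F (Suc k) z - F k z) \<le> q ^ k * b" for k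
  proof (induction k)
    case 0
    have T0: "T (\<lambda>_. 0) = (\<lambda>_. 0)"
      using bounded_operatorD(2)[OF T XD[OF g] XD[OF g], of 0 0] by simp
    have "(\<lambda>z. F (Suc 0) z - F 0 z) = (\<lambda>z. (1 / l) * g z + 0 * g z)"
      by (simp add: F_def A_def T0)
    then show ?case
      using dirichlet_lincomb(2)[OF XD[OF g] XD[OF g], of "1 / l" 0] by (simp add: b_def norm_divide)
  next
    case (Suc k)
    have "dirichlet_norm \<alpha> (\<lambda>z. F (Suc (Suc k)) z - F (Suc k) z) \<le> q * dirichlet_norm \<alpha> (\<lambda>z. F (Suc k) z - F k z)"
      using con[OF FX FX, of "Suc k" k] by (simp only: FS)
    also have "\<dots> \<le> q * (q ^ k * b)" by (intro mult_left_mono Suc q)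
    finally show ?case by simp
  qed
  define e where "e = (\<lambda>k. q ^ k * b / (1 - q))"
  have cau: "dirichlet_norm \<alpha> (\<lambda>z. F m z - F k z) \<le> (q ^ k - q ^ m) * b / (1 - q)" if "k \<le> m" for k m
    using that
  proof (induction m rule: dec_induct)
    case base
    then show ?case by (simp add: dirichlet_zero)
  next
    case (step m)
    have "(\<lambda>z. F (Suc m) z - F k z) = (\<lambda>z. 1 * (F (Suc m) z - F m z) + 1 * (F m z - F k z))" by simp
    then have "dirichlet_norm \<alpha> (\<lambda>z. F (Suc m) z - F k z)
      \<le> dirichlet_norm \<alpha> (\<lambda>z. F (Suc m) z - F m z) + dirichlet_norm \<alpha> (\<lambda>z. F m z - F k z)"
      using dirichlet_lincomb(2)[OF XD[OF dX[OF FX FX]] XD[OF dX[OF FX FX]], of 1 "Suc m" m 1 m k] by simp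
    also have "\<dots> \<le> q ^ m * b + (q ^ k - q ^ m) * b / (1 - q)"
      by (intro add_mono \<open>\<And>k. dirichlet_norm \<alpha> (\<lambda>z. F (Suc k) z - F k z) \<le> q ^ k * b\<close> step.IH)
    also have "\<dots> = (q ^ k - q ^ Suc m) * b / (1 - q)"
      using q by (simp add: field_simps)
    finally show ?case .
  qed
  have cau': "dirichlet_norm \<alpha> (\<lambda>z. F m z - F k z) \<le> e k" if "k \<le> m" for k m
  proof -
    have "(q ^ k - q ^ m) * b / (1 - q) \<le> e k"
      unfolding e_def using q b0 by (intro divide_right_mono mult_right_mono) auto
    then show ?thesis using cau[OF that] by linarith
  qed
  have elim: "e \<longlonglongrightarrow> 0"
    unfolding e_def using q by (auto intro!: tendsto_eq_intros LIMSEQ_power_zero)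
  obtain f where f: "f \<in> dirichlet_space \<alpha>" "\<And>k. dirichlet_norm \<alpha> (\<lambda>z. f z - F k z) \<le> e k"
    by (rule dirichlet_complete[OF XD[OF FX] cau' elim]) (assumption, rule that)
  have fX: "f \<in> ?X"
  proof -
    have "taylor_coeff f j = 0" if j: "j < n" for j
    proof -
      have le: "norm (taylor_coeff f j) \<le> e k / sqrt (dirichlet_weight \<alpha> j)" for k
      proof -
        have d: "(\<lambda>z. f z - F k z) \<in> dirichlet_space \<alpha>"
          using dirichlet_lincomb(1)[OF f(1) XD[OF FX], of 1 "-1" k] by simp
        have "taylor_coeff (\<lambda>z. f z - F k z) j = taylor_coeff f j"
          using dirichlet_taylor_coeff_lincomb[OF f(1) XD[OF FX], of 1 "-1" k j] FX[of k] j
          by (simp add: vanishing_subspace_def)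
        then have "norm (taylor_coeff f j) \<le> dirichlet_norm \<alpha> (\<lambda>z. f z - F k z) / sqrt (dirichlet_weight \<alpha> j)"
          using norm_taylor_coeff_le[OF d, of j] by simp
        also have "\<dots> \<le> e k / sqrt (dirichlet_weight \<alpha> j)" by (intro divide_right_mono f) auto
        finally show ?thesis .
      qed
      have "(\<lambda>k. e k / sqrt (dirichlet_weight \<alpha> j)) \<longlonglongrightarrow> 0 / sqrt (dirichlet_weight \<alpha> j)"
        by (intro tendsto_divide elim tendsto_const) simp
      then have "norm (taylor_coeff f j) \<le> 0 / sqrt (dirichlet_weight \<alpha> j)"
        by (rule LIMSEQ_le_const) (use le in blast)
      then show ?thesis by simp
    qed
    then show ?thesis using f by (simp add: vanishing_subspace_def)
  qed
  have fix_pt: "(\<lambda>z. f z - A f z) = (\<lambda>_. 0)"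
  proof (rule dirichlet_norm_eq_0)
    show D: "(\<lambda>z. f z - A f z) \<in> dirichlet_space \<alpha>" by (rule XD[OF dX[OF fX AX[OF fX]]])
    have "dirichlet_norm \<alpha> (\<lambda>z. f z - A f z) \<le> e (Suc k) + q * e k" for k
    proof -
      have "(\<lambda>z. f z - A f z) = (\<lambda>z. 1 * (f z - F (Suc k) z) + (-1) * (A f z - A (F k) z))"
        by (simp add: FS)
      then have "dirichlet_norm \<alpha> (\<lambda>z. f z - A f z) \<le> dirichlet_norm \<alpha> (\<lambda>z. f z - F (Suc k) z) + dirichlet_norm \<alpha> (\<lambda>z. A f z - A (F k) z)"
        using dirichlet_lincomb(2)[OF XD[OF dX[OF fX FX]] XD[OF dX[OF AX[OF fX] AX[OF FX]]], of 1 "Suc k" "-1" k] by simp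
      also have "\<dots> \<le> e (Suc k) + q * e k"
        by (intro add_mono f order_trans[OF con[OF fX FX] mult_left_mono] q)
      finally show ?thesis .
    qed
    moreover have "(\<lambda>k. e (Suc k) + q * e k) \<longlonglongrightarrow> 0 + q * 0"
      by (intro tendsto_intros elim LIMSEQ_Suc)
    ultimately have "dirichlet_norm \<alpha> (\<lambda>z. f z - A f z) \<le> 0"
      by (intro LIMSEQ_le_const) auto
    then show "dirichlet_norm \<alpha> (\<lambda>z. f z - A f z) = 0"
      using dirichlet_norm_nonneg[OF D] by simp
  qed
  have "f z = (1 / l) * g z + (1 / l) * T f z" for z
    using fun_cong[OF fix_pt, of z] by (simp add: A_def)
  then have "(\<lambda>z. l * f z - T f z) = g"
    using l0 by (auto simp: field_simps fun_eq_iff)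
  moreover have "dirichlet_norm \<alpha> f \<le> 1 / (norm l - \<delta>) * dirichlet_norm \<alpha> g"
  proof -
    have "dirichlet_norm \<alpha> f \<le> e 0" using f(2)[of 0] by (simp add: F_def)
    also have "\<dots> = 1 / (norm l - \<delta>) * dirichlet_norm \<alpha> g"
      using \<delta> l0 by (simp add: e_def b_def q_def field_simps)
    finally show ?thesis .
  qed
  ultimately show "\<exists>f\<in>?X. (\<lambda>z. l * f z - T f z) = g \<and> dirichlet_norm \<alpha> f \<le> 1 / (norm l - \<delta>) * dirichlet_norm \<alpha> g"
    using fX by blast
qed

text \<open>
  The subspace is spanned by the next one and a function \<open>e\<close> with \<open>n\<close>th coefficient 1. A
  multiple of \<open>e\<close> is chosen so that the rest of the equation lives on the smaller subspace.
\<close>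

lemma resolves_step:
  assumes R: "resolves l (Suc n)" and l: "l \<noteq> \<mu> n"
  shows "resolves l n"
proof -
  let ?X = "vanishing_subspace \<alpha> n" and ?Y = "vanishing_subspace \<alpha> (Suc n)"
  obtain C where C: "C \<ge> 0" "\<And>g. g \<in> ?Y \<Longrightarrow> \<exists>f \<in> ?Y. (\<lambda>z. l * f z - T f z) = g \<and> dirichlet_norm \<alpha> f \<le> C * dirichlet_norm \<alpha> g"
    and inj: "\<And>f. f \<in> ?Y \<Longrightarrow> (\<lambda>z. l * f z - T f z) = (\<lambda>_. 0) \<Longrightarrow> f = (\<lambda>_. 0)"
    using R unfolding resolves_def by blast
  obtain e where e: "e \<in> ?X" "taylor_coeff e n = 1" by (rule vanishing_subspace_monomial) (rule that)
  define h where "h = (\<lambda>z. l * e z - T e z)"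
  have h: "h \<in> ?X" "taylor_coeff h n = l - \<mu> n"
    using shifted_in_vanishing_subspace[OF e(1), of l] e(2) by (auto simp: h_def)
  note XD = vanishing_subspaceD[of _ \<alpha> n]
  define M where "M = 1 / (norm (l - \<mu> n) * sqrt (dirichlet_weight \<alpha> n))"
  have M0: "M \<ge> 0" by (simp add: M_def)
  define B where "B = M * dirichlet_norm \<alpha> e + C * (1 + M * dirichlet_norm \<alpha> h)"
  have B0: "B \<ge> 0" unfolding B_def using M0 C dirichlet_norm_nonneg[OF XD[OF e(1)]] dirichlet_norm_nonneg[OF XD[OF h(1)]] by auto
  show ?thesis
    unfolding resolves_def
  proof (intro conjI exI[of _ B] ballI impI B0)
    fix f assume f: "f \<in> ?X" and eq: "(\<lambda>z. l * f z - T f z) = (\<lambda>_. 0)"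
    have "taylor_coeff (\<lambda>_. 0 :: complex) n = 0"
      using taylor_coeff_lincomb[of "\<lambda>_. 0" "\<lambda>_. 0" 0 0 n] by simp
    then have "(l - \<mu> n) * taylor_coeff f n = 0"
      using shifted_in_vanishing_subspace(2)[OF f, of l] by (simp add: eq)
    then have "f \<in> ?Y" using l f by (simp add: vanishing_subspace_Suc)
    then show "f = (\<lambda>_. 0)" using eq by (rule inj)
  next
    fix g assume g: "g \<in> ?X"
    define c where "c = taylor_coeff g n / (l - \<mu> n)"
    have cle: "norm c \<le> M * dirichlet_norm \<alpha> g"
      using norm_taylor_coeff_le[OF XD[OF g], of n] l
      by (simp add: c_def M_def norm_divide field_simps)
    define r where "r = (\<lambda>z. 1 * g z + (- c) * h z)"
    have "taylor_coeff r n = 0"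
      unfolding r_def dirichlet_taylor_coeff_lincomb[OF XD[OF g] XD[OF h(1)]] using l by (simp add: h(2) c_def)
    then have r: "r \<in> ?Y"
      unfolding vanishing_subspace_Suc using vanishing_subspace_lincomb[OF g h(1), of 1 "- c"] by (simp add: r_def)
    obtain f where f: "f \<in> ?Y" "(\<lambda>z. l * f z - T f z) = r" "dirichlet_norm \<alpha> f \<le> C * dirichlet_norm \<alpha> r"
      using C(2)[OF r] by auto
    have fX: "f \<in> ?X" using f(1) by (simp add: vanishing_subspace_Suc)
    define F where "F = (\<lambda>z. c * e z + 1 * f z)"
    have FX: "F \<in> ?X" unfolding F_def by (rule vanishing_subspace_lincomb[OF e(1) fX])
    have TF: "T F = (\<lambda>z. c * T e z + 1 * T f z)"
      unfolding F_def by (rule bounded_operatorD(2)[OF T XD[OF e(1)] XD[OF fX]])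
    have "(\<lambda>z. l * F z - T F z) = (\<lambda>z. c * h z + (l * f z - T f z))"
      unfolding TF by (simp add: F_def h_def algebra_simps)
    also have "\<dots> = (\<lambda>z. c * h z + r z)"
      using fun_cong[OF f(2)] by simp
    also have "\<dots> = g" by (simp add: r_def)
    finally have eq: "(\<lambda>z. l * F z - T F z) = g" .
    have "dirichlet_norm \<alpha> F \<le> norm c * dirichlet_norm \<alpha> e + 1 * dirichlet_norm \<alpha> f"
      using dirichlet_lincomb(2)[OF XD[OF e(1)] XD[OF fX], of c 1] by (simp add: F_def)
    also have "\<dots> \<le> norm c * dirichlet_norm \<alpha> e + C * (dirichlet_norm \<alpha> g + norm c * dirichlet_norm \<alpha> h)"
    proof -
      have "dirichlet_norm \<alpha> r \<le> dirichlet_norm \<alpha> g + norm c * dirichlet_norm \<alpha> h"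
        using dirichlet_lincomb(2)[OF XD[OF g] XD[OF h(1)], of 1 "- c"] by (simp add: r_def)
      from order_trans[OF f(3) mult_left_mono[OF this C(1)]] show ?thesis by simp
    qed
    also have "\<dots> \<le> (M * dirichlet_norm \<alpha> g) * dirichlet_norm \<alpha> e
        + C * (dirichlet_norm \<alpha> g + (M * dirichlet_norm \<alpha> g) * dirichlet_norm \<alpha> h)"
      using cle C(1) dirichlet_norm_nonneg[OF XD[OF e(1)]] dirichlet_norm_nonneg[OF XD[OF h(1)]]
      by (intro add_mono mult_left_mono mult_right_mono order_refl) auto
    also have "\<dots> = B * dirichlet_norm \<alpha> g" by (simp add: B_def algebra_simps)
    finally have "dirichlet_norm \<alpha> F \<le> B * dirichlet_norm \<alpha> g" .
    with eq FX show "\<exists>f\<in>?X. (\<lambda>z. l * f z - T f z) = g \<and> dirichlet_norm \<alpha> f \<le> B * dirichlet_norm \<alpha> g"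
      by blast
  qed
qed

lemma resolves_0:
  assumes "l \<noteq> 0" "l \<notin> range \<mu>"
  shows "resolves l 0"
proof -
  obtain n where "\<forall>f \<in> vanishing_subspace \<alpha> n. dirichlet_norm \<alpha> (T f) \<le> (norm l / 2) * dirichlet_norm \<alpha> f"
    using small[of "norm l / 2"] assms(1) by auto
  then have "resolves l n"
    using assms(1) by (intro resolves_if_small[of "norm l / 2"]) auto
  then show ?thesis
  proof (induction n)
    case (Suc n)
    have "l \<noteq> \<mu> n" using assms(2) by auto
    then show ?case using resolves_step Suc by blast
  qed
qed

lemma not_in_spectrum_if_resolves:
  assumes "resolves l 0"
  shows "l \<notin> operator_spectrum \<alpha> T"
proof -
  let ?X = "dirichlet_space \<alpha>"
  let ?P = "\<lambda>g f. f \<in> ?X \<and> (\<lambda>z. l * f z - T f z) = g"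
  obtain C where C: "\<And>g. g \<in> ?X \<Longrightarrow> \<exists>f. ?P g f \<and> dirichlet_norm \<alpha> f \<le> C * dirichlet_norm \<alpha> g"
    and inj: "\<And>f. f \<in> ?X \<Longrightarrow> (\<lambda>z. l * f z - T f z) = (\<lambda>_. 0) \<Longrightarrow> f = (\<lambda>_. 0)"
    using assms unfolding resolves_def vanishing_subspace_0 by blast
  have lc: "?P (\<lambda>z. c * g z + d * h z) (\<lambda>z. c * f z + d * k z)" if P: "?P g f" "?P h k" for c d f g h k
  proof
    note f = conjunct1[OF P(1)] and k = conjunct1[OF P(2)]
    show "(\<lambda>z. c * f z + d * k z) \<in> ?X" by (rule dirichlet_lincomb(1)[OF f k])
    show "(\<lambda>z. l * (c * f z + d * k z) - T (\<lambda>z. c * f z + d * k z) z) = (\<lambda>z. c * g z + d * h z)"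
    proof
      fix z
      have gh: "g z = l * f z - T f z" "h z = l * k z - T k z"
        by (rule fun_cong[OF conjunct2[OF P(1)], symmetric], rule fun_cong[OF conjunct2[OF P(2)], symmetric])
      show "l * (c * f z + d * k z) - T (\<lambda>z. c * f z + d * k z) z = c * g z + d * h z"
        unfolding bounded_operatorD(2)[OF T f k] gh by (simp add: algebra_simps)
    qed
  qed
  have uniq: "f = k" if "?P g f" "?P g k" for f g k
  proof -
    have P: "?P (\<lambda>z. 1 * g z + (-1) * g z) (\<lambda>z. 1 * f z + (-1) * k z)" by (rule lc[OF that])
    have "(\<lambda>z. 1 * g z + (-1) * g z) = (\<lambda>_. 0)" by simp
    from inj[OF conjunct1[OF P] conjunct2[OF P, unfolded this]]
    have "1 * f z + (-1) * k z = 0" for z by (rule fun_cong)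
    then show ?thesis by (simp add: fun_eq_iff)
  qed
  define S where "S = (\<lambda>g. THE f. ?P g f)"
  have S: "?P g (S g)" if g: "g \<in> ?X" for g
  proof -
    obtain k where k: "?P g k" using C[OF g] by blast
    show ?thesis unfolding S_def by (rule theI[of "?P g" k]) (rule k, rule uniq[OF _ k])
  qed
  have Seq: "S g = f" if "g \<in> ?X" "?P g f" for f g
    by (rule uniq[OF S[OF that(1)] that(2)])
  have "bounded_operator \<alpha> S"
  proof (rule bounded_operatorI)
    fix f assume f: "f \<in> ?X"
    show "S f \<in> ?X" using S[OF f] by simp
    obtain k where k: "?P f k" "dirichlet_norm \<alpha> k \<le> C * dirichlet_norm \<alpha> f" using C[OF f] by blast
    then show "dirichlet_norm \<alpha> (S f) \<le> C * dirichlet_norm \<alpha> f" using Seq[OF f k(1)] by simp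
  next
    fix f g c d assume fg: "f \<in> ?X" "g \<in> ?X"
    show "S (\<lambda>z. c * f z + d * g z) = (\<lambda>z. c * S f z + d * S g z)"
      by (rule Seq[OF dirichlet_lincomb(1)[OF fg] lc[OF S[OF fg(1)] S[OF fg(2)]]])
  qed
  moreover have "S (\<lambda>z. l * f z - T f z) = f" if f: "f \<in> ?X" for f
  proof (rule Seq)
    show "(\<lambda>z. l * f z - T f z) \<in> ?X"
      using dirichlet_lincomb(1)[OF f TD[OF f], of l "-1"] by simp
  qed (use f in simp)
  moreover have "(\<lambda>z. l * S f z - T (S f) z) = f" if "f \<in> ?X" for f
    using S[OF that] by simp
  ultimately show ?thesis unfolding not_in_operator_spectrum_iff by blast
qed

text \<open>
  A bounded inverse would bound \<open>T\<close> from below, contradicting its smallness on functions of high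
  order of vanishing.
\<close>

lemma zero_in_spectrum: "0 \<in> operator_spectrum \<alpha> T"
proof (rule ccontr)
  assume "0 \<notin> operator_spectrum \<alpha> T"
  then obtain S where S': "bounded_operator \<alpha> S" "\<forall>f \<in> dirichlet_space \<alpha>. S (\<lambda>z. 0 * f z - T f z) = f"
    unfolding not_in_operator_spectrum_iff by blast
  note S = S'(1) bspec[OF S'(2)]
  obtain K where K: "K > 0" "\<And>f. f \<in> dirichlet_space \<alpha> \<Longrightarrow> dirichlet_norm \<alpha> (S f) \<le> K * dirichlet_norm \<alpha> f"
    using bounded_operator_bound[OF S(1)] by blast
  obtain n where n: "\<forall>f \<in> vanishing_subspace \<alpha> n. dirichlet_norm \<alpha> (T f) \<le> (1 / (2 * K)) * dirichlet_norm \<alpha> f"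
    using small[of "1 / (2 * K)"] K by auto
  obtain e where e: "e \<in> vanishing_subspace \<alpha> n" "taylor_coeff e n = 1" by (rule vanishing_subspace_monomial) (rule that)
  note eD = vanishing_subspaceD[OF e(1)]
  have "dirichlet_norm \<alpha> e = dirichlet_norm \<alpha> (S (\<lambda>z. 0 * T e z + (-1) * T e z))"
    using S(2)[OF eD] by simp
  also have "\<dots> \<le> K * dirichlet_norm \<alpha> (\<lambda>z. 0 * T e z + (-1) * T e z)"
    by (intro K dirichlet_lincomb TD eD)
  also have "\<dots> \<le> K * dirichlet_norm \<alpha> (T e)"
    using dirichlet_lincomb(2)[OF TD[OF eD] TD[OF eD], of 0 "-1"] K by (intro mult_left_mono) auto
  also have "\<dots> \<le> K * ((1 / (2 * K)) * dirichlet_norm \<alpha> e)"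
    using n e(1) K by (intro mult_left_mono) auto
  also have "\<dots> = dirichlet_norm \<alpha> e / 2" using K by simp
  finally have "dirichlet_norm \<alpha> e = 0" using dirichlet_norm_nonneg[OF eD] by simp
  then show False using norm_taylor_coeff_le[OF eD, of n] e(2) by simp
qed

text \<open>
  The range of \<open>\<mu> m - T\<close> misses a function: at the first \<open>k\<close> with \<open>\<mu> k = \<mu> m\<close>, a solution \<open>f\<close>
  for a right-hand side of exact order \<open>k\<close> would vanish to order \<open>k\<close>, and then the \<open>k\<close>th
  coefficient of the left-hand side would be 0.
\<close>

lemma eigenvalue_in_spectrum: "\<mu> m \<in> operator_spectrum \<alpha> T"
proof (rule ccontr)
  assume "\<mu> m \<notin> operator_spectrum \<alpha> T"
  then obtain S where S': "bounded_operator \<alpha> S" "\<forall>f \<in> dirichlet_space \<alpha>. (\<lambda>z. \<mu> m * S f z - T (S f) z) = f"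
    unfolding not_in_operator_spectrum_iff by blast
  note S = S'(1) bspec[OF S'(2)]
  define k where "k = (LEAST k. \<mu> k = \<mu> m)"
  have k: "\<mu> k = \<mu> m" unfolding k_def by (rule LeastI[of _ m]) simp
  have nk: "\<mu> j \<noteq> \<mu> m" if "j < k" for j using not_less_Least that unfolding k_def by blast
  obtain e where e: "e \<in> vanishing_subspace \<alpha> k" "taylor_coeff e k = 1" by (rule vanishing_subspace_monomial) (rule that)
  note eD = vanishing_subspaceD[OF e(1)]
  define f where "f = S e"
  have fD: "f \<in> dirichlet_space \<alpha>" unfolding f_def by (rule bounded_operatorD(1)[OF S(1) eD])
  have fe: "(\<lambda>z. \<mu> m * f z - T f z) = e" unfolding f_def by (rule S(2)[OF eD])
  have "f \<in> vanishing_subspace \<alpha> j" if "j \<le> k" for j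
    using that
  proof (induction j)
    case 0
    then show ?case using fD by (simp add: vanishing_subspace_0)
  next
    case (Suc j)
    then have f: "f \<in> vanishing_subspace \<alpha> j" by simp
    have "(\<mu> m - \<mu> j) * taylor_coeff f j = taylor_coeff e j"
      using shifted_in_vanishing_subspace(2)[OF f, of "\<mu> m"] by (simp add: fe)
    also have "\<dots> = 0" using e(1) Suc.prems by (simp add: vanishing_subspace_def)
    finally have "taylor_coeff f j = 0" using nk[of j] Suc.prems by simp
    then show ?case using f by (simp add: vanishing_subspace_Suc)
  qed
  then have f: "f \<in> vanishing_subspace \<alpha> k" by simp
  show False
    using shifted_in_vanishing_subspace(2)[OF f, of "\<mu> m"] e(2) k by (simp add: fe)
qed

theorem operator_spectrum_eq: "operator_spectrum \<alpha> T = range \<mu> \<union> {0}"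
  using resolves_0 not_in_spectrum_if_resolves zero_in_spectrum eigenvalue_in_spectrum by blast

end

section \<open>Weighted composition operators with a fixed point\<close>

lemma weighted_comp_in_hol_disc:
  assumes \<phi>: "holomorphic_self_map \<phi>" and \<psi>: "\<psi> holomorphic_on unit_disc" and f: "f holomorphic_on unit_disc"
  shows "weighted_comp \<psi> \<phi> f \<in> hol_disc"
proof -
  have "(\<lambda>z. \<psi> z * f (\<phi> z)) holomorphic_on unit_disc"
    by (intro holomorphic_intros \<psi> holomorphic_on_comp_self_map[OF \<phi> f])
  then have "weighted_comp \<psi> \<phi> f holomorphic_on unit_disc"
    by (rule holomorphic_transform) (simp add: weighted_comp_def)
  then show ?thesis by (simp add: hol_disc_def weighted_comp_def)
qed

lemma weighted_comp_lincomb: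
  "weighted_comp \<psi> \<phi> (\<lambda>z. c * f z + d * g z) = (\<lambda>z. c * weighted_comp \<psi> \<phi> f z + d * weighted_comp \<psi> \<phi> g z)"
  by (auto simp: weighted_comp_def algebra_simps fun_eq_iff)

lemma coeff_energy_weighted_comp: "coeff_energy s (weighted_comp \<psi> \<phi> f) = coeff_energy s (\<lambda>z. \<psi> z * f (\<phi> z))"
  by (rule coeff_energy_cong) (simp add: weighted_comp_def)

lemma weighted_comp_bound:
  assumes \<phi>: "holomorphic_self_map \<phi>" and \<psi>: "\<psi> holomorphic_on unit_disc" and f: "f \<in> dirichlet_space \<alpha>"
    and C: "C \<ge> 0" and le: "coeff_energy (1 - \<alpha>) (\<lambda>z. \<psi> z * f (\<phi> z)) \<le> ennreal C * coeff_energy (1 - \<alpha>) f"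
  shows "weighted_comp \<psi> \<phi> f \<in> dirichlet_space \<alpha>"
    "dirichlet_norm \<alpha> (weighted_comp \<psi> \<phi> f) \<le> sqrt C * dirichlet_norm \<alpha> f"
proof -
  have le': "coeff_energy (1 - \<alpha>) (weighted_comp \<psi> \<phi> f) \<le> ennreal (C * (dirichlet_norm \<alpha> f)\<^sup>2)"
    using le C by (simp add: coeff_energy_weighted_comp coeff_energy_eq_dirichlet_norm[OF f] ennreal_mult')
  show m: "weighted_comp \<psi> \<phi> f \<in> dirichlet_space \<alpha>"
    by (rule dirichlet_space_if_coeff_energy_finite)
       (use le' dirichlet_spaceD[OF f] weighted_comp_in_hol_disc[OF \<phi> \<psi>] in \<open>auto intro: le_less_trans\<close>)
  have "(dirichlet_norm \<alpha> (weighted_comp \<psi> \<phi> f))\<^sup>2 \<le> C * (dirichlet_norm \<alpha> f)\<^sup>2"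
    using le' C by (simp add: coeff_energy_eq_dirichlet_norm[OF m])
  also have "\<dots> = (sqrt C * dirichlet_norm \<alpha> f)\<^sup>2" using C by (simp add: power_mult_distrib)
  finally show "dirichlet_norm \<alpha> (weighted_comp \<psi> \<phi> f) \<le> sqrt C * dirichlet_norm \<alpha> f"
    by (rule power2_le_imp_le) (use C dirichlet_norm_nonneg[OF f] in simp)
qed

lemma bounded_operator_weighted_comp:
  assumes \<phi>: "holomorphic_self_map \<phi>" and \<psi>: "\<psi> holomorphic_on unit_disc" and C: "C \<ge> 0"
    and le: "\<And>f. f holomorphic_on unit_disc \<Longrightarrow>
       coeff_energy (1 - \<alpha>) (\<lambda>z. \<psi> z * f (\<phi> z)) \<le> ennreal C * coeff_energy (1 - \<alpha>) f"
  shows "bounded_operator \<alpha> (weighted_comp \<psi> \<phi>)"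
proof (rule bounded_operatorI)
  fix f assume f: "f \<in> dirichlet_space \<alpha>"
  note b = weighted_comp_bound[OF \<phi> \<psi> f C le[OF dirichlet_spaceD(2)[OF f]]]
  show "weighted_comp \<psi> \<phi> f \<in> dirichlet_space \<alpha>"
    "dirichlet_norm \<alpha> (weighted_comp \<psi> \<phi> f) \<le> sqrt C * dirichlet_norm \<alpha> f"
    by (rule b)+
qed (rule weighted_comp_lincomb)

text \<open>
  In the ring of power series, \<open>F\<close> divisible by the \<open>n\<close>th power of \<open>X\<close> makes the composite
  divisible by the \<open>n\<close>th power of the expansion of \<open>\<phi>\<close>, which is itself divisible by \<open>X\<close>.
\<close>

lemma weighted_comp_triangular:
  assumes \<phi>: "holomorphic_self_map \<phi>" and \<phi>0: "\<phi> 0 = 0" and \<psi>: "\<psi> holomorphic_on unit_disc"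
    and f: "f holomorphic_on unit_disc" and van: "\<And>k. k < n \<Longrightarrow> taylor_coeff f k = 0"
  shows "k < n \<Longrightarrow> taylor_coeff (weighted_comp \<psi> \<phi> f) k = 0"
    and "taylor_coeff (weighted_comp \<psi> \<phi> f) n = \<psi> 0 * deriv \<phi> 0 ^ n * taylor_coeff f n"
proof -
  note hol = holomorphic_self_mapD(1)[OF \<phi>]
  let ?F = "fps_expansion f 0" and ?P = "fps_expansion \<psi> 0" and ?Q = "fps_expansion \<phi> 0"
  have Q0: "fps_nth ?Q 0 = 0" by (simp add: fps_expansion_def \<phi>0)
  have exp: "f has_fps_expansion ?F" "\<psi> has_fps_expansion ?P" "\<phi> has_fps_expansion ?Q"
    using f \<psi> hol by (auto intro!: has_fps_expansion_fps_expansion[of unit_disc])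
  have "(\<lambda>z. \<psi> z * (f \<circ> \<phi>) z) has_fps_expansion ?P * fps_compose ?F ?Q"
    by (intro has_fps_expansion_mult has_fps_expansion_compose exp Q0)
  then have "fps_expansion (\<lambda>z. \<psi> z * f (\<phi> z)) 0 = ?P * fps_compose ?F ?Q"
    by (intro fps_expansion_eqI) (simp add: o_def)
  moreover have "taylor_coeff (weighted_comp \<psi> \<phi> f) = taylor_coeff (\<lambda>z. \<psi> z * f (\<phi> z))"
    by (rule taylor_coeff_cong) (simp add: weighted_comp_def)
  ultimately have tc: "taylor_coeff (weighted_comp \<psi> \<phi> f) k = fps_nth (?P * fps_compose ?F ?Q) k" for k
    by (simp add: taylor_coeff_def)
  define G where "G = fps_shift n ?F"
  define R where "R = fps_shift 1 ?Q"
  have F: "?F = fps_X ^ n * G"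
    by (rule fps_ext) (use van in \<open>simp add: G_def fps_X_power_mult_nth taylor_coeff_def\<close>)
  have Q: "?Q = fps_X ^ 1 * R"
    by (rule fps_ext) (use Q0 in \<open>simp add: R_def fps_X_power_mult_nth\<close>)
  have "fps_compose ?F ?Q = ?Q ^ n * fps_compose G ?Q"
    by (subst F) (simp add: fps_compose_mult_distrib[OF Q0] fps_compose_power[OF Q0, symmetric] Q0)
  also have "?Q ^ n = fps_X ^ n * R ^ n"
    by (subst Q) (simp add: power_mult_distrib)
  finally have eq: "?P * fps_compose ?F ?Q = fps_X ^ n * (?P * R ^ n * fps_compose G ?Q)"
    by (simp add: mult_ac)
  show "taylor_coeff (weighted_comp \<psi> \<phi> f) k = 0" if "k < n"
    unfolding tc eq fps_X_power_mult_nth using that by simp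
  have "fps_nth R 0 = deriv \<phi> 0" by (simp add: R_def fps_expansion_def)
  moreover have "fps_nth (fps_compose G ?Q) 0 = taylor_coeff f n"
    by (simp add: G_def taylor_coeff_def fps_compose_nth)
  moreover have "fps_nth ?P 0 = \<psi> 0" by (simp add: fps_expansion_def)
  ultimately show "taylor_coeff (weighted_comp \<psi> \<phi> f) n = \<psi> 0 * deriv \<phi> 0 ^ n * taylor_coeff f n"
    unfolding tc eq fps_X_power_mult_nth by (simp add: fps_nth_power_0)
qed

lemma Moebius_deriv:
  assumes w: "w \<in> unit_disc"
  shows "deriv (Moebius_function 0 w) w * deriv (Moebius_function 0 (- w)) 0 = 1"
proof -
  have mw: "- w \<in> unit_disc" using w by simp
  note h = holomorphic_self_mapD(1)[OF Moebius_self_map(1)]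
  have M0: "Moebius_function 0 (- w) 0 = w" by (simp add: Moebius_function_of_zero)
  have "(Moebius_function 0 w has_field_derivative deriv (Moebius_function 0 w) w) (at (Moebius_function 0 (- w) 0))"
    unfolding M0 using w by (intro holomorphic_derivI[OF h[OF w]]) auto
  moreover have "(Moebius_function 0 (- w) has_field_derivative deriv (Moebius_function 0 (- w)) 0) (at 0)"
    by (intro holomorphic_derivI[OF h[OF mw]]) auto
  ultimately have "((\<lambda>z. Moebius_function 0 w (Moebius_function 0 (- w) z)) has_field_derivative
      deriv (Moebius_function 0 w) w * deriv (Moebius_function 0 (- w)) 0) (at 0)"
    using DERIV_chain by (fastforce simp: o_def)
  then have "((\<lambda>z. z) has_field_derivative deriv (Moebius_function 0 w) w * deriv (Moebius_function 0 (- w)) 0) (at 0)"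
    by (rule has_field_derivative_transform_within_open[where S = unit_disc])
       (use Moebius_self_map(3)[OF mw] in auto)
  then show ?thesis using DERIV_ident DERIV_unique by blast
qed

text \<open>
  The maximum principle on a disc whose boundary circle lies where \<open>g\<close> is smaller than its value
  at \<open>z\<close>.
\<close>

lemma disc_identically_0_if_boundary_limit_0:
  assumes g: "g holomorphic_on unit_disc" and lim: "((\<lambda>z. norm (g z)) \<longlongrightarrow> 0) (norm going_to at_left 1)"
    and z: "z \<in> unit_disc"
  shows "g z = 0"
proof (rule ccontr)
  assume nz: "g z \<noteq> 0"
  then obtain r where r: "0 < r" "r < 1" "\<And>w. r < norm w \<Longrightarrow> norm w < 1 \<Longrightarrow> \<bar>norm (g w)\<bar> < norm (g z)"
    using tendsto_0_boundaryD[OF lim, of "norm (g z)"] by auto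
  define \<rho> where "\<rho> = (max r (norm z) + 1) / 2"
  have \<rho>: "0 < \<rho>" "r < \<rho>" "norm z < \<rho>" "\<rho> < 1" using r z by (auto simp: \<rho>_def)
  have sub: "cball 0 \<rho> \<subseteq> unit_disc" using \<rho> by auto
  obtain w where w: "w \<in> sphere 0 \<rho>" "\<And>v. v \<in> sphere 0 \<rho> \<Longrightarrow> norm (g v) \<le> norm (g w)"
  proof -
    have "sphere (0::complex) \<rho> \<noteq> {}" using \<rho> by simp
    moreover have "continuous_on (sphere 0 \<rho>) (\<lambda>v. norm (g v))"
      by (intro continuous_intros continuous_on_subset[OF holomorphic_on_imp_continuous_on[OF g]]) (use sub in auto)
    ultimately show ?thesis
      using continuous_attains_sup[of "sphere 0 \<rho>" "\<lambda>v. norm (g v)"] that by auto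
  qed
  have "norm (g z) \<le> norm (g w)"
  proof (rule maximum_modulus_frontier[of g "cball 0 \<rho>"])
    show "g holomorphic_on interior (cball 0 \<rho>)"
      by (rule holomorphic_on_subset[OF g]) (use sub in auto)
    show "continuous_on (closure (cball 0 \<rho>)) g"
      using continuous_on_subset[OF holomorphic_on_imp_continuous_on[OF g] sub] by simp
    show "norm (g v) \<le> norm (g w)" if "v \<in> frontier (cball 0 \<rho>)" for v
      using w(2) that by simp
  qed (use \<rho> in auto)
  moreover have "norm (g w) < norm (g z)" using r(3)[of w] w(1) \<rho> by simp
  ultimately show False by simp
qed

section \<open>Reduction to a fixed point at the origin\<close>

lemma holomorphic_self_map_comp:
  assumes "holomorphic_self_map f" "holomorphic_self_map g"
  shows "holomorphic_self_map (\<lambda>z. f (g z))"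
  using holomorphic_on_comp_self_map[OF assms(2) holomorphic_self_mapD(1)[OF assms(1)]]
    holomorphic_self_mapD(2)[OF assms(1)] holomorphic_self_mapD(2)[OF assms(2)]
  unfolding holomorphic_self_map_def by blast

lemma deriv_conjugate_fixed_point:
  assumes \<phi>: "holomorphic_self_map \<phi>" and a: "a \<in> unit_disc" "\<phi> a = a"
  shows "deriv (\<lambda>z. Moebius_function 0 a (\<phi> (Moebius_function 0 (- a) z))) 0 = deriv \<phi> a"
proof -
  let ?\<tau> = "Moebius_function 0 a" and ?\<sigma> = "Moebius_function 0 (- a)"
  have ma: "- a \<in> unit_disc" using a by simp
  note h = holomorphic_self_mapD(1)[OF Moebius_self_map(1)]
  have M0: "?\<sigma> 0 = a" by (simp add: Moebius_function_of_zero)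
  have d: "(?\<sigma> has_field_derivative deriv ?\<sigma> 0) (at 0)"
    "(\<phi> has_field_derivative deriv \<phi> a) (at (?\<sigma> 0))"
    "(?\<tau> has_field_derivative deriv ?\<tau> a) (at (\<phi> (?\<sigma> 0)))"
    unfolding M0 a(2)
    using a by (intro holomorphic_derivI[OF h[OF ma]] holomorphic_derivI[OF h[OF a(1)]]
        holomorphic_derivI[OF holomorphic_self_mapD(1)[OF \<phi>]]; simp)+
  have c: "((\<lambda>z. \<phi> (?\<sigma> z)) has_field_derivative deriv \<phi> a * deriv ?\<sigma> 0) (at 0)"
    by (rule DERIV_chain2[where f = \<phi> and g = ?\<sigma>, OF d(2) d(1)])
  have "((\<lambda>z. ?\<tau> (\<phi> (?\<sigma> z))) has_field_derivative deriv ?\<tau> a * (deriv \<phi> a * deriv ?\<sigma> 0)) (at 0)"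
    by (rule DERIV_chain2[where f = ?\<tau> and g = "\<lambda>z. \<phi> (?\<sigma> z)", OF d(3) c])
  then have "deriv (\<lambda>z. ?\<tau> (\<phi> (?\<sigma> z))) 0 = deriv ?\<tau> a * (deriv \<phi> a * deriv ?\<sigma> 0)"
    by (rule DERIV_imp_deriv)
  also have "\<dots> = deriv \<phi> a * (deriv ?\<tau> a * deriv ?\<sigma> 0)" by (simp add: mult_ac)
  finally show ?thesis by (simp add: Moebius_deriv[OF a(1)])
qed

lemma weighted_comp_Moebius_conjugate:
  assumes a: "a \<in> unit_disc" and \<phi>: "holomorphic_self_map \<phi>"
  shows "weighted_comp (\<lambda>_. 1) (Moebius_function 0 (- a)) (weighted_comp \<psi> \<phi> (weighted_comp (\<lambda>_. 1) (Moebius_function 0 a) f))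
    = weighted_comp (\<lambda>z. \<psi> (Moebius_function 0 (- a) z))
        (\<lambda>z. Moebius_function 0 a (\<phi> (Moebius_function 0 (- a) z))) f"
proof -
  have ma: "- a \<in> unit_disc" using a by simp
  show ?thesis
    using holomorphic_self_mapD(2)[OF Moebius_self_map(1)[OF ma]] holomorphic_self_mapD(2)[OF \<phi>]
    by (simp add: weighted_comp_def fun_eq_iff del: mem_ball_0)
qed

lemma weighted_comp_Moebius_inverse:
  assumes w: "w \<in> unit_disc" and f: "f \<in> hol_disc"
  shows "weighted_comp (\<lambda>_. 1) (Moebius_function 0 w) (weighted_comp (\<lambda>_. 1) (Moebius_function 0 (- w)) f) = f"
proof
  fix z
  show "weighted_comp (\<lambda>_. 1) (Moebius_function 0 w) (weighted_comp (\<lambda>_. 1) (Moebius_function 0 (- w)) f) z = f z"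
    using holomorphic_self_mapD(2)[OF Moebius_self_map(1)[OF w]] Moebius_self_map(3)[OF w] f
    by (cases "z \<in> unit_disc") (simp_all add: weighted_comp_def hol_disc_def del: mem_ball_0)
qed

lemma bounded_operator_Moebius_comp:
  assumes w: "w \<in> unit_disc" and \<alpha>: "\<alpha> > -1"
  shows "bounded_operator \<alpha> (weighted_comp (\<lambda>_. 1) (Moebius_function 0 w))"
proof -
  have "1 - \<alpha> < 2" using \<alpha> by simp
  then obtain C where C: "C \<ge> 0" "\<And>f. f holomorphic_on unit_disc \<Longrightarrow>
      coeff_energy (1 - \<alpha>) (\<lambda>z. f (Moebius_function 0 w z)) \<le> ennreal C * coeff_energy (1 - \<alpha>) f"
    using coeff_energy_Moebius_comp_le[OF w] by metis
  show ?thesis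
    by (rule bounded_operator_weighted_comp[OF Moebius_self_map(1)[OF w] _ C(1)]) (use C(2) in auto)
qed

text \<open>
  The conjugate \<open>h\<close> of \<open>\<phi>\<close> by a Moebius transformation fixes 0 and has the same derivative
  there.
\<close>

lemma norm_deriv_at_fixed_point:
  assumes \<phi>: "holomorphic_self_map \<phi>" "inj_on \<phi> unit_disc" and a: "a \<in> unit_disc" "\<phi> a = a"
    and \<psi>: "\<psi> holomorphic_on unit_disc" "\<exists>z \<in> unit_disc. \<psi> z \<noteq> 0" and \<alpha>: "\<alpha> > (-1::real)"
    and lim: "((\<lambda>z. norm (\<psi> z) * (defect z / defect (\<phi> z)) powr (\<alpha> / 2 + 1)) \<longlongrightarrow> 0) (norm going_to at_left 1)"
  shows "0 < norm (deriv \<phi> a)" "norm (deriv \<phi> a) < 1"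
proof -
  note hol = holomorphic_self_mapD(1)[OF \<phi>(1)] and im = holomorphic_self_mapD(2)[OF \<phi>(1)]
  show "0 < norm (deriv \<phi> a)"
    using holomorphic_injective_imp_regular[OF hol _ \<phi>(2) a(1)] by simp
  let ?\<tau> = "Moebius_function 0 a" and ?\<sigma> = "Moebius_function 0 (- a)"
  have ma: "- a \<in> unit_disc" using a by simp
  note \<tau> = Moebius_self_map(1)[OF a(1)] and \<sigma> = Moebius_self_map(1)[OF ma]
  note \<tau>im = holomorphic_self_mapD(2)[OF \<tau>] and \<sigma>im = holomorphic_self_mapD(2)[OF \<sigma>]
  have \<sigma>\<tau>: "?\<sigma> (?\<tau> z) = z" if "z \<in> unit_disc" for z by (rule Moebius_self_map(3)[OF a(1) that])
  have M0: "?\<sigma> 0 = a" "?\<tau> a = 0" by (simp_all add: Moebius_function_of_zero Moebius_function_eq_zero)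
  define h where "h = (\<lambda>z. ?\<tau> (\<phi> (?\<sigma> z)))"
  have h: "h holomorphic_on unit_disc"
    unfolding h_def
    by (rule holomorphic_on_comp_self_map[OF \<sigma>, of "\<lambda>z. ?\<tau> (\<phi> z)"])
       (rule holomorphic_on_comp_self_map[OF \<phi>(1) holomorphic_self_mapD(1)[OF \<tau>]])
  have h0: "h 0 = 0" by (simp add: h_def M0 a(2))
  have him: "norm (h z) < 1" if "norm z < 1" for z
    using \<tau>im[OF im[OF \<sigma>im[of z]]] that by (simp add: h_def)
  have dh: "deriv h 0 = deriv \<phi> a" by (rule deriv_conjugate_fixed_point[OF \<phi>(1) a, folded h_def])
  have le1: "norm (deriv h 0) \<le> 1" by (rule Schwarz_Lemma(2)[OF h h0 him, of 0]) auto
  have "norm (deriv h 0) \<noteq> 1"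
  proof
    assume eq1: "norm (deriv h 0) = 1"
    have "\<exists>c. (\<forall>z. norm z < 1 \<longrightarrow> h z = c * z) \<and> norm c = 1"
      by (rule Schwarz_Lemma(3)[OF h h0 him, of 0]) (use eq1 in auto)
    then obtain c where c: "\<And>z. norm z < 1 \<Longrightarrow> h z = c * z" "norm c = 1" by blast
    \<comment> \<open>\<open>\<phi>\<close> is then conjugate to a rotation, so it distorts the distance to the circle by a bounded factor.\<close>
    obtain S where S: "S \<ge> 1" "\<And>z. z \<in> unit_disc \<Longrightarrow> defect z \<le> S * defect (?\<tau> z)"
      using defect_le_defect_self_map[OF \<tau>] by metis
    obtain R where R: "R \<ge> 1" "\<And>z. z \<in> unit_disc \<Longrightarrow> defect z \<le> R * defect (?\<sigma> z)"
      using defect_le_defect_self_map[OF \<sigma>] by metis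
    have bd: "defect (\<phi> w) \<le> S * R * defect w" if w: "w \<in> unit_disc" for w
    proof -
      have "defect (\<phi> w) \<le> S * defect (?\<tau> (\<phi> w))" by (rule S(2)[OF im[OF w]])
      also have "?\<tau> (\<phi> w) = c * ?\<tau> w"
        using c(1)[of "?\<tau> w"] \<tau>im[OF w] by (simp add: h_def \<sigma>\<tau>[OF w])
      also have "defect (c * ?\<tau> w) = defect (?\<tau> w)" by (simp add: defect_def norm_mult c(2))
      also have "S * defect (?\<tau> w) \<le> S * (R * defect (?\<sigma> (?\<tau> w)))"
        using S(1) by (intro mult_left_mono R(2) \<tau>im w) auto
      finally show ?thesis by (simp add: \<sigma>\<tau>[OF w] mult.assoc)
    qed
    let ?p = "\<alpha> / 2 + 1"
    let ?F = "\<lambda>z. norm (\<psi> z) * (defect z / defect (\<phi> z)) powr ?p"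
    have "norm (\<psi> w) \<le> (S * R) powr ?p * ?F w" if "norm w < 1" for w
    proof -
      have w: "w \<in> unit_disc" using that by simp
      have pos: "0 < defect w" "0 < defect (\<phi> w)" using w im by (auto intro: defect_pos)
      have "1 \<le> S * R * (defect w / defect (\<phi> w))"
        using bd[OF w] pos by (simp add: field_simps)
      then have "1 powr ?p \<le> (S * R * (defect w / defect (\<phi> w))) powr ?p"
        using \<alpha> by (intro powr_mono2) auto
      also have "\<dots> = (S * R) powr ?p * (defect w / defect (\<phi> w)) powr ?p"
        by (rule powr_mult)
      finally have "norm (\<psi> w) * 1 \<le> norm (\<psi> w) * ((S * R) powr ?p * (defect w / defect (\<phi> w)) powr ?p)"
        by (intro mult_left_mono) auto
      then show ?thesis by (simp add: mult_ac)
    qed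
    moreover have "eventually (\<lambda>w::complex. norm w < 1) (norm going_to at_left 1)"
      by (rule eventually_going_toI[of "\<lambda>x. x < 1"]) (auto simp: eventually_at_left_field intro: exI[of _ 0])
    ultimately have ev: "eventually (\<lambda>w. norm (norm (\<psi> w)) \<le> (S * R) powr ?p * ?F w) (norm going_to at_left 1)"
      by (auto elim!: eventually_mono)
    have "((\<lambda>w. (S * R) powr ?p * ?F w) \<longlongrightarrow> (S * R) powr ?p * 0) (norm going_to at_left 1)"
      by (intro tendsto_mult tendsto_const lim)
    then have lim0: "((\<lambda>w. (S * R) powr ?p * ?F w) \<longlongrightarrow> 0) (norm going_to at_left 1)" by simp
    have "((\<lambda>w. norm (\<psi> w)) \<longlongrightarrow> 0) (norm going_to at_left 1)"
      by (rule Lim_null_comparison[OF ev lim0])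
    then have "\<psi> z = 0" if "z \<in> unit_disc" for z
      by (rule disc_identically_0_if_boundary_limit_0[OF \<psi>(1) _ that])
    then show False using \<psi>(2) by blast
  qed
  then show "norm (deriv \<phi> a) < 1" using le1 dh by simp
qed

text \<open>
  The part with the small factor is paid by the choice of \<open>\<epsilon>\<close>, the part in the weaker norm by
  the choice of \<open>n\<close>; each gets half of \<open>\<delta>\<^sup>2\<close>.
\<close>

lemma conjugate_weighted_comp_small:
  assumes \<alpha>: "\<alpha> > -1" and \<phi>: "holomorphic_self_map \<phi>" and \<psi>: "\<psi> holomorphic_on unit_disc" and a: "a \<in> unit_disc"
    and est: "\<And>\<epsilon>. \<epsilon> > 0 \<Longrightarrow> \<exists>K\<ge>0. \<forall>f. f holomorphic_on unit_disc \<longrightarrow> coeff_energy (1 - \<alpha>) (\<lambda>z. \<psi> z * f (\<phi> z))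
        \<le> ennreal \<epsilon> * coeff_energy (1 - \<alpha>) f + ennreal K * coeff_energy (- \<alpha>) f"
    and \<delta>: "\<delta> > 0"
  defines "T' \<equiv> weighted_comp (\<lambda>z. \<psi> (Moebius_function 0 (- a) z))
        (\<lambda>z. Moebius_function 0 a (\<phi> (Moebius_function 0 (- a) z)))"
  shows "\<exists>n. \<forall>f \<in> vanishing_subspace \<alpha> n. dirichlet_norm \<alpha> (T' f) \<le> \<delta> * dirichlet_norm \<alpha> f"
proof -
  let ?\<tau> = "Moebius_function 0 a" and ?\<sigma> = "Moebius_function 0 (- a)"
  have ma: "- a \<in> unit_disc" using a by simp
  note \<tau> = Moebius_self_map(1)[OF a] and \<sigma> = Moebius_self_map(1)[OF ma]
  have s: "1 - \<alpha> < 2" "- \<alpha> < 2" using \<alpha> by auto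
  obtain C1 where C1: "C1 \<ge> 0" "\<And>f. f holomorphic_on unit_disc \<Longrightarrow>
      coeff_energy (1 - \<alpha>) (\<lambda>z. f (?\<tau> z)) \<le> ennreal C1 * coeff_energy (1 - \<alpha>) f"
    using coeff_energy_Moebius_comp_le[OF a s(1)] by metis
  obtain C0 where C0: "C0 \<ge> 0" "\<And>f. f holomorphic_on unit_disc \<Longrightarrow>
      coeff_energy (- \<alpha>) (\<lambda>z. f (?\<tau> z)) \<le> ennreal C0 * coeff_energy (- \<alpha>) f"
    using coeff_energy_Moebius_comp_le[OF a s(2)] by metis
  obtain C2 where C2: "C2 \<ge> 0" "\<And>f. f holomorphic_on unit_disc \<Longrightarrow>
      coeff_energy (1 - \<alpha>) (\<lambda>z. f (?\<sigma> z)) \<le> ennreal C2 * coeff_energy (1 - \<alpha>) f"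
    using coeff_energy_Moebius_comp_le[OF ma s(1)] by metis
  define \<epsilon> where "\<epsilon> = \<delta>\<^sup>2 / (2 * (C1 * C2 + 1))"
  have D: "C1 * C2 + 1 > 0" using C1 C2 by (simp add: add_nonneg_pos)
  have \<epsilon>: "\<epsilon> > 0" using \<delta> D by (simp add: \<epsilon>_def)
  have \<epsilon>le: "C2 * (\<epsilon> * C1) \<le> \<delta>\<^sup>2 / 2"
  proof -
    have "C2 * (\<epsilon> * C1) = (\<delta>\<^sup>2 / 2) * (C1 * C2 / (C1 * C2 + 1))" by (simp add: \<epsilon>_def)
    also have "\<dots> \<le> (\<delta>\<^sup>2 / 2) * 1" using D by (intro mult_left_mono) auto
    finally show ?thesis by simp
  qed
  obtain K where K: "K \<ge> 0" "\<And>f. f holomorphic_on unit_disc \<Longrightarrow> coeff_energy (1 - \<alpha>) (\<lambda>z. \<psi> z * f (\<phi> z))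
        \<le> ennreal \<epsilon> * coeff_energy (1 - \<alpha>) f + ennreal K * coeff_energy (- \<alpha>) f"
    using est[OF \<epsilon>] by blast
  obtain n :: nat where n: "2 * (C2 * (K * C0)) / \<delta>\<^sup>2 \<le> real n" using real_arch_simple by blast
  have nle: "C2 * (K * C0) * (real n + 1) powr (-1) \<le> \<delta>\<^sup>2 / 2"
  proof -
    have "2 * (C2 * (K * C0)) \<le> real n * \<delta>\<^sup>2" using n \<delta> by (simp add: pos_divide_le_eq)
    also have "\<dots> \<le> (real n + 1) * \<delta>\<^sup>2" by (intro mult_right_mono) auto
    finally show ?thesis by (simp add: powr_minus field_simps)
  qed
  have \<phi>': "holomorphic_self_map (\<lambda>z. ?\<tau> (\<phi> (?\<sigma> z)))"
    by (rule holomorphic_self_map_comp[OF \<tau> holomorphic_self_map_comp[OF \<phi> \<sigma>]])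
  have \<psi>': "(\<lambda>z. \<psi> (?\<sigma> z)) holomorphic_on unit_disc" by (rule holomorphic_on_comp_self_map[OF \<sigma> \<psi>])
  show ?thesis
  proof (intro exI[of _ n] ballI)
    fix f assume fX: "f \<in> vanishing_subspace \<alpha> n"
    then have fD: "f \<in> dirichlet_space \<alpha>" and van: "\<And>k. k < n \<Longrightarrow> taylor_coeff f k = 0"
      by (auto simp: vanishing_subspace_def)
    note f = dirichlet_spaceD(2)[OF fD]
    let ?W = "coeff_energy (1 - \<alpha>) f"
    have g: "(\<lambda>z. f (?\<tau> z)) holomorphic_on unit_disc" by (rule holomorphic_on_comp_self_map[OF \<tau> f])
    have k: "(\<lambda>z. \<psi> z * f (?\<tau> (\<phi> z))) holomorphic_on unit_disc"
      by (intro holomorphic_intros \<psi> holomorphic_on_comp_self_map[OF \<phi> g])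
    have gain: "coeff_energy (- \<alpha>) f \<le> ennreal ((real n + 1) powr (-1)) * ?W"
      using coeff_energy_gain[of "- \<alpha>" "1 - \<alpha>" n f] van by simp
    have g0: "coeff_energy (- \<alpha>) (\<lambda>z. f (?\<tau> z)) \<le> ennreal (C0 * (real n + 1) powr (-1)) * ?W"
      by (rule ennreal_mult_trans[OF C0(2)[OF f] gain]) (use C0 in auto)
    have "coeff_energy (1 - \<alpha>) (\<lambda>z. \<psi> z * f (?\<tau> (\<phi> z)))
       \<le> ennreal \<epsilon> * coeff_energy (1 - \<alpha>) (\<lambda>z. f (?\<tau> z)) + ennreal K * coeff_energy (- \<alpha>) (\<lambda>z. f (?\<tau> z))"
      by (rule K(2)[OF g])
    also have "\<dots> \<le> ennreal \<epsilon> * (ennreal C1 * ?W) + ennreal K * (ennreal (C0 * (real n + 1) powr (-1)) * ?W)"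
      by (intro add_mono mult_left_mono C1(2) f g0) auto
    also have "\<dots> = ennreal (\<epsilon> * C1) * ?W + ennreal (K * (C0 * (real n + 1) powr (-1))) * ?W"
      using \<epsilon> K(1) by (simp only: ennreal_mult'[OF less_imp_le[OF \<epsilon>]] ennreal_mult'[OF K(1)] mult.assoc[of _ _ ?W])
    also have "\<dots> = ennreal (\<epsilon> * C1 + K * (C0 * (real n + 1) powr (-1))) * ?W"
      using \<epsilon> C1(1) K(1) C0(1) by (subst ennreal_plus) (auto simp: distrib_right)
    finally have 1: "coeff_energy (1 - \<alpha>) (\<lambda>z. \<psi> z * f (?\<tau> (\<phi> z))) \<le> \<dots>" .
    have "coeff_energy (1 - \<alpha>) (\<lambda>z. \<psi> (?\<sigma> z) * f (?\<tau> (\<phi> (?\<sigma> z))))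
      \<le> ennreal (C2 * (\<epsilon> * C1 + K * (C0 * (real n + 1) powr (-1)))) * ?W"
      by (rule ennreal_mult_trans[OF C2(2)[OF k] 1]) (use \<epsilon> C1(1) K(1) C0(1) C2(1) in auto)
    also have "\<dots> \<le> ennreal (\<delta>\<^sup>2) * ?W"
    proof (intro mult_right_mono ennreal_leI)
      have "C2 * (\<epsilon> * C1 + K * (C0 * (real n + 1) powr (-1))) = C2 * (\<epsilon> * C1) + C2 * (K * C0) * (real n + 1) powr (-1)"
        by (simp only: distrib_left mult.assoc)
      then show "C2 * (\<epsilon> * C1 + K * (C0 * (real n + 1) powr (-1))) \<le> \<delta>\<^sup>2"
        using \<epsilon>le nle by linarith
    qed simp
    finally have "coeff_energy (1 - \<alpha>) (\<lambda>z. \<psi> (?\<sigma> z) * f (?\<tau> (\<phi> (?\<sigma> z)))) \<le> ennreal (\<delta>\<^sup>2) * ?W" .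
    from weighted_comp_bound(2)[OF \<phi>' \<psi>' fD _ this]
    show "dirichlet_norm \<alpha> (T' f) \<le> \<delta> * dirichlet_norm \<alpha> f"
      using \<delta> by (simp add: T'_def)
  qed
qed

theorem theorem1p4:
  fixes \<alpha> :: real and \<phi> \<psi> :: "complex \<Rightarrow> complex" and a :: complex
  assumes "\<alpha> \<in> {-1<..<1}"
    and "holomorphic_self_map \<phi>" and "inj_on \<phi> unit_disc"
    and "a \<in> unit_disc" and "\<phi> a = a"
    and "deriv (deriv \<phi>) \<in> bounded_holomorphic"
    and "\<psi> holomorphic_on unit_disc" and "\<exists>z \<in> unit_disc. \<psi> z \<noteq> 0"
    and "((\<lambda>z. norm (deriv (deriv \<psi>) z) * (1 - (norm z)\<^sup>2)) \<longlongrightarrow> 0) (norm going_to at_left 1)"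
    and "((\<lambda>z. norm (\<psi> z) * ((1 - (norm z)\<^sup>2) / (1 - (norm (\<phi> z))\<^sup>2)) powr (\<alpha> / 2 + 1)) \<longlongrightarrow> 0)
           (norm going_to at_left 1)"
  shows "0 < norm (deriv \<phi> a) \<and> norm (deriv \<phi> a) < 1 \<and>
    bounded_operator \<alpha> (weighted_comp \<psi> \<phi>) \<and>
    operator_spectrum \<alpha> (weighted_comp \<psi> \<phi>)
      = {\<psi> a * deriv \<phi> a ^ n | n :: nat. True} \<union> {0} \<and>
    (\<psi> a = 0 \<longrightarrow> operator_spectrum \<alpha> (weighted_comp \<psi> \<phi>) = {0})"
proof -
  have \<alpha>: "\<alpha> > -1" using assms(1) by simp
  note \<phi> = assms(2,3) and a = assms(4) and \<psi> = assms(7)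
  note lim1 = assms(9)[folded defect_def] and lim2 = assms(10)[folded defect_def]
  let ?T = "weighted_comp \<psi> \<phi>"
  have est: "\<exists>K\<ge>0. \<forall>f. f holomorphic_on unit_disc \<longrightarrow> coeff_energy (1 - \<alpha>) (\<lambda>z. \<psi> z * f (\<phi> z))
        \<le> ennreal \<epsilon> * coeff_energy (1 - \<alpha>) f + ennreal K * coeff_energy (- \<alpha>) f" if "\<epsilon> > 0" for \<epsilon>
    using coeff_energy_weighted_comp_small[OF \<alpha> \<phi> assms(6) \<psi> lim1 lim2 that] by metis
  have bT: "bounded_operator \<alpha> ?T"
  proof -
    obtain K where K: "K \<ge> 0" "\<And>f. f holomorphic_on unit_disc \<Longrightarrow> coeff_energy (1 - \<alpha>) (\<lambda>z. \<psi> z * f (\<phi> z))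
        \<le> ennreal 1 * coeff_energy (1 - \<alpha>) f + ennreal K * coeff_energy (- \<alpha>) f"
      using est[of 1] by (metis zero_less_one)
    show ?thesis
    proof (rule bounded_operator_weighted_comp[OF \<phi>(1) \<psi>, of "1 + K"])
      fix f assume f: "f holomorphic_on unit_disc"
      have "coeff_energy (1 - \<alpha>) (\<lambda>z. \<psi> z * f (\<phi> z))
        \<le> ennreal 1 * coeff_energy (1 - \<alpha>) f + ennreal K * coeff_energy (1 - \<alpha>) f"
        by (rule order_trans[OF K(2)[OF f]]) (intro add_left_mono mult_left_mono coeff_energy_mono, auto)
      also have "\<dots> = ennreal (1 + K) * coeff_energy (1 - \<alpha>) f"
        using K(1) by (simp add: ennreal_plus distrib_right)
      finally show "coeff_energy (1 - \<alpha>) (\<lambda>z. \<psi> z * f (\<phi> z)) \<le> ennreal (1 + K) * coeff_energy (1 - \<alpha>) f" .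
    qed (use K in simp)
  qed
  let ?\<tau> = "Moebius_function 0 a" and ?\<sigma> = "Moebius_function 0 (- a)"
  have ma: "- a \<in> unit_disc" using a by simp
  note \<tau> = Moebius_self_map(1)[OF a] and \<sigma> = Moebius_self_map(1)[OF ma]
  have M0: "?\<sigma> 0 = a" "?\<tau> a = 0" by (simp_all add: Moebius_function_of_zero Moebius_function_eq_zero)
  let ?U = "weighted_comp (\<lambda>_. 1) ?\<sigma>" and ?V = "weighted_comp (\<lambda>_. 1) ?\<tau>"
  define \<psi>' where "\<psi>' = (\<lambda>z. \<psi> (?\<sigma> z))"
  define \<phi>' where "\<phi>' = (\<lambda>z. ?\<tau> (\<phi> (?\<sigma> z)))"
  let ?T' = "weighted_comp \<psi>' \<phi>'"
  have conj: "?T' f = ?U (?T (?V f))" for f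
    unfolding \<psi>'_def \<phi>'_def by (rule weighted_comp_Moebius_conjugate[OF a \<phi>(1), symmetric])
  have U: "bounded_operator \<alpha> ?U" and V: "bounded_operator \<alpha> ?V"
    by (rule bounded_operator_Moebius_comp[OF ma \<alpha>], rule bounded_operator_Moebius_comp[OF a \<alpha>])
  have T': "bounded_operator \<alpha> ?T'"
    using bounded_operator_comp[OF U bounded_operator_comp[OF bT V]] unfolding conj[symmetric] .
  have UV: "?U (?V f) = f" if "f \<in> dirichlet_space \<alpha>" for f
    using weighted_comp_Moebius_inverse[OF ma dirichlet_spaceD(1)[OF that]] by simp
  have VU: "?V (?U f) = f" if "f \<in> dirichlet_space \<alpha>" for f
    by (rule weighted_comp_Moebius_inverse[OF a dirichlet_spaceD(1)[OF that]])
  have spec: "operator_spectrum \<alpha> ?T = operator_spectrum \<alpha> ?T'"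
    by (rule operator_spectrum_conjugate[of \<alpha> ?T ?T' ?U ?V]) (fact bT T' U V UV VU | rule conj)+
  have \<phi>'self: "holomorphic_self_map \<phi>'"
    unfolding \<phi>'_def by (rule holomorphic_self_map_comp[OF \<tau> holomorphic_self_map_comp[OF \<phi>(1) \<sigma>]])
  have \<psi>'hol: "\<psi>' holomorphic_on unit_disc"
    unfolding \<psi>'_def by (rule holomorphic_on_comp_self_map[OF \<sigma> \<psi>])
  have at0: "\<phi>' 0 = 0" "\<psi>' 0 = \<psi> a" "deriv \<phi>' 0 = deriv \<phi> a"
    unfolding \<phi>'_def \<psi>'_def using deriv_conjugate_fixed_point[OF \<phi>(1) a assms(5)] by (simp_all add: M0 assms(5))
  interpret small_triangular_operator \<alpha> ?T' "\<lambda>n. \<psi> a * deriv \<phi> a ^ n"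
  proof
    show "bounded_operator \<alpha> ?T'" by (rule T')
    fix f n assume f: "f \<in> vanishing_subspace \<alpha> n"
    then have fD: "f \<in> dirichlet_space \<alpha>" and van: "\<And>k. k < n \<Longrightarrow> taylor_coeff f k = 0"
      by (auto simp: vanishing_subspace_def)
    note tri = weighted_comp_triangular[OF \<phi>'self at0(1) \<psi>'hol dirichlet_spaceD(2)[OF fD] van]
    show "?T' f \<in> vanishing_subspace \<alpha> n \<and> taylor_coeff (?T' f) n = \<psi> a * deriv \<phi> a ^ n * taylor_coeff f n"
      using tri bounded_operatorD(1)[OF T' fD] by (simp add: vanishing_subspace_def at0)
  next
    fix \<delta> :: real assume \<delta>: "\<delta> > 0"
    show "\<exists>n. \<forall>f \<in> vanishing_subspace \<alpha> n. dirichlet_norm \<alpha> (?T' f) \<le> \<delta> * dirichlet_norm \<alpha> f"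
      unfolding \<psi>'_def \<phi>'_def by (rule conjugate_weighted_comp_small[OF \<alpha> \<phi>(1) \<psi> a _ \<delta>]) (rule est)
  qed
  have "operator_spectrum \<alpha> ?T = {\<psi> a * deriv \<phi> a ^ n | n :: nat. True} \<union> {0}"
    unfolding spec operator_spectrum_eq by auto
  moreover have "{\<psi> a * deriv \<phi> a ^ n | n :: nat. True} \<union> {0} = {0}" if "\<psi> a = 0"
    using that by auto
  ultimately show ?thesis
    using bT norm_deriv_at_fixed_point[OF \<phi> a assms(5) \<psi> assms(8) \<alpha> lim2] by simp
qed

end
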